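(* Let $\Theta_k(n)=\frac{\Delta_k(n-1)\Delta_k(n+1)}{\Delta_k(n)^2}$. For $k\in\{1,2\}$ and all integers $n\ge 6$, \[ 4\big(1-\Theta_k(n)\big)\big(1-\Theta_k(n+1)\big)-\big(1-\Theta_k(n)\Theta_k(n+1)\big)^2>0. \]
   Context: For an integer $k\ge 0$, $\Delta_k(n)$ denotes the number of broken $k$-diamond partitions of $n$ (Andrews–Paule), defined equivalently by the generating function \[ \sum_{n\ge 0}\Delta_k(n)q^n=\prod_{n\ge1}\frac{(1-q^{2n})(1-q^{(2k+1)n})}{(1-q^n)^3(1-q^{(4k+2)n})}. \] *)

theory Defs
  imports "HOL-Analysis.Analysis" "HOL-Computational_Algebra.Formal_Power_Series"
begin

text \<open>
  Broken \<open>k\<close>-diamond partition numbers are defined by their generating function, an infinite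
  product in the ring of formal power series (which carries the coefficientwise topology).
  Since \<open>prodinf\<close> ranges over the indices \<open>i = 0, 1, \<dots>\<close>, the factor with index \<open>n \<ge> 1\<close>
  of the product appears at \<open>i = n - 1\<close>.
\<close>

definition broken_diamond_factor :: "nat \<Rightarrow> nat \<Rightarrow> real fps" where
  "broken_diamond_factor k n =
     ((1 - fps_X ^ (2 * n)) * (1 - fps_X ^ ((2 * k + 1) * n))) /
     ((1 - fps_X ^ n) ^ 3 * (1 - fps_X ^ ((4 * k + 2) * n)))"

definition broken_diamond_gf :: "nat \<Rightarrow> real fps" where
  "broken_diamond_gf k = (\<Prod>i. broken_diamond_factor k (Suc i))"

definition broken_diamond :: "nat \<Rightarrow> nat \<Rightarrow> real" (\<open>\<Delta>\<close>) where
  "\<Delta> k n = fps_nth (broken_diamond_gf k) n"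

definition broken_diamond_ratio :: "nat \<Rightarrow> nat \<Rightarrow> real" (\<open>\<Theta>\<close>) where
  "\<Theta> k n = \<Delta> k (n - 1) * \<Delta> k (n + 1) / (\<Delta> k n)\<^sup>2"

text \<open>The product converges, so \<open>prodinf\<close> above denotes its actual value.\<close>

lemma dvd_mult_minus_one:
  fixes d a b :: "'a::comm_ring_1"
  assumes "d dvd a - 1" "d dvd b - 1"
  shows "d dvd a * b - 1"
proof -
  have "a * b - 1 = (a - 1) * b + (b - 1)" by (simp add: algebra_simps)
  then show ?thesis using assms by (metis dvd_add dvd_mult2)
qed

lemma fps_X_power_dvd_minus_one:
  assumes "m \<le> j"
  shows "fps_X ^ m dvd (1 - fps_X ^ j :: real fps) - 1"
  using assms by (simp add: le_imp_power_dvd)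

lemma broken_diamond_factor_0:
  assumes "n > 0"
  shows "fps_nth (broken_diamond_factor k n) 0 = 1"
  using assms by (simp add: broken_diamond_factor_def fps_divide_unit power3_eq_cube)

lemma dvd_broken_diamond_factor_minus_one:
  assumes "n > 0"
  shows "fps_X ^ n dvd broken_diamond_factor k n - 1"
proof -
  define N :: "real fps" where "N = (1 - fps_X ^ (2 * n)) * (1 - fps_X ^ ((2 * k + 1) * n))"
  define D :: "real fps" where "D = (1 - fps_X ^ n) ^ 3 * (1 - fps_X ^ ((4 * k + 2) * n))"
  have D0: "fps_nth D 0 = 1" using assms(1) by (simp add: D_def power3_eq_cube)
  have N1: "fps_X ^ n dvd N - 1"
    unfolding N_def by (intro dvd_mult_minus_one fps_X_power_dvd_minus_one) auto
  have D1: "fps_X ^ n dvd D - 1"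
    unfolding D_def power3_eq_cube
    by (intro dvd_mult_minus_one fps_X_power_dvd_minus_one) auto
  have "broken_diamond_factor k n = N * inverse D"
    unfolding broken_diamond_factor_def N_def[symmetric] D_def[symmetric]
    using D0 by (simp add: fps_divide_unit)
  then have eq: "broken_diamond_factor k n - 1 = (N - D) * inverse D"
    using inverse_mult_eq_1'[of D] D0 by (metis left_diff_distrib zero_neq_one)
  have "N - D = (N - 1) - (D - 1)" by simp
  then have "fps_X ^ n dvd N - D" using N1 D1 by (metis dvd_diff)
  then show ?thesis unfolding eq by (rule dvd_mult2)
qed

lemma broken_diamond_has_prod:
  "(\<lambda>i. broken_diamond_factor k (Suc i)) has_prod broken_diamond_gf k"
proof -
  let ?f = "\<lambda>i. broken_diamond_factor k (Suc i)"
  have dvd: "fps_X ^ Suc i dvd ?f i - 1" for i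
    by (rule dvd_broken_diamond_factor_minus_one) simp
  have step: "fps_nth (prod ?f {..Suc m}) n = fps_nth (prod ?f {..m}) n" if "n \<le> m" for m n
  proof -
    obtain h where h: "?f (Suc m) - 1 = fps_X ^ Suc (Suc m) * h" using dvd by blast
    have "prod ?f {..Suc m} = prod ?f {..m} * (1 + (?f (Suc m) - 1))"
      by (simp only: prod.atMost_Suc add_diff_cancel_left' diff_add_cancel add.commute[of 1])
    also have "\<dots> = prod ?f {..m} + fps_X ^ Suc (Suc m) * (h * prod ?f {..m})"
      unfolding h by (simp add: algebra_simps)
    finally show ?thesis using that by (simp add: fps_X_power_mult_nth del: power_Suc)
  qed
  have const: "fps_nth (prod ?f {..m}) n = fps_nth (prod ?f {..n}) n" if "n \<le> m" for m n
    using that by (induction rule: dec_induct) (use step in auto)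
  define P where "P = Abs_fps (\<lambda>n. fps_nth (prod ?f {..n}) n)"
  have lim: "(\<lambda>n. \<Prod>i\<le>n. ?f i) \<longlonglongrightarrow> P"
  proof (rule tendsto_fpsI)
    fix n
    show "\<forall>\<^sub>F m in sequentially. fps_nth (\<Prod>i\<le>m. ?f i) n = fps_nth P n"
      using eventually_ge_at_top[of n] unfolding P_def fps_nth_Abs_fps
      by eventually_elim (rule const)
  qed
  have "fps_nth P 0 = 1" by (simp add: P_def broken_diamond_factor_0)
  then have "P \<noteq> 0" by auto
  then have "?f has_prod P" using lim by (simp add: has_prod_def raw_has_prod_def)
  then show ?thesis unfolding broken_diamond_gf_def using has_prod_unique by metis
qed

end

theory Submission
  imports Defs "HOL-Complex_Analysis.Complex_Analysis" "HOL-Real_Asymp.Real_Asymp"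
begin

text \<open>
  Let \<open>m = 2 k + 1\<close>. The generating function \<open>F (q) = E (q\<^sup>2) E (q ^ m) / (E (q) ^ 3 E (q ^ (2 m)))\<close>, where
  \<open>E (q) = (1 - q) (1 - q\<^sup>2) \<dots>\<close>, has weight \<open>-1\<close>, so the inversion formula of the eta function gives
  \<open>F (exp (- t)) = t / (2 \<pi>) exp (A / t - (m + 1) t / 24) (1 + \<dots>)\<close> with \<open>A = \<pi>\<^sup>2 (5 m - 1) / (12 m)\<close>. For
  \<open>m \<in> {3, 5}\<close> the correction in brackets is bounded after multiplication by \<open>exp (A / t)\<close>, and Cauchy's formula on a
  vertical segment yields \<open>\<Delta> k n = A\<^sup>2 / (2 \<pi>) \<Sum>j. (A x) ^ j / (j! (j + 2)!)\<close> with \<open>x = n - (m + 1) / 24\<close>, up to an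
  exponentially smaller error. This main term is a modified Bessel function of order 2 in disguise. The Riccati
  equation of its logarithmic derivative gives sharp bounds for the second differences of its logarithm, that is, for
  \<open>1 - \<Theta> k n\<close>. If two consecutive values of \<open>1 - \<Theta> k n\<close> lie in \<open>{l..r}\<close>, the claim follows from
  \<open>(r - l)\<^sup>2 + r ^ 4 < 4 l ^ 3\<close>, which the bounds satisfy for \<open>n \<ge> 700\<close>. The smaller cases are computed with
  Euler's pentagonal number theorem.
\<close>

section \<open>Pentagonal series\<close>

text \<open>With u = 1 - \<Theta> k n and v = 1 - \<Theta> k (n + 1) the claim reads (u - v)^2 + (u
  v)^2 < 2 u v (u + v): the terms of degree two collapse to a squared difference. Put w = 1 / (2
  sqrt (A x)). As u is about 4 A^2 w^3, the right side has order w^9, so an interval containing u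
  and v may have length of order w^(9/2) at most. Hence its ends must share the w^3 and w^4 terms,
  the Bessel quotient is needed to second order in 1 / z, and the relative error of the main term
  must be O(w^5). The squared length is then of order w^10 with a large constant, a gain of one
  power of w only; this makes the threshold 700 so high. The condition k \<le> 2 enters through A
  \<le> 2 pi^2 / m, that is 5 m - 1 \<le> 24: the decay exp (- 2 pi^2 / (m t)) of the first
  correction has to absorb exp (A / t). The inversion formula is first proved at rational arguments,
  where a divergent double series can be cut to rectangles that suit both orders of summation;
  analytic continuation does the rest.\<close>

definition pentagonal_sum :: "'a::comm_ring_1 \<Rightarrow> nat \<Rightarrow> 'a" where
  "pentagonal_sum q n = 1 + (\<Sum>j<n. (-1) ^ Suc j *
     (q ^ ((Suc j)\<^sup>2 + triangle j) + q ^ ((Suc j)\<^sup>2 + triangle (Suc j))))"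

text \<open>Shanks's finite form of the pentagonal theorem. The product over \<open>k..<n\<close>
  stands for the quotient of (1 - q) ... (1 - q^n) by (1 - q) ... (1 - q^k); without division it
  makes sense in every commutative ring, in particular at a power of \<open>fps_X\<close>.\<close>

definition shanks_sum :: "'a::comm_ring_1 \<Rightarrow> nat \<Rightarrow> 'a" where
  "shanks_sum q n = (\<Sum>k\<le>n. (-1) ^ k * (\<Prod>i=k..<n. 1 - q ^ Suc i) * q ^ (n * k + triangle k))"

text \<open>Induction on \<open>n\<close>: the old summands change in total by \<open>- b n\<close>,
  since everything else telescopes, and together with the new summand \<open>k = n + 1\<close> this
  is the next pair of pentagonal terms. With k = j + 1 the exponents in
  \<open>pentagonal_sum\<close> are k (3 k - 1) / 2 and k (3 k + 1) / 2.\<close>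

lemma shanks_sum_eq: "shanks_sum q n = pentagonal_sum q n"
proof (induction n)
  case 0
  show ?case by (simp add: shanks_sum_def pentagonal_sum_def)
next
  case (Suc n)
  define c where "c k = (-1) ^ k * (\<Prod>i=k..<n. 1 - q ^ Suc i) * q ^ (n * k + triangle k)" for k
  define b where "b k = c k * q ^ (Suc n + k)" for k
  \<comment> \<open>From n to n + 1 the summand is multiplied by (1 - q^(n + 1)) q^k. The splitting
    is chosen so that the middle term for \<open>k + 1\<close> cancels the last term for
    \<open>k\<close>.\<close>
  have summand: "(-1) ^ k * (\<Prod>i=k..<Suc n. 1 - q ^ Suc i) * q ^ (Suc n * k + triangle k)
      = c k - c k * (1 - q ^ k) - b k" if "k \<le> n" for k
    using that unfolding b_def c_def
    by (simp add: prod.atLeastLessThan_Suc power_add algebra_simps)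
  have c0: "c 0 * (1 - q ^ 0) = 0" by simp
  have cS: "c (Suc k) * (1 - q ^ Suc k) = - b k" if "k < n" for k
  proof -
    have "(\<Prod>i=k..<n. 1 - q ^ Suc i) = (1 - q ^ Suc k) * (\<Prod>i=Suc k..<n. 1 - q ^ Suc i)"
      using that by (rule prod.atLeast_Suc_lessThan)
    moreover have "q ^ (n * k + triangle k) * q ^ (Suc n + k) = q ^ (n * Suc k + triangle (Suc k))"
      unfolding power_add[symmetric] by (simp add: add_ac)
    moreover have "-1 * x * y * z * w = - (x * (w * y) * z)" for x y z w :: 'a
      by (simp add: algebra_simps)
    ultimately show ?thesis unfolding b_def c_def by (simp only: power_Suc[of "-1"] mult.assoc)
  qed
  have f1: "(\<Sum>k\<le>n. c k * (1 - q ^ k)) = - (\<Sum>k<n. b k)"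
    unfolding lessThan_Suc_atMost[symmetric] sum.lessThan_Suc_shift c0
    using cS by (simp add: sum_negf)
  have f2: "(\<Sum>k\<le>n. b k) = (\<Sum>k<n. b k) + b n"
    unfolding lessThan_Suc_atMost[symmetric] by simp
  have f3: "b n = (-1) ^ n * q ^ ((Suc n)\<^sup>2 + triangle n)"
  proof -
    have e: "n * n + triangle n + (Suc n + n) = (Suc n)\<^sup>2 + triangle n"
      by (simp add: power2_eq_square)
    have "q ^ (n * n + triangle n) * q ^ (Suc n + n) = q ^ ((Suc n)\<^sup>2 + triangle n)"
      unfolding power_add[symmetric] e ..
    then show ?thesis
      unfolding b_def c_def mult.assoc
      by (simp only: atLeastLessThan_empty[OF order_refl] prod.empty mult_1_left)
  qed
  have f4: "shanks_sum q (Suc n) = (\<Sum>k\<le>n. c k - c k * (1 - q ^ k) - b k)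
      + (-1) ^ Suc n * q ^ (Suc n * Suc n + triangle (Suc n))"
  proof -
    have eq: "(\<Sum>k\<le>n. (-1) ^ k * (\<Prod>i=k..<Suc n. 1 - q ^ Suc i) * q ^ (Suc n * k + triangle k)) =
        (\<Sum>k\<le>n. c k - c k * (1 - q ^ k) - b k)"
      by (intro sum.cong refl summand) simp
    show ?thesis
      unfolding shanks_sum_def sum.atMost_Suc eq
      by (simp only: atLeastLessThan_empty[OF order_refl] prod.empty mult_1_right)
  qed
  have f5: "(\<Sum>k\<le>n. c k) = shanks_sum q n"
    unfolding c_def shanks_sum_def ..
  define L where "L = (-1) ^ Suc n * q ^ (Suc n * Suc n + triangle (Suc n))"
  have "shanks_sum q (Suc n) = shanks_sum q n - b n + L"
    using f4 unfolding L_def[symmetric] sum_subtractf f1 f2 f5 by simp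
  also have "L = (-1) ^ Suc n * q ^ ((Suc n)\<^sup>2 + triangle (Suc n))"
    unfolding L_def power2_eq_square ..
  also have "s - b n + (-1) ^ Suc n * y = s + (-1) ^ Suc n * (q ^ ((Suc n)\<^sup>2 + triangle n) + y)" for s y
    unfolding f3 by (simp add: algebra_simps del: triangle_Suc)
  finally have "shanks_sum q (Suc n) = shanks_sum q n + (-1) ^ Suc n *
       (q ^ ((Suc n)\<^sup>2 + triangle n) + q ^ ((Suc n)\<^sup>2 + triangle (Suc n)))" .
  then show ?case unfolding Suc.IH by (simp add: pentagonal_sum_def)
qed

text \<open>Modulo \<open>q ^ (n + 1)\<close> only the summand \<open>k = 0\<close> of the sum survives.\<close>

lemma euler_pentagonal_dvd:
  "q ^ Suc n dvd (\<Prod>i<n. 1 - q ^ Suc i) - pentagonal_sum q n"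
proof -
  have "shanks_sum q n = (\<Prod>i<n. 1 - q ^ Suc i) +
      (\<Sum>k<n. (-1) ^ Suc k * (\<Prod>i=Suc k..<n. 1 - q ^ Suc i) * q ^ (n * Suc k + triangle (Suc k)))"
    unfolding shanks_sum_def lessThan_Suc_atMost[symmetric] sum.lessThan_Suc_shift
    by (simp add: atLeast0LessThan)
  moreover have "q ^ Suc n dvd (\<Sum>k<n. (-1) ^ Suc k * (\<Prod>i=Suc k..<n. 1 - q ^ Suc i) * q ^ (n * Suc k + triangle (Suc k)))"
    by (intro dvd_sum dvd_mult le_imp_power_dvd) auto
  ultimately show ?thesis
    unfolding shanks_sum_eq[symmetric] by (simp del: power_Suc)
qed

lemma fps_X_power_dvd_iff:
  fixes f :: "'a::comm_ring_1 fps"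
  shows "fps_X ^ n dvd f \<longleftrightarrow> (\<forall>i<n. fps_nth f i = 0)"
proof
  assume "fps_X ^ n dvd f"
  then obtain g where "f = fps_X ^ n * g" by blast
  then show "\<forall>i<n. fps_nth f i = 0" by (simp add: fps_X_power_mult_nth)
next
  assume *: "\<forall>i<n. fps_nth f i = 0"
  have "f = fps_X ^ n * Abs_fps (\<lambda>i. fps_nth f (i + n))"
    using * by (intro fps_ext) (auto simp: fps_X_power_mult_nth)
  then show "fps_X ^ n dvd f" by (metis dvd_triv_left)
qed

text \<open>Reading degree \<open>n\<close> off the partial sum with \<open>n\<close> pairs is safe
  for \<open>d > 0\<close>: all later exponents are at least d (n + 1)^2 > n. The ring is left open
  because real coefficients are needed for \<open>\<Delta>\<close> and complex ones for Cauchy's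
  formula.\<close>

definition pentagonal_fps :: "nat \<Rightarrow> 'a::comm_ring_1 fps" where
  "pentagonal_fps d = Abs_fps (\<lambda>n. fps_nth (pentagonal_sum (fps_X ^ d) n) n)"

lemma pentagonal_sum_nth_stable:
  assumes "d > 0" "n \<le> N"
  shows "fps_nth (pentagonal_sum (fps_X ^ d :: 'a::comm_ring_1 fps) N) n = fps_nth (pentagonal_fps d) n"
  using assms(2)
proof (induction rule: dec_induct)
  case base
  show ?case by (simp add: pentagonal_fps_def)
next
  case (step N)
  have "n < d * ((Suc N)\<^sup>2 + t)" for t
  proof -
    have "n < Suc N" using step by simp
    also have "Suc N = 1 * Suc N" by simp
    also have "1 * Suc N \<le> d * ((Suc N)\<^sup>2 + t)"
      using assms(1) by (intro mult_le_mono) (auto simp: power2_eq_square)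
    finally show ?thesis .
  qed
  then have "fps_nth (fps_X ^ (d * ((Suc N)\<^sup>2 + t)) :: 'a fps) n = 0" for t
    by (metis fps_X_power_nth nat_neq_iff)
  moreover have "fps_nth ((-1) ^ k * h) n = (-1) ^ k * fps_nth h n" for h :: "'a fps" and k
    by (cases "even k") auto
  ultimately have "fps_nth (pentagonal_sum (fps_X ^ d :: 'a fps) (Suc N)) n = fps_nth (pentagonal_sum (fps_X ^ d) N) n"
    unfolding pentagonal_sum_def by (simp only: sum.lessThan_Suc fps_add_nth power_mult[symmetric]) simp
  then show ?case using step by simp
qed

theorem euler_pentagonal_fps:
  assumes "d > 0"
  shows "(\<lambda>N. \<Prod>i<N. 1 - (fps_X ^ d :: 'a::comm_ring_1 fps) ^ Suc i) \<longlonglongrightarrow> pentagonal_fps d"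
  unfolding tendsto_fps_iff
proof
  fix n
  have "fps_nth (\<Prod>i<N. 1 - (fps_X ^ d :: 'a fps) ^ Suc i) n = fps_nth (pentagonal_fps d) n" if "n \<le> N" for N
  proof -
    have "fps_X ^ (d * Suc N) dvd (\<Prod>i<N. 1 - (fps_X ^ d :: 'a fps) ^ Suc i) - pentagonal_sum (fps_X ^ d) N"
      using euler_pentagonal_dvd[of "fps_X ^ d :: 'a fps" N] by (simp only: power_mult)
    moreover have "n < d * Suc N" using that assms by (cases d) auto
    ultimately have "fps_nth ((\<Prod>i<N. 1 - (fps_X ^ d :: 'a fps) ^ Suc i) - pentagonal_sum (fps_X ^ d) N) n = 0"
      unfolding fps_X_power_dvd_iff by blast
    then show ?thesis using pentagonal_sum_nth_stable[OF assms that, where 'a='a] by simp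
  qed
  then show "\<forall>\<^sub>F N in sequentially. fps_nth (\<Prod>i<N. 1 - (fps_X ^ d :: 'a fps) ^ Suc i) n = fps_nth (pentagonal_fps d) n"
    unfolding eventually_sequentially by blast
qed

lemma tendsto_fps_mult:
  fixes f g :: "'b \<Rightarrow> 'a::comm_ring_1 fps"
  assumes "(f \<longlongrightarrow> F) net" "(g \<longlongrightarrow> G) net"
  shows "((\<lambda>x. f x * g x) \<longlongrightarrow> F * G) net"
  unfolding tendsto_fps_iff
proof
  fix n
  have "\<forall>\<^sub>F x in net. \<forall>i\<in>{..n}. fps_nth (f x) i = fps_nth F i"
    using assms(1) by (intro eventually_ball_finite) (auto simp: tendsto_fps_iff)
  moreover have "\<forall>\<^sub>F x in net. \<forall>i\<in>{..n}. fps_nth (g x) i = fps_nth G i"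
    using assms(2) by (intro eventually_ball_finite) (auto simp: tendsto_fps_iff)
  ultimately show "\<forall>\<^sub>F x in net. fps_nth (f x * g x) n = fps_nth (F * G) n"
    by eventually_elim (simp add: fps_mult_nth)
qed

text \<open>The denominators are cleared because this form serves twice: to recognise the Taylor
  series of the analytic product, and to compute coefficients by multiplying and dividing by sparse
  series.\<close>

lemma broken_diamond_gf_identity:
  "broken_diamond_gf k * (pentagonal_fps 1 ^ 3 * pentagonal_fps (4 * k + 2)) = pentagonal_fps 2 * pentagonal_fps (2 * k + 1)"
proof -
  let ?E = "\<lambda>d N. \<Prod>i<N. 1 - (fps_X ^ d :: real fps) ^ Suc i"
  let ?F = "\<lambda>N. \<Prod>i<N. broken_diamond_factor k (Suc i)"
  have eq: "?F N * (?E 1 N ^ 3 * ?E (4 * k + 2) N) = ?E 2 N * ?E (2 * k + 1) N" for N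
  proof -
    have "broken_diamond_factor k (Suc i) * ((1 - (fps_X ^ 1) ^ Suc i) ^ 3 * (1 - (fps_X ^ (4 * k + 2)) ^ Suc i)) =
      (1 - (fps_X ^ 2) ^ Suc i) * (1 - (fps_X ^ (2 * k + 1)) ^ Suc i)" for i
    proof -
      have "fps_nth ((1 - fps_X ^ Suc i) ^ 3 * (1 - fps_X ^ ((4 * k + 2) * Suc i)) :: real fps) 0 = 1"
        by (simp add: power3_eq_cube)
      then show ?thesis
        unfolding broken_diamond_factor_def power_mult[symmetric]
        by (simp add: fps_divide_unit mult.assoc inverse_mult_eq_1 del: power_Suc)
    qed
    then show ?thesis unfolding prod_power_distrib prod.distrib[symmetric] by simp
  qed
  have F: "?F \<longlonglongrightarrow> broken_diamond_gf k"
  proof -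
    have "broken_diamond_factor k (Suc i) \<noteq> 0" for i
      using broken_diamond_factor_0[of "Suc i" k] by auto
    then have "raw_has_prod (\<lambda>i. broken_diamond_factor k (Suc i)) 0 (broken_diamond_gf k)"
      using broken_diamond_has_prod[of k] unfolding has_prod_def by blast
    then have "(\<lambda>N. \<Prod>i<Suc N. broken_diamond_factor k (Suc i)) \<longlonglongrightarrow> broken_diamond_gf k"
      by (simp add: raw_has_prod_def lessThan_Suc_atMost)
    then show ?thesis by (rule filterlim_sequentially_Suc[THEN iffD1])
  qed
  have "(\<lambda>N. ?F N * (?E 1 N ^ 3 * ?E (4 * k + 2) N)) \<longlonglongrightarrow> broken_diamond_gf k * (pentagonal_fps 1 ^ 3 * pentagonal_fps (4 * k + 2))"
    unfolding power3_eq_cube by (intro tendsto_fps_mult F euler_pentagonal_fps) auto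
  moreover have "(\<lambda>N. ?E 2 N * ?E (2 * k + 1) N) \<longlonglongrightarrow> pentagonal_fps 2 * pentagonal_fps (2 * k + 1)"
    by (intro tendsto_fps_mult euler_pentagonal_fps) auto
  ultimately show ?thesis unfolding eq by (rule LIMSEQ_unique)
qed

section \<open>Inversion of the Euler product\<close>

lemma Digamma_reflection_complex:
  fixes z :: complex
  assumes "z \<notin> \<int>"
  shows "Digamma (1 - z) - Digamma z = of_real pi * cot (of_real pi * z)"
proof -
  have nz: "z \<notin> \<int>\<^sub>\<le>\<^sub>0" "1 - z \<notin> \<int>\<^sub>\<le>\<^sub>0"
    using assms by (auto elim!: nonpos_Ints_cases)
      (metis Ints_1 Ints_diff Ints_of_int add_diff_cancel_left' diff_add_cancel)
  have s: "sin (of_real pi * z) \<noteq> 0"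
    using assms by (auto simp: sin_eq_0)
  have rz: "rGamma z \<noteq> 0" "rGamma (1 - z) \<noteq> 0"
    using nz by (auto simp: rGamma_eq_zero_iff)
  \<comment> \<open>Both sides of rGamma w rGamma (1 - w) = sin (pi w) / pi are differentiated;
    working with the entire function \<open>rGamma\<close> avoids any choice of a logarithm.\<close>
  have 1: "((\<lambda>w. rGamma w * rGamma (1 - w)) has_field_derivative
      (rGamma z * rGamma (1 - z) * (Digamma (1 - z) - Digamma z))) (at z)"
    using nz by (auto intro!: derivative_eq_intros simp: algebra_simps)
  have 2: "((\<lambda>w. sin (of_real pi * w) / of_real pi) has_field_derivative cos (of_real pi * z)) (at z)"
    by (auto intro!: derivative_eq_intros)
  have "rGamma z * rGamma (1 - z) * (Digamma (1 - z) - Digamma z) = cos (of_real pi * z)"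
    using DERIV_unique[OF 1] 2 by (simp add: rGamma_reflection_complex)
  then have "sin (of_real pi * z) / of_real pi * (Digamma (1 - z) - Digamma z) = cos (of_real pi * z)"
    by (simp add: rGamma_reflection_complex)
  then show ?thesis using s by (simp add: cot_def field_simps)
qed

text \<open>The difference of the series for Digamma (1 - z) and Digamma z pairs the pole at - n
  with the pole at n + 1. A telescoping series shifts one family by one, so that the poles at n + 1
  and - (n + 1) meet in one term and the pole at 0 splits off.\<close>

lemma cot_partial_fractions:
  fixes z :: complex
  assumes "z \<notin> \<int>"
  shows "(\<lambda>n. 2 * z / (z\<^sup>2 - of_nat (Suc n) ^ 2)) sums (of_real pi * cot (of_real pi * z) - 1 / z)"
proof -
  have z: "z \<noteq> 0" "1 - z \<noteq> 0" using assms by auto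
  have nz: "of_nat n + z \<noteq> 0" "of_nat n - z \<noteq> 0" for n
    using assms by (metis Ints_minus Ints_of_nat add_eq_0_iff, metis Ints_of_nat eq_iff_diff_eq_0)
  have "(\<lambda>n. (inverse (of_nat (Suc n)) - inverse (1 - z + of_nat n)) -
          (inverse (of_nat (Suc n)) - inverse (z + of_nat n)))
        sums ((Digamma (1 - z) + of_real euler_mascheroni) - (Digamma z + of_real euler_mascheroni))"
    using summable_sums[OF summable_Digamma[OF z(2)]] summable_sums[OF summable_Digamma[OF z(1)]]
    by (intro sums_diff) (simp_all add: Digamma_def)
  then have 1: "(\<lambda>n. inverse (z + of_nat n) - inverse (1 - z + of_nat n)) sums
      (of_real pi * cot (of_real pi * z))"
    using Digamma_reflection_complex[OF assms] by simp
  have 2: "(\<lambda>n. inverse (z + of_nat (Suc n)) - inverse (z + of_nat n)) sums (0 - inverse (z + of_nat 0))"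
    by (intro telescope_sums filterlim_compose[OF tendsto_inverse_0]
              tendsto_add_filterlim_at_infinity[OF tendsto_const] tendsto_of_nat)
  have "(\<lambda>n. inverse (z + of_nat (Suc n)) - inverse (1 - z + of_nat n)) sums
      (of_real pi * cot (of_real pi * z) - 1 / z)"
    using sums_add[OF 1 2] by (simp add: inverse_eq_divide)
  moreover have "inverse (z + of_nat (Suc n)) - inverse (1 - z + of_nat n)
      = 2 * z / (z\<^sup>2 - of_nat (Suc n) ^ 2)" for n
  proof -
    have "z\<^sup>2 - of_nat (Suc n) ^ 2 = - ((of_nat (Suc n) + z) * (of_nat (Suc n) - z))"
      by (simp add: power2_eq_square algebra_simps)
    moreover have "inverse (a + z) - inverse (a - z) = - (2 * z / ((a + z) * (a - z)))"
      if "a + z \<noteq> 0" "a - z \<noteq> 0" for a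
      using that by (simp add: field_simps)
    moreover have "z + of_nat (Suc n) = of_nat (Suc n) + z" "1 - z + of_nat n = of_nat (Suc n) - z"
      by simp_all
    ultimately show ?thesis
      using nz[of "Suc n"] by (metis minus_divide_right)
  qed
  ultimately show ?thesis by simp
qed

lemma coth_partial_fractions_real:
  fixes x :: real
  assumes "x > 0"
  shows "(\<lambda>n. 2 * x / (x\<^sup>2 + real (Suc n) ^ 2)) sums
           (2 * pi / (exp (2 * pi * x) - 1) + pi - 1 / x)"
proof -
  let ?z = "\<i> * of_real x"
  have nz: "?z \<notin> \<int>" using assms by (auto elim!: Ints_cases simp: complex_eq_iff)
  have eq: "\<i> * (2 * ?z / (?z\<^sup>2 - of_nat (Suc n) ^ 2)) = of_real (2 * x / (x\<^sup>2 + real (Suc n) ^ 2))" for n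
  proof -
    have "?z\<^sup>2 - of_nat (Suc n) ^ 2 = - of_real (x\<^sup>2 + real (Suc n) ^ 2)"
      by (simp add: power_mult_distrib)
    moreover have "\<i> * (2 * ?z) = - of_real (2 * x)" by simp
    ultimately show ?thesis
      unfolding times_divide_eq_right of_real_divide by (metis minus_divide_divide)
  qed
  have "\<i> * (of_real pi * cot (of_real pi * ?z) - 1 / ?z)
      = of_real (2 * pi / (exp (2 * pi * x) - 1) + pi - 1 / x)"
  proof -
    let ?y = "of_real (pi * x) :: complex"
    have e: "exp (2 * pi * x) \<noteq> 1" using assms by simp
    have ez: "\<i> * (of_real pi * ?z) = - ?y" by (simp add: algebra_simps)
    have c: "cos (of_real pi * ?z) = (exp (- ?y) + exp ?y) / 2"
      unfolding cos_exp_eq ez by simp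
    have s: "sin (of_real pi * ?z) = (exp (- ?y) - exp ?y) / (2 * \<i>)"
      unfolding sin_exp_eq ez by simp
    have E: "exp ?y * exp ?y = of_real (exp (2 * pi * x))"
      by (simp add: exp_of_real[symmetric] mult_exp_exp mult.assoc)
    have ne: "exp ?y \<noteq> 0" by simp
    have "\<i> * cot (of_real pi * ?z) = of_real (1 + 2 / (exp (2 * pi * x) - 1))"
    proof -
      let ?e = "of_real (exp (2 * pi * x)) :: complex"
      have e1: "?e \<noteq> 1" using e by (metis of_real_eq_1_iff)
      have "exp ?y * exp ?y - 1 \<noteq> 0" using e1 E by simp
      have half: "\<i> * ((u / 2) / (v / (2 * \<i>))) = - u / v" for u v :: complex
        by (cases "v = 0") (simp_all add: divide_simps)
      have "\<i> * cot (of_real pi * ?z) = - (exp (- ?y) + exp ?y) / (exp (- ?y) - exp ?y)"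
        unfolding cot_def c s by (rule half)
      also have "\<dots> = (1 + exp ?y * exp ?y) / (exp ?y * exp ?y - 1)"
        using ne e1 E unfolding exp_minus by (simp add: divide_simps) (simp add: algebra_simps)
      also have "\<dots> = 1 + 2 / (?e - 1)" unfolding E using e1 by (simp add: field_simps)
      finally show ?thesis by simp
    qed
    then have "\<i> * (of_real pi * cot (of_real pi * ?z)) = of_real (pi * (1 + 2 / (exp (2 * pi * x) - 1)))"
      by (metis (no_types, lifting) mult.left_commute of_real_mult)
    moreover have "\<i> * (1 / ?z) = of_real (1 / x)" using assms by simp
    ultimately have "\<i> * (of_real pi * cot (of_real pi * ?z) - 1 / ?z)
      = of_real (pi * (1 + 2 / (exp (2 * pi * x) - 1)) - 1 / x)"
      by (simp only: right_diff_distrib of_real_diff)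
    then show ?thesis by (simp add: algebra_simps)
  qed
  with sums_mult[OF cot_partial_fractions[OF nz], of \<i>]
  have "(\<lambda>n. complex_of_real (2 * x / (x\<^sup>2 + real (Suc n) ^ 2))) sums
      complex_of_real (2 * pi / (exp (2 * pi * x) - 1) + pi - 1 / x)"
    unfolding eq by simp
  then show ?thesis by (simp only: sums_of_real_iff)
qed

section \<open>A lattice sum in two orders of summation\<close>

definition lattice_term :: "real \<Rightarrow> nat \<Rightarrow> nat \<Rightarrow> real" where
  "lattice_term a m l = (a / pi) / (a\<^sup>2 * real m ^ 2 + real l ^ 2)"

lemma lattice_term_swap:
  assumes "a > 0"
  shows "lattice_term (1 / a) l m = lattice_term a m l"
proof (cases "m = 0 \<and> l = 0")
  case False
  then have "a\<^sup>2 * real m ^ 2 + real l ^ 2 > 0"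
    using assms by (auto simp: add_nonneg_pos add_pos_nonneg)
  moreover have "a\<^sup>2 * real m ^ 2 + real l ^ 2 = a\<^sup>2 * ((1 / a)\<^sup>2 * real l ^ 2 + real m ^ 2)"
    using assms by (simp add: field_simps)
  ultimately show ?thesis
    using assms unfolding lattice_term_def by (simp add: field_simps power2_eq_square)
qed (simp add: lattice_term_def)

text \<open>The three parts behave differently when summed over \<open>m\<close>: the first gives
  the Lambert series, the second diverges and is removed in \<open>lattice_rows\<close>, and the
  third gives - pi / (12 a).\<close>

lemma lattice_row_sums:
  assumes "a > 0" "m > 0"
  shows "(\<lambda>l. lattice_term a m (Suc l)) sums
           (1 / (real m * (exp (2 * pi * a * real m) - 1)) + 1 / (2 * real m) - 1 / (2 * pi * a * real m ^ 2))"
proof -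
  let ?x = "a * real m"
  have x: "?x > 0" using assms by simp
  have e: "exp (2 * pi * ?x) - 1 > 0" using x by simp
  from sums_mult[OF coth_partial_fractions_real[OF x], of "1 / (2 * pi * real m)"]
  have "(\<lambda>n. 1 / (2 * pi * real m) * (2 * ?x / (?x\<^sup>2 + real (Suc n) ^ 2))) sums
      (1 / (2 * pi * real m) * (2 * pi / (exp (2 * pi * ?x) - 1) + pi - 1 / ?x))" .
  moreover have "1 / (2 * pi * real m) * (2 * ?x / (?x\<^sup>2 + real (Suc n) ^ 2)) = lattice_term a m (Suc n)" for n
    using assms unfolding lattice_term_def by (simp add: power_mult_distrib field_simps)
  moreover have "1 / (2 * pi * real m) * (2 * pi / (exp (2 * pi * ?x) - 1) + pi - 1 / ?x)
      = 1 / (real m * (exp (2 * pi * a * real m) - 1)) + 1 / (2 * real m) - 1 / (2 * pi * a * real m ^ 2)"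
    using e assms by (simp add: field_simps power2_eq_square)
  ultimately show ?thesis by simp
qed

text \<open>If a N = L, the integral that approximates the tail of row \<open>m\<close> is arctan (m
  / N) / (pi m), whatever \<open>a\<close> is. The sum over the rows is a Riemann sum of arctan x /
  (pi x) on the unit interval.\<close>

definition arctan_sum :: "nat \<Rightarrow> real" where
  "arctan_sum N = (\<Sum>m=1..N. arctan (real m / real N) / (pi * real m))"

text \<open>The tail of a row is compared with the integral of \<open>a / \<pi> / (a\<^sup>2 m\<^sup>2 + y\<^sup>2)\<close> over \<open>y \<ge> L\<close>.\<close>

lemma lattice_row_tail:
  assumes "a > 0" "m > 0" "L > 0"
  shows "(\<Sum>l. lattice_term a m (Suc (l + L))) \<le> arctan (a * real m / real L) / (pi * real m)"
    and "arctan (a * real m / real L) / (pi * real m) - lattice_term a m L \<le> (\<Sum>l. lattice_term a m (Suc (l + L)))"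
proof -
  let ?\<phi> = "\<lambda>y. arctan (y / (a * real m)) / (pi * real m)"
  let ?d = "\<lambda>y. (a / pi) / (a\<^sup>2 * real m ^ 2 + y\<^sup>2)"
  have d: "(?\<phi> has_real_derivative ?d y) (at y)" for y
  proof -
    have p: "a\<^sup>2 * real m ^ 2 + y\<^sup>2 > 0" using assms by (simp add: add_pos_nonneg)
    have "1 + (y / (a * real m))\<^sup>2 = (a\<^sup>2 * real m ^ 2 + y\<^sup>2) / (a * real m)\<^sup>2"
      using assms by (simp add: field_simps)
    moreover have "inverse (q / (a * real m)\<^sup>2) * (1 / (a * real m)) / (pi * real m) = (a / pi) / q"
      if "q > 0" for q
      using assms that by (simp add: field_simps power2_eq_square)
    ultimately have "inverse (1 + (y / (a * real m))\<^sup>2) * (1 / (a * real m)) / (pi * real m) = ?d y"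
      using p by presburger
    moreover have "(?\<phi> has_real_derivative inverse (1 + (y / (a * real m))\<^sup>2) * (1 / (a * real m)) / (pi * real m)) (at y)"
      using assms by (auto intro!: derivative_eq_intros)
    ultimately show ?thesis by metis
  qed
  have step: "lattice_term a m (Suc l) \<le> ?\<phi> (real (Suc l)) - ?\<phi> (real l) \<and>
              ?\<phi> (real (Suc l)) - ?\<phi> (real l) \<le> lattice_term a m l" for l
  proof -
    obtain z where z: "real l < z" "z < real (Suc l)" and eq: "?\<phi> (real (Suc l)) - ?\<phi> (real l) = (real (Suc l) - real l) * ?d z"
      using MVT2[of "real l" "real (Suc l)" ?\<phi> ?d] d by auto
    have "z\<^sup>2 \<le> real (Suc l) ^ 2" "real l ^ 2 \<le> z\<^sup>2" using z by (auto intro!: power_mono)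
    moreover have "a\<^sup>2 * real m ^ 2 > 0" using assms by simp
    ultimately have "?d z \<ge> ?d (real (Suc l))" "?d z \<le> ?d (real l)"
      using assms by (auto intro!: divide_left_mono mult_pos_pos add_pos_nonneg)
    then show ?thesis unfolding eq lattice_term_def by simp
  qed
  define c where "c = a * real m"
  have c: "c > 0" using assms by (simp add: c_def)
  have "filterlim (\<lambda>l. real (l + L) / c) at_top sequentially" using c by real_asymp
  then have lim: "(\<lambda>l. ?\<phi> (real (l + L))) \<longlonglongrightarrow> (pi / 2) / (pi * real m)"
    unfolding c_def[symmetric] using assms
    by (intro tendsto_divide tendsto_const filterlim_compose[OF tendsto_arctan_at_top]) auto
  have "arctan (1 / (real L / c)) = pi / 2 - arctan (real L / c)"
    using arctan_inverse[of "real L / c"] c assms by (simp add: sgn_if)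
  then have val: "(pi / 2) / (pi * real m) - ?\<phi> (real L) = arctan (a * real m / real L) / (pi * real m)"
    unfolding c_def[symmetric] by (simp add: diff_divide_distrib)
  have s1: "(\<lambda>l. ?\<phi> (real (Suc l + L)) - ?\<phi> (real (l + L))) sums (arctan (a * real m / real L) / (pi * real m))"
    using telescope_sums[OF lim] unfolding add_0 val .
  have s2: "summable (\<lambda>l. lattice_term a m (Suc (l + k)))" for k
    using summable_ignore_initial_segment[OF sums_summable[OF lattice_row_sums[OF assms(1,2)]], of k] by simp
  show "(\<Sum>l. lattice_term a m (Suc (l + L))) \<le> arctan (a * real m / real L) / (pi * real m)"
    by (rule sums_le[OF _ summable_sums[OF s2] s1]) (metis step add_Suc)
  have s3: "(\<lambda>l. lattice_term a m (l + L)) sums ((\<Sum>l. lattice_term a m (Suc (l + L))) + lattice_term a m L)"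
    using summable_sums[OF s2[of L]] sums_Suc_iff[of "\<lambda>l. lattice_term a m (l + L)"] by simp
  show "arctan (a * real m / real L) / (pi * real m) - lattice_term a m L \<le> (\<Sum>l. lattice_term a m (Suc (l + L)))"
    using sums_le[OF _ s1 s3] step[of "_ + L"] unfolding add_Suc diff_le_eq by blast
qed

definition lattice_corner :: "real \<Rightarrow> nat \<Rightarrow> nat \<Rightarrow> real" where
  "lattice_corner a N L = (\<Sum>m=1..N. \<Sum>l. lattice_term a m (Suc (l + L)))"

text \<open>Each of the \<open>N\<close> rows differs from its integral by at most its term at
  column \<open>L\<close>, which is at most 1 / (a pi N^2).\<close>

lemma lattice_corner_estimate:
  assumes "a > 0" "N > 0" "a * real N = real L"
  shows "\<bar>lattice_corner a N L - arctan_sum N\<bar> \<le> 1 / (a * pi * real N)"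
proof -
  have L: "L > 0" using assms by (metis mult_pos_pos of_nat_0_less_iff)
  have eq: "a * real m / real L = real m / real N" for m
    using assms(1,2) by (simp add: assms(3)[symmetric])
  have b: "lattice_term a m L \<le> 1 / (a * pi * real N ^ 2)" for m
  proof -
    have "lattice_term a m L \<le> (a / pi) / (real L ^ 2)"
      unfolding lattice_term_def using assms(1) L by (intro divide_left_mono) (auto intro!: mult_pos_pos add_nonneg_pos)
    also have "\<dots> = 1 / (a * pi * real N ^ 2)"
      using assms(1,2) by (simp add: assms(3)[symmetric] field_simps power2_eq_square)
    finally show ?thesis .
  qed
  have "\<bar>lattice_corner a N L - arctan_sum N\<bar> \<le> (\<Sum>m=1..N. \<bar>(\<Sum>l. lattice_term a m (Suc (l + L))) - arctan (real m / real N) / (pi * real m)\<bar>)"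
    unfolding lattice_corner_def arctan_sum_def sum_subtractf[symmetric] by (rule sum_abs)
  also have "\<dots> \<le> (\<Sum>m=1..N. 1 / (a * pi * real N ^ 2))"
  proof (rule sum_mono)
    fix m assume "m \<in> {1..N}"
    then have "m > 0" by simp
    from lattice_row_tail[OF assms(1) this L] b[of m]
    show "\<bar>(\<Sum>l. lattice_term a m (Suc (l + L))) - arctan (real m / real N) / (pi * real m)\<bar> \<le> 1 / (a * pi * real N ^ 2)"
      unfolding eq by linarith
  qed
  also have "\<dots> = 1 / (a * pi * real N)" using assms by (simp add: power2_eq_square)
  finally show ?thesis .
qed

text \<open>Convergence alone is enough: both orders of summation produce the same limit for their
  corners, and it cancels before its value matters.\<close>

lemma riemann_sum_convergent:
  fixes \<phi> :: "real \<Rightarrow> real"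
  assumes "continuous_on {0..1} \<phi>"
  shows "convergent (\<lambda>N. \<Sum>m=1..N. \<phi> (real m / real N) / real N)"
proof -
  obtain \<Psi> where \<Psi>: "\<And>x. x \<in> {0..1} \<Longrightarrow> (\<Psi> has_vector_derivative \<phi> x) (at x within {0..1})"
    using antiderivative_continuous[OF assms] by blast
  have "(\<lambda>N. \<Sum>m=1..N. \<phi> (real m / real N) / real N) \<longlonglongrightarrow> \<Psi> 1 - \<Psi> 0"
  proof (rule LIMSEQ_I)
    fix e :: real assume e: "e > 0"
    have "uniformly_continuous_on {0..1} \<phi>" using assms by (intro compact_uniformly_continuous) auto
    then obtain d where d: "d > 0" "\<And>x y. x \<in> {0..1} \<Longrightarrow> y \<in> {0..1} \<Longrightarrow> dist y x < d \<Longrightarrow> dist (\<phi> y) (\<phi> x) < e / 2"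
      unfolding uniformly_continuous_on_def using e by (metis half_gt_zero)
    obtain N0 where N0: "real N0 > 1 / d" using reals_Archimedean2 by blast
    show "\<exists>no. \<forall>N\<ge>no. norm ((\<Sum>m=1..N. \<phi> (real m / real N) / real N) - (\<Psi> 1 - \<Psi> 0)) < e"
    proof (intro exI allI impI)
      fix N assume N: "N0 + 1 \<le> N"
      then have Np: "real N > 0" "1 / real N < d"
        using N0 d(1) by (auto simp: field_simps intro: less_le_trans)
      have step: "\<bar>\<phi> (real (Suc m) / real N) / real N - (\<Psi> (real (Suc m) / real N) - \<Psi> (real m / real N))\<bar> \<le> e / 2 / real N"
        if "m < N" for m
      proof -
        let ?u = "real m / real N" and ?v = "real (Suc m) / real N"
        have uv: "?u \<le> ?v" "0 \<le> ?u" "?v \<le> 1" "?v - ?u = 1 / real N"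
          using that Np by (auto simp: field_simps)
        have sub: "{?u..?v} \<subseteq> {0..1}" using uv by auto
        have der: "(\<Psi> has_derivative (\<lambda>h. h *\<^sub>R \<phi> x)) (at x within {?u..?v})"
          if "?u \<le> x" "x \<le> ?v" for x
        proof -
          have "x \<in> {0..1}" using subsetD[OF sub, of x] that by simp
          from has_vector_derivative_within_subset[OF \<Psi>[OF this] sub] show ?thesis
            by (simp add: has_vector_derivative_def)
        qed
        obtain x where x: "x \<in> {?u..?v}" "\<Psi> ?v - \<Psi> ?u = (?v - ?u) *\<^sub>R \<phi> x"
          using mvt_very_simple[OF uv(1) der] by auto
        have "dist ?v x < d" using x(1) uv(4) Np(2) by (auto simp: dist_real_def)
        then have "dist (\<phi> ?v) (\<phi> x) < e / 2" 
          using subsetD[OF sub x(1)] uv by (intro d(2)) auto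
        moreover have "\<phi> ?v / real N - (\<Psi> ?v - \<Psi> ?u) = (\<phi> ?v - \<phi> x) / real N"
          unfolding x(2) uv(4) by (simp add: diff_divide_distrib)
        ultimately show ?thesis
          using Np(1) unfolding dist_real_def by (metis abs_divide abs_of_pos divide_right_mono less_imp_le)
      qed
      have "(\<Sum>m=1..N. \<phi> (real m / real N) / real N) - (\<Psi> 1 - \<Psi> 0) =
          (\<Sum>m<N. \<phi> (real (Suc m) / real N) / real N - (\<Psi> (real (Suc m) / real N) - \<Psi> (real m / real N)))"
        using sum_lessThan_telescope[of "\<lambda>m. \<Psi> (real m / real N)" N] Np(1)
        unfolding sum_subtractf by (simp add: sum.atLeast1_atMost_eq)
      also have "\<bar>\<dots>\<bar> \<le> (\<Sum>m<N. e / 2 / real N)"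
        by (rule order_trans[OF sum_abs]) (intro sum_mono step, simp)
      also have "\<dots> = e / 2" using Np(1) by simp
      finally show "norm ((\<Sum>m=1..N. \<phi> (real m / real N) / real N) - (\<Psi> 1 - \<Psi> 0)) < e" using e by simp
    qed
  qed
  then show ?thesis by (auto simp: convergent_def)
qed

lemma arctan_sum_convergent: "convergent arctan_sum"
proof -
  define \<phi> where "\<phi> = (\<lambda>x::real. if x = 0 then 1 / pi else arctan x / (pi * x))"
  have "(arctan has_real_derivative 1) (at 0)" by (auto intro!: derivative_eq_intros)
  then have "((\<lambda>h. arctan h / h) \<longlongrightarrow> 1) (at 0)" by (simp add: has_field_derivative_iff)
  then have "((\<lambda>h. arctan h / h / pi) \<longlongrightarrow> 1 / pi) (at 0)" by (intro tendsto_intros) auto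
  then have "(\<phi> \<longlongrightarrow> 1 / pi) (at 0)"
    by (rule Lim_transform_eventually) (auto simp: \<phi>_def eventually_at_filter mult.commute)
  then have c0: "isCont \<phi> 0" by (simp add: isCont_def \<phi>_def)
  have c: "isCont \<phi> x" if "x \<noteq> 0" for x
  proof -
    have "isCont (\<lambda>x. arctan x / (pi * x)) x" using that by (auto intro!: continuous_intros)
    moreover have "eventually (\<lambda>y. \<phi> y = arctan y / (pi * y)) (nhds x)"
      using eventually_nhds_in_open[of "- {0}" x] that by (auto simp: \<phi>_def elim!: eventually_mono)
    ultimately show ?thesis using isCont_cong by metis
  qed
  have "continuous_on {0..1} \<phi>" using c0 c by (metis continuous_at_imp_continuous_on)
  from riemann_sum_convergent[OF this]
  have "convergent (\<lambda>N. \<Sum>m=1..N. \<phi> (real m / real N) / real N)" .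
  moreover have "(\<Sum>m=1..N. \<phi> (real m / real N) / real N) = arctan_sum N" for N
    unfolding arctan_sum_def \<phi>_def by (intro sum.cong) auto
  ultimately show ?thesis by simp
qed

text \<open>Minus the logarithm of the Euler product at exp (- 2 pi a), with the logarithms expanded
  and the sum over the factors taken first.\<close>

definition lambert_sum :: "real \<Rightarrow> real" where
  "lambert_sum a = (\<Sum>m. 1 / (real (Suc m) * (exp (2 * pi * a * real (Suc m)) - 1)))"

lemma lambert_summable:
  assumes "a > 0"
  shows "summable (\<lambda>m. 1 / (real (Suc m) * (exp (2 * pi * a * real (Suc m)) - 1)))"
proof (rule summable_comparison_test')
  show "summable (\<lambda>m. (1 / (2 * pi * a)) * (1 / (real m + 1)\<^sup>2))"
    using sums_summable[OF inverse_squares_sums] by (intro summable_mult) (simp add: add.commute)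
  fix m :: nat
  have "exp (2 * pi * a * real (Suc m)) \<ge> 1 + 2 * pi * a * real (Suc m)" by (rule exp_ge_add_one_self)
  then have "exp (2 * pi * a * real (Suc m)) - 1 \<ge> 2 * pi * a * real (Suc m)" by linarith
  moreover have p: "2 * pi * a * real (Suc m) > 0" using assms by simp
  ultimately have "1 / (real (Suc m) * (exp (2 * pi * a * real (Suc m)) - 1)) \<le> 1 / (real (Suc m) * (2 * pi * a * real (Suc m)))"
    using assms by (intro divide_left_mono mult_left_mono mult_pos_pos) auto
  also have "\<dots> = (1 / (2 * pi * a)) * (1 / (real m + 1)\<^sup>2)" using assms by (simp add: power2_eq_square add.commute)
  finally have "1 / (real (Suc m) * (exp (2 * pi * a * real (Suc m)) - 1)) \<le> (1 / (2 * pi * a)) * (1 / (real m + 1)\<^sup>2)" .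
  moreover have "1 / (real (Suc m) * (exp (2 * pi * a * real (Suc m)) - 1)) \<ge> 0"
    using p by (intro divide_nonneg_nonneg mult_nonneg_nonneg) auto
  ultimately show "norm (1 / (real (Suc m) * (exp (2 * pi * a * real (Suc m)) - 1))) \<le> (1 / (2 * pi * a)) * (1 / (real m + 1)\<^sup>2)"
    by (simp only: real_norm_def abs_of_nonneg)
qed

definition lattice_rows :: "real \<Rightarrow> nat \<Rightarrow> real" where
  "lattice_rows a N = (\<Sum>m=1..N. (\<Sum>l. lattice_term a m (Suc l)) - 1 / (2 * real m))"

lemma lattice_rows_tendsto:
  assumes "a > 0"
  shows "lattice_rows a \<longlonglongrightarrow> lambert_sum a - pi / (12 * a)"
proof -
  have "(\<lambda>m. 1 / (real (Suc m) * (exp (2 * pi * a * real (Suc m)) - 1)) - (1 / (2 * pi * a)) * (1 / (real m + 1)\<^sup>2))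
     sums (lambert_sum a - (1 / (2 * pi * a)) * (pi\<^sup>2 / 6))"
    unfolding lambert_sum_def
    using inverse_squares_sums
    by (intro sums_diff summable_sums lambert_summable assms sums_mult) (simp add: add.commute)
  moreover have "(\<Sum>l. lattice_term a (Suc m) (Suc l)) - 1 / (2 * real (Suc m)) =
      1 / (real (Suc m) * (exp (2 * pi * a * real (Suc m)) - 1)) - (1 / (2 * pi * a)) * (1 / (real m + 1)\<^sup>2)" for m
    using sums_unique[OF lattice_row_sums[OF assms, of "Suc m"]] by (simp add: add.commute)
  moreover have "(1 / (2 * pi * a)) * (pi\<^sup>2 / 6) = pi / (12 * a)" by (simp add: power2_eq_square)
  ultimately have "(\<lambda>m. (\<Sum>l. lattice_term a (Suc m) (Suc l)) - 1 / (2 * real (Suc m))) sums (lambert_sum a - pi / (12 * a))"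
    by simp
  then show ?thesis
    unfolding sums_def lattice_rows_def by (simp add: sum.atLeast1_atMost_eq)
qed

text \<open>Both harmonic sums are compared with logarithms and Euler's constant cancels. This limit
  is the source of the factor sqrt a in the inversion formula. \<open>Suc M\<close> keeps the
  logarithms away from 0.\<close>

lemma harmonic_difference:
  assumes "p > 0" "q > 0"
  shows "(\<lambda>M. (\<Sum>m=1..p * Suc M. 1 / real m) - (\<Sum>m=1..q * Suc M. 1 / real m)) \<longlonglongrightarrow> ln (real p / real q)"
proof -
  have sm: "strict_mono (\<lambda>M. r * Suc M)" if "r > 0" for r :: nat
    using that by (auto simp: strict_mono_def)
  have h: "(\<lambda>M. (\<Sum>m=1..r * Suc M. 1 / real m) - ln (real (r * Suc M))) \<longlonglongrightarrow> euler_mascheroni"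
    if "r > 0" for r :: nat
    using LIMSEQ_subseq_LIMSEQ[OF euler_mascheroni_LIMSEQ sm[OF that]]
    by (simp add: o_def harm_def inverse_eq_divide)
  have "(\<lambda>M. ((\<Sum>m=1..p * Suc M. 1 / real m) - ln (real (p * Suc M)))
      - ((\<Sum>m=1..q * Suc M. 1 / real m) - ln (real (q * Suc M))) + ln (real p / real q))
      \<longlonglongrightarrow> euler_mascheroni - euler_mascheroni + ln (real p / real q)"
    by (intro tendsto_intros h assms)
  moreover have "ln (real (r * Suc M)) = ln (real r) + ln (real (Suc M))" if "r > 0" for r M :: nat
    using that unfolding of_nat_mult by (intro ln_mult_pos) auto
  moreover have "ln (real p / real q) = ln (real p) - ln (real q)" using assms by (simp add: ln_div)
  ultimately show ?thesis using assms by simp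
qed

text \<open>By \<open>lattice_term_swap\<close> both sides contain the same finite rectangle of N by
  L terms. What remains are the two corners, the parts of the rows beyond the rectangle, and the
  harmonic sums subtracted in \<open>lattice_rows\<close>.\<close>

lemma lattice_exchange:
  assumes "a > 0" "N > 0" "a * real N = real L"
  shows "lattice_rows a N - lattice_rows (1 / a) L =
    lattice_corner a N L - lattice_corner (1 / a) L N
     + ((\<Sum>m=1..L. 1 / real m) - (\<Sum>m=1..N. 1 / real m)) / 2"
proof -
  have split: "(\<Sum>l. lattice_term b m (Suc l)) = (\<Sum>l=1..K. lattice_term b m l) + (\<Sum>l. lattice_term b m (Suc (l + K)))"
    if "b > 0" "m > 0" for b m K
    using suminf_split_initial_segment[OF sums_summable[OF lattice_row_sums[OF that]], of K]
    by (simp add: sum.atLeast1_atMost_eq)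
  have "(\<Sum>m=1..N. \<Sum>l. lattice_term a m (Suc l)) = (\<Sum>m=1..N. \<Sum>l=1..L. lattice_term a m l) + lattice_corner a N L"
    unfolding lattice_corner_def sum.distrib[symmetric] using assms by (intro sum.cong split) auto
  moreover have "(\<Sum>m=1..L. \<Sum>l. lattice_term (1 / a) m (Suc l)) = (\<Sum>m=1..L. \<Sum>l=1..N. lattice_term (1 / a) m l) + lattice_corner (1 / a) L N"
    unfolding lattice_corner_def sum.distrib[symmetric] using assms by (intro sum.cong split) auto
  moreover have "(\<Sum>m=1..L. \<Sum>l=1..N. lattice_term (1 / a) m l) = (\<Sum>m=1..N. \<Sum>l=1..L. lattice_term a m l)"
    unfolding lattice_term_swap[OF assms(1)] by (rule sum.swap)
  ultimately show ?thesis
    unfolding lattice_rows_def sum_subtractf by (simp add: sum_divide_distrib diff_divide_distrib mult.commute)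
qed

text \<open>A rational \<open>a\<close> admits arbitrarily large rectangles with exactly a N = L,
  namely N = q (M + 1) and L = p (M + 1). Both corners then tend to the limit of
  \<open>arctan_sum\<close>, and only the harmonic difference survives, with limit ln a / 2.\<close>

lemma lambert_sum_inversion:
  assumes "p > 0" "q > 0" and a: "a = real p / real q"
  shows "lambert_sum a - lambert_sum (1 / a) = pi / (12 * a) - pi * a / 12 + ln a / 2"
proof -
  have ap: "a > 0" "1 / a > 0" using assms by auto
  obtain l where l: "arctan_sum \<longlonglongrightarrow> l" using arctan_sum_convergent by (auto simp: convergent_def)
  have sm: "strict_mono (\<lambda>M. r * Suc M)" if "r > 0" for r :: nat
    using that by (auto simp: strict_mono_def)
  have corner: "(\<lambda>M. lattice_corner b (r * Suc M) (s * Suc M)) \<longlonglongrightarrow> l"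
    if "r > 0" "s > 0" "b = real s / real r" for r s :: nat and b
  proof -
    have b: "b > 0" using that by simp
    have "(\<lambda>M. lattice_corner b (r * Suc M) (s * Suc M) - arctan_sum (r * Suc M)) \<longlonglongrightarrow> 0"
    proof (rule Lim_null_comparison)
      show "\<forall>\<^sub>F M in sequentially. norm (lattice_corner b (r * Suc M) (s * Suc M) - arctan_sum (r * Suc M)) \<le> 1 / (b * pi * real (r * Suc M))"
        using that unfolding real_norm_def
        by (intro always_eventually allI lattice_corner_estimate b) (auto simp: field_simps)
      show "(\<lambda>M. 1 / (b * pi * real (r * Suc M))) \<longlonglongrightarrow> 0"
        using b that by real_asymp
    qed
    from tendsto_add[OF this LIMSEQ_subseq_LIMSEQ[OF l sm[OF that(1)]]] show ?thesis by (simp add: o_def)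
  qed
  have 1: "(\<lambda>M. lattice_rows a (q * Suc M) - lattice_rows (1 / a) (p * Suc M)) \<longlonglongrightarrow>
        (lambert_sum a - pi / (12 * a)) - (lambert_sum (1 / a) - pi / (12 * (1 / a)))"
    using LIMSEQ_subseq_LIMSEQ[OF lattice_rows_tendsto[OF ap(1)] sm[OF assms(2)]]
      LIMSEQ_subseq_LIMSEQ[OF lattice_rows_tendsto[OF ap(2)] sm[OF assms(1)]]
    unfolding o_def by (rule tendsto_diff)
  have 2: "(\<lambda>M. lattice_rows a (q * Suc M) - lattice_rows (1 / a) (p * Suc M)) =
     (\<lambda>M. lattice_corner a (q * Suc M) (p * Suc M) - lattice_corner (1 / a) (p * Suc M) (q * Suc M)
     + ((\<Sum>m=1..p * Suc M. 1 / real m) - (\<Sum>m=1..q * Suc M. 1 / real m)) / 2)"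
    using assms by (intro ext lattice_exchange ap) (auto simp: field_simps)
  have 3: "(\<lambda>M. lattice_corner a (q * Suc M) (p * Suc M) - lattice_corner (1 / a) (p * Suc M) (q * Suc M)
     + ((\<Sum>m=1..p * Suc M. 1 / real m) - (\<Sum>m=1..q * Suc M. 1 / real m)) / 2) \<longlonglongrightarrow> l - l + ln a / 2"
    unfolding a
    by (intro tendsto_intros corner harmonic_difference) (use assms in auto)
  have "(lambert_sum a - pi / (12 * a)) - (lambert_sum (1 / a) - pi / (12 * (1 / a))) = l - l + ln a / 2"
    using LIMSEQ_unique[OF 1 3[folded 2]] .
  moreover have "pi / (12 * (1 / a)) = pi * a / 12" by simp
  ultimately show ?thesis by linarith
qed

section \<open>The Euler product as an analytic function\<close>

definition euler_prod :: "'a::{real_normed_field,banach} \<Rightarrow> 'a" where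
  "euler_prod q = (\<Prod>i. 1 - q ^ Suc i)"

lemma euler_prod_converges:
  fixes q :: "'a::{real_normed_field,banach}"
  assumes "norm q < 1"
  shows "convergent_prod (\<lambda>i. 1 - q ^ Suc i)"
proof -
  have "summable (\<lambda>i. norm q ^ Suc i)" unfolding summable_Suc_iff using assms by (intro summable_geometric) simp
  then have "abs_convergent_prod (\<lambda>i. 1 - q ^ Suc i)"
    by (intro summable_imp_abs_convergent_prod) (simp add: norm_power norm_mult)
  then show ?thesis by (rule abs_convergent_prod_imp_convergent_prod)
qed

lemma euler_prod_LIMSEQ:
  fixes q :: "'a::{real_normed_field,banach}"
  assumes "norm q < 1"
  shows "(\<lambda>N. \<Prod>i<N. 1 - q ^ Suc i) \<longlonglongrightarrow> euler_prod q"
  using convergent_prod_LIMSEQ[OF euler_prod_converges[OF assms]]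
  unfolding euler_prod_def lessThan_Suc_atMost[symmetric] by (subst (asm) filterlim_sequentially_Suc)

lemma euler_prod_nonzero:
  fixes q :: "'a::{real_normed_field,banach}"
  assumes "norm q < 1"
  shows "euler_prod q \<noteq> 0"
proof -
  have "1 - q ^ Suc i \<noteq> 0" for i
    using assms by (metis eq_iff_diff_eq_0 norm_one norm_power power_Suc_less_one less_irrefl power_less_one_iff zero_less_Suc norm_ge_zero)
  then show ?thesis
    unfolding euler_prod_def using prodinf_nonzero[OF euler_prod_converges[OF assms]] by blast
qed

lemma euler_prod_uniform_limit:
  assumes "r < 1"
  shows "uniform_limit (cball 0 r) (\<lambda>N q::complex. \<Prod>i<N. 1 - q ^ Suc i) euler_prod sequentially"
proof (cases "r \<ge> 0")
  case True
  have "uniformly_convergent_on (cball 0 r) (\<lambda>N q::complex. \<Prod>i<N. 1 - q ^ Suc i)"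
  proof (rule uniformly_convergent_on_prod')
    show "uniformly_convergent_on (cball 0 r) (\<lambda>N (q::complex). \<Sum>n<N. norm (1 - q ^ Suc n - 1))"
    proof (rule Weierstrass_m_test')
      show "summable (\<lambda>n. r ^ Suc n)" using assms True by (simp add: summable_geometric summable_mult)
      fix n and q :: complex assume "q \<in> cball 0 r"
      then have "norm q ^ Suc n \<le> r ^ Suc n" by (intro power_mono) auto
      then show "norm (norm (1 - q ^ Suc n - 1)) \<le> r ^ Suc n" by (simp add: norm_power norm_mult)
    qed
  qed (auto intro!: continuous_intros)
  then obtain l where l: "uniform_limit (cball 0 r) (\<lambda>N q::complex. \<Prod>i<N. 1 - q ^ Suc i) l sequentially"
    by (auto simp: uniformly_convergent_on_def)
  have "l q = euler_prod q" if "q \<in> cball 0 r" for q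
    using LIMSEQ_unique[OF tendsto_uniform_limitI[OF l that] euler_prod_LIMSEQ] that assms by auto
  then show ?thesis using l by (metis (no_types, lifting) uniform_limit_cong')
qed auto

lemma euler_prod_holomorphic: "euler_prod holomorphic_on ball (0::complex) 1"
proof (rule holomorphic_uniform_sequence)
  fix q :: complex assume q: "q \<in> ball 0 1"
  define d where "d = (1 - norm q) / 2"
  have d: "d > 0" "norm q + d < 1" using q by (auto simp: d_def field_simps)
  have sub: "cball q d \<subseteq> cball 0 (norm q + d)"
    by (auto simp: dist_norm) (smt (verit) norm_triangle_ineq2 norm_minus_commute)
  then show "\<exists>d>0. cball q d \<subseteq> ball 0 1 \<and> uniform_limit (cball q d) (\<lambda>N q. \<Prod>i<N. 1 - q ^ Suc i) euler_prod sequentially"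
    using d uniform_limit_on_subset[OF euler_prod_uniform_limit[OF d(2)] sub]
    by (intro exI[of _ d]) (auto simp: subset_eq)
qed (auto intro!: holomorphic_intros)

lemma euler_prod_of_real:
  fixes r :: real
  assumes "\<bar>r\<bar> < 1"
  shows "euler_prod (complex_of_real r) = of_real (euler_prod r)"
proof (rule LIMSEQ_unique)
  show "(\<lambda>N. \<Prod>i<N. 1 - complex_of_real r ^ Suc i) \<longlonglongrightarrow> euler_prod (complex_of_real r)"
    using assms by (intro euler_prod_LIMSEQ) simp
  have "(\<lambda>N. complex_of_real (\<Prod>i<N. 1 - r ^ Suc i)) \<longlonglongrightarrow> of_real (euler_prod r)"
    using assms by (intro tendsto_of_real euler_prod_LIMSEQ) simp
  then show "(\<lambda>N. \<Prod>i<N. 1 - complex_of_real r ^ Suc i) \<longlonglongrightarrow> of_real (euler_prod r)" by simp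
qed

lemma euler_prod_pos:
  fixes r :: real
  assumes "0 \<le> r" "r < 1"
  shows "euler_prod r > 0"
proof -
  have "euler_prod r \<ge> 0"
  proof (rule LIMSEQ_le_const)
    show "(\<lambda>N. \<Prod>i<N. 1 - r ^ Suc i) \<longlonglongrightarrow> euler_prod r" using assms by (intro euler_prod_LIMSEQ) simp
    show "\<exists>N. \<forall>n\<ge>N. 0 \<le> (\<Prod>i<n. 1 - r ^ Suc i)"
      using assms by (intro exI allI impI prod_nonneg ballI) (simp add: power_le_one del: power_Suc)
  qed
  then show ?thesis using euler_prod_nonzero[of r] assms by simp
qed

text \<open>All terms in the expansions of - ln (1 - r^n) are nonnegative, so the double series may
  be summed in either order: one gives the logarithms of the factors, the other geometric
  series.\<close>

lemma ln_euler_prod: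
  assumes "a > 0"
  shows "ln (euler_prod (exp (- 2 * pi * a))) = - lambert_sum a"
proof -
  define r where "r = exp (- 2 * pi * a)"
  have r: "0 < r" "r < 1" using assms by (auto simp: r_def)
  have rp: "0 < r ^ Suc n" "r ^ Suc n < 1" for n using r by (auto simp: power_Suc_less_one simp del: power_Suc)
  have re: "r ^ Suc m = inverse (exp (2 * pi * a * real (Suc m)))" for m
    unfolding r_def exp_of_nat_mult[symmetric] exp_minus[symmetric] by (simp add: algebra_simps)
  define f where "f = (\<lambda>(m, n). (r ^ Suc n) ^ Suc m / real (Suc m))"
  have nn: "f x \<ge> 0" for x using r by (simp add: f_def case_prod_unfold)
  have row: "((\<lambda>n. f (m, n)) has_sum 1 / (real (Suc m) * (exp (2 * pi * a * real (Suc m)) - 1))) UNIV" for m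
  proof (rule sums_nonneg_imp_has_sum)
    let ?s = "r ^ Suc m"
    have "(\<lambda>n. ?s / real (Suc m) * ?s ^ n) sums (?s / real (Suc m) * (1 / (1 - ?s)))"
      using rp[of m] by (intro sums_mult geometric_sums) simp
    moreover have "?s / real (Suc m) * ?s ^ n = f (m, n)" for n
      by (simp add: f_def power_mult[symmetric] power_add[symmetric] algebra_simps flip: power_Suc)
    moreover have "x / real (Suc m) * (1 / (1 - x)) = 1 / (real (Suc m) * (inverse x - 1))" if "0 < x" "x < 1" for x
      using that by (simp add: divide_simps)
    ultimately show "(\<lambda>n. f (m, n)) sums (1 / (real (Suc m) * (exp (2 * pi * a * real (Suc m)) - 1)))"
      using rp[of m] re[of m] by (metis (no_types, lifting) inverse_inverse_eq sums_cong)
  qed (rule nn)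
  have lam: "((\<lambda>m. 1 / (real (Suc m) * (exp (2 * pi * a * real (Suc m)) - 1))) has_sum lambert_sum a) UNIV"
  proof (rule sums_nonneg_imp_has_sum)
    show "(\<lambda>m. 1 / (real (Suc m) * (exp (2 * pi * a * real (Suc m)) - 1))) sums lambert_sum a"
      unfolding lambert_sum_def by (rule summable_sums[OF lambert_summable[OF assms]])
    show "1 / (real (Suc m) * (exp (2 * pi * a * real (Suc m)) - 1)) \<ge> 0" for m
      using assms by (intro divide_nonneg_nonneg mult_nonneg_nonneg) auto
  qed
  have summ: "f summable_on UNIV \<times> UNIV"
  proof (rule summable_on_SigmaI)
    show "(\<lambda>m. 1 / (real (Suc m) * (exp (2 * pi * a * real (Suc m)) - 1))) summable_on UNIV"
      using lam by (rule has_sum_imp_summable)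
  qed (rule row nn)+
  have "(f has_sum lambert_sum a) (UNIV \<times> UNIV)"
    by (rule has_sum_SigmaI[OF _ lam summ]) (rule row)
  then have sw: "((\<lambda>(n, m). f (m, n)) has_sum lambert_sum a) (UNIV \<times> UNIV)"
    by (subst (asm) has_sum_swap)
  have col: "((\<lambda>m. f (m, n)) has_sum - ln (1 - r ^ Suc n)) UNIV" for n
  proof (rule sums_nonneg_imp_has_sum)
    have "(\<lambda>m. - (- ((- (- (r ^ Suc n))) ^ m) / real m)) sums - ln (1 + - (r ^ Suc n))"
      using rp[of n] by (intro sums_minus ln_series') simp
    then have "(\<lambda>m. (r ^ Suc n) ^ m / real m) sums - ln (1 - r ^ Suc n)" by simp
    then have "(\<lambda>m. (r ^ Suc n) ^ Suc m / real (Suc m)) sums - ln (1 - r ^ Suc n)"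
      by (subst sums_Suc_iff[of "\<lambda>m. (r ^ Suc n) ^ m / real m"]) simp
    then show "(\<lambda>m. f (m, n)) sums - ln (1 - r ^ Suc n)"
      unfolding f_def by simp
  qed (rule nn)
  have "((\<lambda>n. - ln (1 - r ^ Suc n)) has_sum lambert_sum a) UNIV"
    using has_sum_SigmaD[OF sw, of "\<lambda>n. - ln (1 - r ^ Suc n)"] col by simp
  then have s: "(\<lambda>n. - ln (1 - r ^ Suc n)) sums lambert_sum a" by (rule has_sum_imp_sums)
  have c1: "(\<lambda>N. \<Sum>n<N. ln (1 - r ^ Suc n)) \<longlonglongrightarrow> - lambert_sum a"
    using sums_minus[OF s] by (simp add: sums_def)
  have c2: "(\<Sum>n<N. ln (1 - r ^ Suc n)) = ln (\<Prod>n<N. 1 - r ^ Suc n)" for N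
  proof -
    have "1 - r ^ Suc i > 0" for i using rp[of i] by linarith
    then show ?thesis by (subst ln_prod) (auto simp del: power_Suc simp: less_imp_neq[THEN not_sym])
  qed
  have c3: "(\<lambda>N. ln (\<Prod>n<N. 1 - r ^ Suc n)) \<longlonglongrightarrow> ln (euler_prod r)"
    using euler_prod_pos[of r] r by (intro tendsto_ln euler_prod_LIMSEQ) auto
  show ?thesis using LIMSEQ_unique[OF c3 c1[unfolded c2]] unfolding r_def .
qed

lemma euler_prod_inversion:
  assumes "p > 0" "q > 0" and a: "a = real p / real q"
  shows "euler_prod (exp (- 2 * pi * a)) =
    exp (pi * a / 12 - pi / (12 * a)) / sqrt a * euler_prod (exp (- 2 * pi * (1 / a)))"
proof -
  have ap: "a > 0" "1 / a > 0" using assms by auto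
  have pos: "euler_prod (exp (- 2 * pi * b)) > 0" if "b > 0" for b :: real
    using that by (intro euler_prod_pos) auto
  have "ln (euler_prod (exp (- 2 * pi * a))) = pi * a / 12 - pi / (12 * a) - ln a / 2 + ln (euler_prod (exp (- 2 * pi * (1 / a))))"
    unfolding ln_euler_prod[OF ap(1)] ln_euler_prod[OF ap(2)] using lambert_sum_inversion[OF assms] by simp
  then have "exp (ln (euler_prod (exp (- 2 * pi * a)))) =
     exp (pi * a / 12 - pi / (12 * a)) / exp (ln a / 2) * exp (ln (euler_prod (exp (- 2 * pi * (1 / a)))))"
    by (simp only: exp_add exp_diff)
  moreover have "exp (ln a / 2) = sqrt a" using ap by (simp add: ln_sqrt[symmetric])
  ultimately show ?thesis using pos[OF ap(1)] pos[OF ap(2)] by (simp only: exp_ln)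
qed

section \<open>Inversion of the generating function\<close>

definition diamond_fun :: "nat \<Rightarrow> 'a::{real_normed_field,banach} \<Rightarrow> 'a" where
  "diamond_fun m q = euler_prod (q\<^sup>2) * euler_prod (q ^ m) / (euler_prod q ^ 3 * euler_prod (q ^ (2 * m)))"

text \<open>Inversion sends q^d = exp (- d t) to exp (- 4 pi^2 / (d t)), which is v^(2 m / d) for v
  = exp (- 2 pi^2 / (m t)). On the exponents 1, 2, m, 2 m it acts as d \<mapsto> 2 m / d, exchanging
  1 with 2 m and 2 with m.\<close>

definition diamond_dual :: "nat \<Rightarrow> 'a::{real_normed_field,banach} \<Rightarrow> 'a" where
  "diamond_dual m v = euler_prod (v ^ m) * euler_prod (v\<^sup>2) / (euler_prod (v ^ (2 * m)) ^ 3 * euler_prod v)"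

text \<open>Collected from the exponents - pi / (12 d a) of the Euler products: (3 + 1 / (2 m) - 1 /
  2 - 1 / m) pi / (12 a) equals \<open>diamond_growth m / (2 * pi * a)\<close>.\<close>

definition diamond_growth :: "nat \<Rightarrow> real" where
  "diamond_growth m = pi\<^sup>2 * (5 * real m - 1) / (12 * real m)"

lemma diamond_fun_inversion_rational:
  assumes "p > 0" "q > 0" "m > 0" and a: "a = real p / real q"
  shows "diamond_fun m (exp (- (2 * pi * a))) =
    a * exp (diamond_growth m / (2 * pi * a) - (real m + 1) / 24 * (2 * pi * a)) *
      diamond_dual m (exp (- (2 * pi\<^sup>2 / (real m * (2 * pi * a)))))"
proof -
  have ap: "a > 0" using assms by simp
  define E where "E d = exp (pi * (real d * a) / 12 - pi / (12 * (real d * a)))" for d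
  define v where "v = exp (- (2 * pi\<^sup>2 / (real m * (2 * pi * a))))"
  have v: "v = exp (- (pi / (real m * a)))"
    using ap by (simp add: v_def power2_eq_square)
  have inv: "euler_prod (exp (- (2 * pi * a)) ^ d) = E d / (sqrt (real d) * sqrt a) * euler_prod (exp (- 2 * pi * (1 / (real d * a))))"
    if "d > 0" for d
  proof -
    have "exp (- (2 * pi * a)) ^ d = exp (- 2 * pi * (real d * a))"
      by (simp add: exp_of_nat_mult[symmetric] algebra_simps)
    moreover have "real d * a = real (d * p) / real q" by (simp add: a)
    from euler_prod_inversion[OF _ assms(2) this]
    have "euler_prod (exp (- 2 * pi * (real d * a))) = E d / sqrt (real d * a) * euler_prod (exp (- 2 * pi * (1 / (real d * a))))"
      using that assms(1) unfolding E_def by simp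
    ultimately show ?thesis unfolding real_sqrt_mult by metis
  qed
  have vp: "exp (- 2 * pi * (1 / (real d * a))) = v ^ e" if "d * e = 2 * m" "d > 0" for d e
  proof -
    have "real d * real e = 2 * real m" using that(1) by (metis of_nat_mult of_nat_numeral)
    then have e: "real e = 2 * real m / real d" using that(2) by (simp add: field_simps)
    have "- 2 * pi * (1 / (real d * a)) = real e * (- (pi / (real m * a)))"
      unfolding e using ap that(2) assms(3) by (simp add: field_simps)
    then show ?thesis unfolding v by (simp add: exp_of_nat_mult[symmetric])
  qed
  have sq: "sqrt a * sqrt a = a" "sqrt a > 0" using ap by auto
  have "diamond_fun m (exp (- (2 * pi * a))) =
    (E 2 / (sqrt 2 * sqrt a) * euler_prod (v ^ m)) * (E m / (sqrt (real m) * sqrt a) * euler_prod (v\<^sup>2)) /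
    ((E 1 / sqrt a * euler_prod (v ^ (2 * m))) ^ 3 * (E (2 * m) / (sqrt (2 * real m) * sqrt a) * euler_prod v))"
    unfolding diamond_fun_def
    using inv[of 2] inv[of m] inv[of 1] inv[of "2 * m"] vp[of 2 m] vp[of m 2] vp[of 1 "2 * m"] vp[of "2 * m" 1] assms
    by simp
  also have "\<dots> = a * (E 2 * E m / (E 1 ^ 3 * E (2 * m))) * diamond_dual m v"
  proof -
    \<comment> \<open>The square roots of 2, m and 2 m cancel completely, and of the powers of sqrt
      a exactly one factor \<open>a\<close> is left.\<close>
    have alg: "(e2 / (x * s) * p1) * (em / (y * s) * p2) / ((e1 / s * p3) ^ 3 * (e3 / ((x * y) * s) * p4))
      = (s * s) * (e2 * em / (e1 ^ 3 * e3)) * (p1 * p2 / (p3 ^ 3 * p4))"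
      if "x > 0" "y > 0" "s > 0" for e2 x s p1 em y p2 e1 p3 e3 p4 :: real
      using that by (simp add: divide_simps) (simp add: power3_eq_cube algebra_simps)
    show ?thesis
      unfolding real_sqrt_mult diamond_dual_def
      using alg[of "sqrt 2" "sqrt (real m)" "sqrt a"] sq assms by simp
  qed
  also have "E 2 * E m / (E 1 ^ 3 * E (2 * m)) = exp (diamond_growth m / (2 * pi * a) - (real m + 1) / 24 * (2 * pi * a))"
  proof -
    have "E 2 * E m / (E 1 ^ 3 * E (2 * m)) =
      exp ((pi * (2 * a) / 12 - pi / (12 * (2 * a))) + (pi * (real m * a) / 12 - pi / (12 * (real m * a)))
        - (3 * (pi * a / 12 - pi / (12 * a)) + (pi * (2 * real m * a) / 12 - pi / (12 * (2 * real m * a)))))"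
      unfolding E_def exp_of_nat_mult[symmetric] exp_add[symmetric] exp_diff[symmetric] by simp
    also have "(pi * (2 * a) / 12 - pi / (12 * (2 * a))) + (pi * (real m * a) / 12 - pi / (12 * (real m * a)))
        - (3 * (pi * a / 12 - pi / (12 * a)) + (pi * (2 * real m * a) / 12 - pi / (12 * (2 * real m * a))))
       = diamond_growth m / (2 * pi * a) - (real m + 1) / 24 * (2 * pi * a)"
    proof -
      have g: "diamond_growth m / (2 * pi * a) = pi * (5 * real m - 1) / (24 * real m * a)"
        unfolding diamond_growth_def by (simp add: power2_eq_square)
      show ?thesis unfolding g using ap assms(3) by (simp add: divide_simps) (simp add: algebra_simps)
    qed
    finally show ?thesis .
  qed
  finally show ?thesis unfolding v_def .
qed

lemma euler_prod_holomorphic_compose: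
  assumes "f holomorphic_on S" "\<And>z. z \<in> S \<Longrightarrow> norm (f z) < 1"
  shows "(\<lambda>z. euler_prod (f z :: complex)) holomorphic_on S"
  using holomorphic_on_compose_gen[OF assms(1) euler_prod_holomorphic] assms(2)
  by (auto simp: o_def image_subset_iff)

lemma norm_power_less_one:
  fixes q :: "'a::real_normed_div_algebra"
  assumes "norm q < 1" "n > 0"
  shows "norm (q ^ n) < 1"
  using assms by (simp add: norm_power power_less_one_iff)

lemma diamond_fun_holomorphic_compose:
  assumes "f holomorphic_on S" "\<And>z. z \<in> S \<Longrightarrow> norm (f z :: complex) < 1" "m > 0"
  shows "(\<lambda>z. diamond_fun m (f z)) holomorphic_on S" "(\<lambda>z. diamond_dual m (f z)) holomorphic_on S"
  unfolding diamond_fun_def diamond_dual_def using assms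
  by (auto intro!: holomorphic_intros euler_prod_holomorphic_compose norm_power_less_one
      simp: euler_prod_nonzero norm_power_less_one)

lemma abs_power_less_one: "\<bar>x\<bar> < 1 \<Longrightarrow> n > 0 \<Longrightarrow> \<bar>x ^ n\<bar> < (1::real)"
  by (simp add: power_abs power_less_one_iff)

lemma diamond_of_real:
  fixes x :: real
  assumes "\<bar>x\<bar> < 1" "m > 0"
  shows "diamond_fun m (complex_of_real x) = of_real (diamond_fun m x)"
    "diamond_dual m (complex_of_real x) = of_real (diamond_dual m x)"
proof -
  have "euler_prod (complex_of_real x ^ n) = of_real (euler_prod (x ^ n))" if "n > 0" for n
    unfolding of_real_power[symmetric] by (intro euler_prod_of_real abs_power_less_one assms that)
  from this[of 1] this[of 2] this[of m] this[of "2 * m"] assms(2)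
  show "diamond_fun m (complex_of_real x) = of_real (diamond_fun m x)"
    "diamond_dual m (complex_of_real x) = of_real (diamond_dual m x)"
    by (simp_all add: diamond_fun_def diamond_dual_def)
qed

text \<open>Both sides are holomorphic on the right half plane. They agree at the points 2 pi (n +
  2) / (n + 1), which come from rational \<open>a\<close> and accumulate at 2 pi, hence
  everywhere.\<close>

theorem diamond_fun_inversion:
  fixes t :: complex
  assumes "Re t > 0" "m > 0"
  shows "diamond_fun m (exp (- t)) =
    t / (2 * of_real pi) * exp (of_real (diamond_growth m) / t - of_real ((real m + 1) / 24) * t) *
      diamond_dual m (exp (- (2 * of_real pi ^ 2 / (of_nat m * t))))"
proof -
  let ?S = "{t. Re t > 0}"
  let ?R = "\<lambda>t. t / (2 * of_real pi) * exp (of_real (diamond_growth m) / t - of_real ((real m + 1) / 24) * t) *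
      diamond_dual m (exp (- (2 * of_real pi ^ 2 / (of_nat m * t))))"
  let ?U = "(\<lambda>n. complex_of_real (2 * pi * (real (Suc n + 1) / real (Suc n)))) ` UNIV"
  have n1: "norm (exp (- t)) < 1" if "t \<in> ?S" for t :: complex using that by simp
  have n2: "norm (exp (- (2 * of_real pi ^ 2 / (of_nat m * t)))) < 1" if "t \<in> ?S" for t :: complex
  proof -
    have "Re (2 * of_real pi ^ 2 / (of_nat m * t)) = 2 * pi\<^sup>2 / real m * Re (inverse t)"
    proof -
      have "2 * of_real pi ^ 2 / (of_nat m * t) = of_real (2 * pi\<^sup>2 / real m) * inverse t"
        by (simp add: field_simps)
      moreover have "Re (of_real x * w) = x * Re w" for x w by simp
      ultimately show ?thesis by metis
    qed
    moreover have "Re (inverse t) > 0" using that by (auto intro!: divide_pos_pos add_pos_nonneg)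
    moreover have "2 * pi\<^sup>2 / real m > 0" using assms by simp
    ultimately have "Re (2 * of_real pi ^ 2 / (of_nat m * t)) > 0" by (simp only: mult_pos_pos)
    then show ?thesis by simp
  qed
  have "diamond_fun m (exp (- t)) - ?R t = 0"
  proof (rule analytic_continuation[where f = "\<lambda>t. diamond_fun m (exp (- t)) - ?R t" and S = ?S and U = ?U and \<xi> = "of_real (2 * pi)"])
    show "(\<lambda>t. diamond_fun m (exp (- t)) - ?R t) holomorphic_on ?S"
      using assms(2) by (intro holomorphic_intros diamond_fun_holomorphic_compose n1 n2) auto
    show "open ?S" by (rule open_halfspace_Re_gt)
    show "connected ?S" by (intro convex_connected convex_halfspace_Re_gt)
    show "?U \<subseteq> ?S" by auto
    have "(\<lambda>n. 2 * pi * (real (Suc n + 1) / real (Suc n))) \<longlonglongrightarrow> 2 * pi * 1"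
      by (intro tendsto_intros) real_asymp
    then have "(\<lambda>n. complex_of_real (2 * pi * (real (Suc n + 1) / real (Suc n)))) \<longlonglongrightarrow> of_real (2 * pi * 1)"
      by (rule tendsto_of_real)
    then have lim: "(\<lambda>n. complex_of_real (2 * pi * (real (Suc n + 1) / real (Suc n)))) \<longlonglongrightarrow> of_real (2 * pi)"
      by (simp only: mult_1_right)
    have ne: "complex_of_real (2 * pi * (real (Suc n + 1) / real (Suc n))) \<noteq> of_real (2 * pi)" for n
    proof
      assume "complex_of_real (2 * pi * (real (Suc n + 1) / real (Suc n))) = of_real (2 * pi)"
      then have "2 * pi * (real (Suc n + 1) / real (Suc n)) = 2 * pi" by (simp only: of_real_eq_iff)
      moreover have "2 * pi * x = 2 * pi \<Longrightarrow> x = 1" for x by simp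
      ultimately have "real (Suc n + 1) / real (Suc n) = 1" by blast
      then show False by (simp add: divide_simps)
    qed
    show "of_real (2 * pi) islimpt ?U"
      unfolding islimpt_sequential
    proof (intro exI conjI allI DiffI)
      show "complex_of_real (2 * pi * (real (Suc n + 1) / real (Suc n))) \<in> ?U" for n by (rule rangeI)
      show "complex_of_real (2 * pi * (real (Suc n + 1) / real (Suc n))) \<notin> {of_real (2 * pi)}" for n
        using ne[of n] by (simp only: singleton_iff not_False_eq_True)
    qed (rule lim)
    show "diamond_fun m (exp (- z)) - ?R z = 0" if z: "z \<in> ?U" for z
    proof -
      obtain n where n: "z = of_real (2 * pi * (real (Suc n + 1) / real (Suc n)))" using z by blast
      define a where "a = real (Suc n + 1) / real (Suc n)"
      have a: "a > 0" "z = of_real (2 * pi * a)" by (auto simp: n a_def)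
      have x1: "exp (- z) = of_real (exp (- (2 * pi * a)))"
        unfolding a(2) by (simp add: exp_of_real[symmetric])
      have x2: "exp (- (2 * of_real pi ^ 2 / (of_nat m * z))) = of_real (exp (- (2 * pi\<^sup>2 / (real m * (2 * pi * a)))))"
        unfolding a(2) by (simp add: exp_of_real[symmetric])
      have x3: "exp (of_real (diamond_growth m) / z - of_real ((real m + 1) / 24) * z) =
        of_real (exp (diamond_growth m / (2 * pi * a) - (real m + 1) / 24 * (2 * pi * a)))"
        unfolding a(2) by (simp add: exp_of_real[symmetric])
      have x4: "z / (2 * of_real pi) = of_real a" unfolding a(2) by simp
      have "diamond_fun m (exp (- (2 * pi * a))) =
        a * exp (diamond_growth m / (2 * pi * a) - (real m + 1) / 24 * (2 * pi * a)) *
        diamond_dual m (exp (- (2 * pi\<^sup>2 / (real m * (2 * pi * a)))))"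
        by (rule diamond_fun_inversion_rational[OF _ _ assms(2) a_def]) auto
      moreover have "\<bar>exp (- (2 * pi * a))\<bar> < 1" "\<bar>exp (- (2 * pi\<^sup>2 / (real m * (2 * pi * a))))\<bar> < 1"
        using a(1) assms(2) by auto
      ultimately show ?thesis
        unfolding x1 x2 x3 x4 using assms(2) by (simp add: diamond_of_real)
    qed
  qed (use assms in auto)
  then show ?thesis by simp
qed

section \<open>Growth of the generating function\<close>

text \<open>With distances to 1 measured as exp a - 1 the parameters simply add under
  multiplication; this collects the errors of the six factors of
  \<open>diamond_dual\<close>.\<close>

lemma norm_minus_one_mult_le:
  fixes x y :: "'a::real_normed_field"
  assumes "norm (x - 1) \<le> exp a - 1" "norm (y - 1) \<le> exp b - 1"
  shows "norm (x * y - 1) \<le> exp (a + b) - 1"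
proof -
  have ea: "0 \<le> exp a - 1" and eb: "0 \<le> exp b - 1" using assms norm_ge_zero order_trans by blast+
  have "x * y - 1 = (x - 1) * (y - 1) + (x - 1) + (y - 1)" by (simp add: algebra_simps)
  then have "norm (x * y - 1) \<le> norm (x - 1) * norm (y - 1) + norm (x - 1) + norm (y - 1)"
    by (metis (no_types, lifting) norm_triangle_le norm_mult add_mono order_refl norm_triangle_ineq)
  also have "\<dots> \<le> (exp a - 1) * (exp b - 1) + (exp a - 1) + (exp b - 1)"
    using assms ea eb by (intro add_mono mult_mono) auto
  also have "\<dots> = exp (a + b) - 1" by (simp add: exp_add algebra_simps)
  finally show ?thesis .
qed

text \<open>The factor 7 / 6 is 1 / (1 - 1 / 7), from the geometric series. For the inverse, the
  product has norm at least 1 / 2, and e = exp (7 / 6 norm q) satisfies 2 (e - 1) \<le> (e + 1) (e -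
  1) = e^2 - 1, so the parameter doubles.\<close>

lemma euler_prod_near_one:
  fixes q :: complex
  assumes "norm q \<le> 1 / 7"
  shows "norm (euler_prod q - 1) \<le> exp (7 / 6 * norm q) - 1"
    and "norm (inverse (euler_prod q) - 1) \<le> exp (7 / 3 * norm q) - 1"
proof -
  let ?s = "norm q"
  have s: "0 \<le> ?s" "?s \<le> 1 / 7" using assms by auto
  show 1: "norm (euler_prod q - 1) \<le> exp (7 / 6 * ?s) - 1"
  proof (rule LIMSEQ_le_const2)
    show "(\<lambda>N. norm ((\<Prod>i<N. 1 - q ^ Suc i) - 1)) \<longlonglongrightarrow> norm (euler_prod q - 1)"
      using s by (intro tendsto_intros euler_prod_LIMSEQ) auto
    have "norm ((\<Prod>i<N. 1 - q ^ Suc i) - 1) \<le> exp (7 / 6 * ?s) - 1" for N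
    proof -
      have "norm ((\<Prod>i<N. 1 + (- (q ^ Suc i))) - 1) \<le> (\<Prod>i<N. 1 + norm (- (q ^ Suc i))) - 1"
        by (rule norm_prod_minus1_le_prod_minus1)
      also have "(\<Prod>i<N. 1 + norm (- (q ^ Suc i))) \<le> exp (\<Sum>i<N. norm (- (q ^ Suc i)))"
        by (rule prod_le_exp_sum) simp
      also have "exp (\<Sum>i<N. norm (- (q ^ Suc i))) \<le> exp (7 / 6 * ?s)"
      proof -
        have "(\<Sum>i<N. norm (- (q ^ Suc i))) = ?s * (\<Sum>i<N. ?s ^ i)"
          by (simp add: norm_power norm_mult sum_distrib_left)
        also have "\<dots> \<le> ?s * (7 / 6)"
        proof (rule mult_left_mono)
          have "(\<Sum>i<N. ?s ^ i) \<le> (\<Sum>i. ?s ^ i)"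
            using s by (intro sum_le_suminf summable_geometric) auto
          also have "\<dots> = 1 / (1 - ?s)" using s by (intro suminf_geometric) auto
          also have "\<dots> \<le> 7 / 6" using s by (simp add: field_simps)
          finally show "(\<Sum>i<N. ?s ^ i) \<le> 7 / 6" .
        qed simp
        finally have "(\<Sum>i<N. norm (- (q ^ Suc i))) \<le> ?s * (7 / 6)" .
        then show ?thesis by simp
      qed
      finally show ?thesis by simp
    qed
    then show "\<exists>N. \<forall>n\<ge>N. norm ((\<Prod>i<n. 1 - q ^ Suc i) - 1) \<le> exp (7 / 6 * ?s) - 1" by blast
  qed
  let ?e = "exp (7 / 6 * ?s)"
  have e: "?e \<ge> 1" "?e \<le> 3 / 2"
  proof -
    have "?e \<le> exp (1 / 6)" using s by simp
    also have "\<dots> \<le> 1 + 1 / 6 + (1 / 6)\<^sup>2" by (rule exp_bound) auto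
    also have "\<dots> \<le> 3 / (2::real)" by (simp add: power2_eq_square)
    finally show "?e \<le> 3 / 2" .
  qed (use s in simp)
  have P: "norm (euler_prod q) \<ge> 1 / 2"
    using norm_triangle_ineq2[of 1 "1 - euler_prod q"] 1 e by (simp add: norm_minus_commute)
  have "inverse (euler_prod q) - 1 = (1 - euler_prod q) / euler_prod q"
  proof -
    have "euler_prod q \<noteq> 0" using P by auto
    then show ?thesis by (simp add: field_simps)
  qed
  then have "norm (inverse (euler_prod q) - 1) = norm (euler_prod q - 1) / norm (euler_prod q)"
    by (simp add: norm_divide norm_minus_commute)
  also have "\<dots> \<le> (?e - 1) / (1 / 2)" using 1 P e by (intro frac_le) auto
  also have "\<dots> = (?e - 1) * 2" by simp
  also have "\<dots> \<le> (?e - 1) * (?e + 1)" using e by (intro mult_left_mono) auto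
  also have "\<dots> = exp (7 / 3 * ?s) - 1" by (simp add: algebra_simps mult_exp_exp)
  finally show "norm (inverse (euler_prod q) - 1) \<le> exp (7 / 3 * ?s) - 1" .
qed

lemma exp_minus_one_le: "exp x - 1 \<le> x * exp (x::real)"
proof -
  have "1 + - x \<le> exp (- x)" by (rule exp_ge_add_one_self)
  then have "(1 - x) * exp x \<le> exp (- x) * exp x" by (intro mult_right_mono) auto
  then show ?thesis by (simp add: exp_minus algebra_simps)
qed

text \<open>Two factors and four inverses give the parameter 2 (7 / 6) + 4 (7 / 3) = 35 / 3 times
  norm v. As norm v \<le> 1 / 7, the exponential is at most exp (5 / 3) < 6.5, and 6.5 times 35 / 3
  is below 80.\<close>

lemma diamond_dual_near_one:
  fixes v :: complex
  assumes "norm v \<le> 1 / 7" "m > 0"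
  shows "norm (diamond_dual m v - 1) \<le> 80 * norm v"
proof -
  let ?s = "norm v"
  have p: "norm (v ^ n) \<le> ?s" "norm (v ^ n) \<le> 1 / 7" if "n > 0" for n
  proof -
    show "norm (v ^ n) \<le> ?s" using power_decreasing[of 1 n ?s] that assms by (simp add: norm_power)
    then show "norm (v ^ n) \<le> 1 / 7" using assms by simp
  qed
  have P: "norm (euler_prod (v ^ n) - 1) \<le> exp (7 / 6 * ?s) - 1"
    and Q: "norm (inverse (euler_prod (v ^ n)) - 1) \<le> exp (7 / 3 * ?s) - 1" if "n > 0" for n
    using euler_prod_near_one[OF p(2)[OF that]] p(1)[OF that]
    by (smt (verit) exp_le_cancel_iff mult_left_mono divide_nonneg_nonneg)+
  have eq: "diamond_dual m v = (euler_prod (v ^ m) * euler_prod (v ^ 2)) * (inverse (euler_prod (v ^ (2 * m))) *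
     (inverse (euler_prod (v ^ (2 * m))) * (inverse (euler_prod (v ^ (2 * m))) * inverse (euler_prod (v ^ 1)))))"
    unfolding diamond_dual_def by (simp add: divide_inverse power3_eq_cube mult_ac)
  have "norm (diamond_dual m v - 1) \<le> exp ((7 / 6 * ?s + 7 / 6 * ?s) + (7 / 3 * ?s + (7 / 3 * ?s + (7 / 3 * ?s + 7 / 3 * ?s)))) - 1"
    unfolding eq using assms(2) by (intro norm_minus_one_mult_le P Q) auto
  also have "\<dots> \<le> exp (35 / 3 * ?s) - 1" by simp
  also have "\<dots> \<le> (35 / 3 * ?s) * exp (35 / 3 * ?s)" by (rule exp_minus_one_le)
  also have "\<dots> \<le> (35 / 3 * ?s) * 6.5"
  proof (intro mult_left_mono)
    have "exp (35 / 3 * ?s) \<le> exp (5 / 3)" using assms by simp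
    also have "exp (5 / 3) = exp (5 / 12 :: real) ^ 4" by (simp add: exp_of_nat_mult[symmetric])
    also have "\<dots> \<le> (1 + 5 / 12 + (5 / 12 :: real)\<^sup>2) ^ 4"
      by (intro power_mono exp_bound) auto
    also have "\<dots> \<le> 6.5" by (simp add: power_divide)
    finally show "exp (35 / 3 * ?s) \<le> 6.5" .
  qed simp
  finally show ?thesis using norm_ge_zero[of v] by linarith
qed

text \<open>Only the linear term of the logarithm is used; the higher ones have the right sign.\<close>

lemma norm_one_minus_ge:
  fixes z :: complex
  assumes "norm z < 1"
  shows "(1 - norm z) * exp (norm z - Re z) \<le> norm (1 - z)"
proof -
  have z1: "1 - z \<noteq> 0" using assms by auto
  have s1: "(\<lambda>n. - ((- (- z)) ^ n) / of_nat n) sums ln (1 + - z)" using assms by (intro Ln_series') simp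
  have 1: "(\<lambda>n. - Re (z ^ n) / real n) sums Re (ln (1 - z))"
    using sums_Re[OF s1] by (simp add: Re_divide_of_nat)
  have 2: "(\<lambda>n. - ((- (- norm z)) ^ n) / real n) sums ln (1 + - norm z)" using assms by (intro ln_series') simp
  have 3: "(\<lambda>n. (norm z ^ n - Re (z ^ n)) / real n) sums (Re (ln (1 - z)) - ln (1 - norm z))"
    using sums_diff[OF 1 2] by (simp add: diff_divide_distrib)
  have nn: "(norm z ^ n - Re (z ^ n)) / real n \<ge> 0" for n
    using complex_Re_le_cmod[of "z ^ n"] by (simp add: norm_power)
  have "norm z - Re z \<le> Re (ln (1 - z)) - ln (1 - norm z)"
    using sum_le_suminf[OF sums_summable[OF 3], of "{1}"] nn sums_unique[OF 3] by simp
  also have "Re (ln (1 - z)) = ln (norm (1 - z))" using z1 by (rule Re_Ln)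
  finally have "exp (norm z - Re z) \<le> exp (ln (norm (1 - z)) - ln (1 - norm z))" by simp
  also have "\<dots> = norm (1 - z) / (1 - norm z)" using z1 assms by (simp add: exp_diff)
  finally show ?thesis using assms by (simp add: field_simps)
qed

text \<open>Applied to every factor, \<open>norm_one_minus_ge\<close> puts the geometric series of
  norm q and of q into the exponent. Since Re (1 / (1 - q)) is large only near q = 1, the Euler
  product elsewhere is much larger than at \<open>norm q\<close>.\<close>

lemma euler_prod_norm_ge:
  fixes q :: complex
  assumes "norm q < 1"
  shows "euler_prod (norm q) * exp (1 / (1 - norm q) - Re (1 / (1 - q))) \<le> norm (euler_prod q)"
proof (rule LIMSEQ_le)
  let ?r = "norm q"
  show "(\<lambda>N. norm (\<Prod>i<N. 1 - q ^ Suc i)) \<longlonglongrightarrow> norm (euler_prod q)"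
    using assms by (intro tendsto_norm euler_prod_LIMSEQ)
  have g: "(\<lambda>i. ?r ^ i - Re (q ^ i)) sums (1 / (1 - ?r) - Re (1 / (1 - q)))"
    using assms by (intro sums_diff geometric_sums sums_Re) auto
  have "(\<lambda>i. ?r ^ Suc i - Re (q ^ Suc i)) sums (1 / (1 - ?r) - Re (1 / (1 - q)))"
    by (subst sums_Suc_iff[of "\<lambda>i. ?r ^ i - Re (q ^ i)"]) (use g in simp)
  then show "(\<lambda>N. (\<Prod>i<N. 1 - ?r ^ Suc i) * exp (\<Sum>i<N. ?r ^ Suc i - Re (q ^ Suc i)))
     \<longlonglongrightarrow> euler_prod ?r * exp (1 / (1 - ?r) - Re (1 / (1 - q)))"
    using assms by (intro tendsto_mult tendsto_exp euler_prod_LIMSEQ) (auto simp: sums_def)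
  have "(\<Prod>i<N. 1 - ?r ^ Suc i) * exp (\<Sum>i<N. ?r ^ Suc i - Re (q ^ Suc i)) \<le> norm (\<Prod>i<N. 1 - q ^ Suc i)" for N
  proof -
    have "(\<Prod>i<N. 1 - ?r ^ Suc i) * exp (\<Sum>i<N. ?r ^ Suc i - Re (q ^ Suc i))
       = (\<Prod>i<N. (1 - norm (q ^ Suc i)) * exp (norm (q ^ Suc i) - Re (q ^ Suc i)))"
      by (simp only: prod.distrib exp_sum finite_lessThan norm_power)
    also have "\<dots> \<le> (\<Prod>i<N. norm (1 - q ^ Suc i))"
    proof (intro prod_mono conjI)
      fix i
      have "norm (q ^ Suc i) < 1" using assms by (rule norm_power_less_one) simp
      then show "0 \<le> (1 - norm (q ^ Suc i)) * exp (norm (q ^ Suc i) - Re (q ^ Suc i))"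
        "(1 - norm (q ^ Suc i)) * exp (norm (q ^ Suc i) - Re (q ^ Suc i)) \<le> norm (1 - q ^ Suc i)"
        using norm_one_minus_ge[of "q ^ Suc i"] by auto
    qed
    also have "\<dots> = norm (\<Prod>i<N. 1 - q ^ Suc i)" by (rule prod_norm)
    finally show ?thesis .
  qed
  then show "\<exists>N. \<forall>n\<ge>N. (\<Prod>i<n. 1 - ?r ^ Suc i) * exp (\<Sum>i<n. ?r ^ Suc i - Re (q ^ Suc i)) \<le> norm (\<Prod>i<n. 1 - q ^ Suc i)"
    by blast
qed

text \<open>The quotient is the product of 1 + q^j over all j not divisible by m, the generating
  function of partitions into distinct parts of this kind. In this form it is visibly dominated by
  its value at \<open>norm q\<close>.\<close>

lemma distinct_parts_limit:
  fixes q :: "'a::{real_normed_field,banach}"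
  assumes "norm q < 1" "m > 0"
  shows "(\<lambda>N. \<Prod>j\<in>{j. j < m * Suc N \<and> \<not> m dvd Suc j}. 1 + q ^ Suc j) \<longlonglongrightarrow>
    euler_prod (q\<^sup>2) * euler_prod (q ^ m) / (euler_prod q * euler_prod (q ^ (2 * m)))"
proof -
  let ?E = "\<lambda>x N. \<Prod>i<N. 1 - x ^ Suc i :: 'a"
  have nz: "1 - x ^ Suc i \<noteq> 0" if "norm x < 1" for x :: 'a and i
    using norm_power_less_one[OF that, of "Suc i"] by auto
  \<comment> \<open>A cut at m (N + 1) contains exactly the first N + 1 multiples of m, so they
    cancel without boundary terms.\<close>
  have eq: "(\<Prod>j\<in>{j. j < m * Suc N \<and> \<not> m dvd Suc j}. 1 + q ^ Suc j) =
     ?E (q\<^sup>2) (m * Suc N) * ?E (q ^ m) (Suc N) / (?E q (m * Suc N) * ?E (q ^ (2 * m)) (Suc N))" for N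
  proof -
    have fac: "1 - (x\<^sup>2) ^ Suc i = (1 - x ^ Suc i) * (1 + x ^ Suc i)" for x :: 'a and i
      by (simp add: power2_eq_square power_mult_distrib algebra_simps)
    have 1: "?E (x\<^sup>2) M = ?E x M * (\<Prod>i<M. 1 + x ^ Suc i)" for x :: 'a and M
      unfolding fac prod.distrib ..
    have split: "(\<Prod>j<m * Suc N. 1 + q ^ Suc j) =
       (\<Prod>j\<in>{j. j < m * Suc N \<and> \<not> m dvd Suc j}. 1 + q ^ Suc j) * (\<Prod>i<Suc N. 1 + (q ^ m) ^ Suc i)"
    proof -
      have "{..<m * Suc N} = {j. j < m * Suc N \<and> \<not> m dvd Suc j} \<union> {j. j < m * Suc N \<and> m dvd Suc j}" by auto
      then have "(\<Prod>j<m * Suc N. 1 + q ^ Suc j) =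
        (\<Prod>j\<in>{j. j < m * Suc N \<and> \<not> m dvd Suc j}. 1 + q ^ Suc j) * (\<Prod>j\<in>{j. j < m * Suc N \<and> m dvd Suc j}. 1 + q ^ Suc j)"
        by (simp only:) (intro prod.union_disjoint, auto)
      also have "(\<Prod>j\<in>{j. j < m * Suc N \<and> m dvd Suc j}. 1 + q ^ Suc j) = (\<Prod>i<Suc N. 1 + (q ^ m) ^ Suc i)"
      proof (rule prod.reindex_bij_witness[where i = "\<lambda>i. m * Suc i - 1" and j = "\<lambda>j. Suc j div m - 1"])
        fix j assume "j \<in> {j. j < m * Suc N \<and> m dvd Suc j}"
        then have j: "j < m * Suc N" "m dvd Suc j" by auto
        then obtain c where c: "Suc j = m * c" by blast
        then have c0: "c > 0" by (cases c) auto
        have cN: "c \<le> Suc N" using j(1) c assms(2) by (metis Suc_leI mult_le_cancel1)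
        have "Suc j div m = c" using c assms(2) by simp
        then show "m * Suc (Suc j div m - 1) - 1 = j" "Suc j div m - 1 \<in> {..<Suc N}"
          using c c0 cN by auto
        show "1 + (q ^ m) ^ Suc (Suc j div m - 1) = 1 + q ^ Suc j"
          using \<open>Suc j div m = c\<close> c c0 by (simp add: power_mult[symmetric] del: power_Suc)
      next
        fix i assume "i \<in> {..<Suc N}"
        then have i: "i < Suc N" by simp
        have S: "Suc (m * Suc i - 1) = m * Suc i" using assms(2) by simp
        show "Suc (m * Suc i - 1) div m - 1 = i" unfolding S using assms(2) by simp
        have "m * Suc i \<le> m * Suc N" using i by (intro mult_left_mono) auto
        then have "m * Suc i - 1 < m * Suc N" using S by linarith
        moreover have "m dvd Suc (m * Suc i - 1)" unfolding S by simp
        ultimately show "m * Suc i - 1 \<in> {j. j < m * Suc N \<and> m dvd Suc j}" by blast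
      qed
      finally show ?thesis .
    qed
    have nz2: "1 + (q ^ m) ^ Suc i \<noteq> 0" for i
    proof
      assume "1 + (q ^ m) ^ Suc i = 0"
      then have "norm ((q ^ m) ^ Suc i) = 1" by (metis add_eq_0_iff2 norm_minus_cancel norm_one)
      moreover have "norm ((q ^ m) ^ Suc i) < 1" using assms by (intro norm_power_less_one) auto
      ultimately show False by simp
    qed
    have z1: "?E q (m * Suc N) \<noteq> 0" "?E (q ^ m) (Suc N) \<noteq> 0" "(\<Prod>i<Suc N. 1 + (q ^ m) ^ Suc i) \<noteq> 0"
      using nz[OF assms(1)] nz[OF norm_power_less_one[OF assms]] nz2 by (auto simp: prod_zero_iff simp del: power_Suc prod.lessThan_Suc)
    have c: "(a * (h * d)) * b / (a * (b * d)) = h" if "a \<noteq> 0" "b \<noteq> 0" "d \<noteq> 0" for a b d h :: 'a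
      using that by simp
    have pw: "q ^ (2 * m) = (q ^ m)\<^sup>2" by (simp add: power_mult[symmetric] mult.commute)
    show ?thesis unfolding pw 1 split by (rule c[OF z1, symmetric])
  qed
  have sm: "strict_mono (\<lambda>N. m * Suc N)" using assms(2) by (auto simp: strict_mono_def)
  have "(\<lambda>N. ?E (q\<^sup>2) (m * Suc N) * ?E (q ^ m) (Suc N) / (?E q (m * Suc N) * ?E (q ^ (2 * m)) (Suc N))) \<longlonglongrightarrow>
    euler_prod (q\<^sup>2) * euler_prod (q ^ m) / (euler_prod q * euler_prod (q ^ (2 * m)))"
    using assms
    by (intro tendsto_intros LIMSEQ_subseq_LIMSEQ[OF euler_prod_LIMSEQ sm, unfolded o_def]
        LIMSEQ_Suc[OF euler_prod_LIMSEQ] norm_power_less_one)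
       (auto simp: euler_prod_nonzero norm_power_less_one)
  then show ?thesis unfolding eq .
qed

text \<open>\<open>diamond_fun\<close> is the product over distinct parts, which is largest at
  \<open>norm q\<close>, times the square of the inverse Euler product. Each of the two inverse
  factors contributes one copy of the saving from \<open>euler_prod_norm_ge\<close>.\<close>

lemma diamond_fun_norm_le:
  fixes q :: complex
  assumes "norm q < 1" "m > 0"
  shows "norm (diamond_fun m q) \<le> diamond_fun m (norm q) * exp (- 2 * (1 / (1 - norm q) - Re (1 / (1 - q))))"
proof -
  let ?r = "norm q"
  let ?H = "\<lambda>x. euler_prod (x\<^sup>2) * euler_prod (x ^ m) / (euler_prod x * euler_prod (x ^ (2 * m)))"
  have D: "diamond_fun m x = ?H x * (1 / euler_prod x)\<^sup>2" for x :: "'a::{real_normed_field,banach}"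
    unfolding diamond_fun_def by (simp add: power3_eq_cube power2_eq_square)
  have H: "norm (?H q) \<le> ?H ?r"
  proof (rule LIMSEQ_le)
    show "(\<lambda>N. norm (\<Prod>j\<in>{j. j < m * Suc N \<and> \<not> m dvd Suc j}. 1 + q ^ Suc j)) \<longlonglongrightarrow> norm (?H q)"
      by (intro tendsto_norm distinct_parts_limit assms)
    show "(\<lambda>N. \<Prod>j\<in>{j. j < m * Suc N \<and> \<not> m dvd Suc j}. 1 + ?r ^ Suc j) \<longlonglongrightarrow> ?H ?r"
      using assms by (intro distinct_parts_limit) auto
    have "norm (\<Prod>j\<in>A. 1 + q ^ Suc j) \<le> (\<Prod>j\<in>A. 1 + ?r ^ Suc j)" for A
      unfolding prod_norm[symmetric]
      by (intro prod_mono) (metis norm_ge_zero norm_one norm_power norm_triangle_ineq)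
    then show "\<exists>N. \<forall>n\<ge>N. norm (\<Prod>j\<in>{j. j < m * Suc n \<and> \<not> m dvd Suc j}. 1 + q ^ Suc j)
        \<le> (\<Prod>j\<in>{j. j < m * Suc n \<and> \<not> m dvd Suc j}. 1 + ?r ^ Suc j)" by blast
  qed
  let ?X = "1 / (1 - ?r) - Re (1 / (1 - q))"
  have P: "euler_prod ?r * exp ?X \<le> norm (euler_prod q)" by (rule euler_prod_norm_ge[OF assms(1)])
  have Pr: "euler_prod ?r > 0" using assms by (intro euler_prod_pos) auto
  have "norm (1 / euler_prod q) \<le> 1 / (euler_prod ?r * exp ?X)"
    unfolding norm_divide norm_one using P Pr less_le_trans[OF mult_pos_pos[OF Pr exp_gt_zero] P]
    by (intro divide_left_mono mult_pos_pos) auto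
  then have "norm ((1 / euler_prod q)\<^sup>2) \<le> (1 / (euler_prod ?r * exp ?X))\<^sup>2"
    unfolding norm_power by (intro power_mono) auto
  also have "\<dots> = (1 / euler_prod ?r)\<^sup>2 * exp (- 2 * ?X)"
  proof -
    have "exp (- 2 * x) = (1 / exp x)\<^sup>2" for x :: real
      by (simp add: power2_eq_square inverse_eq_divide[symmetric] exp_minus[symmetric] mult_exp_exp)
    then show ?thesis by (simp only: power_divide power_mult_distrib) simp
  qed
  finally have "norm (?H q) * norm ((1 / euler_prod q)\<^sup>2) \<le> ?H ?r * ((1 / euler_prod ?r)\<^sup>2 * exp (- 2 * ?X))"
    using H by (intro mult_mono) (auto intro: order_trans[OF norm_ge_zero])
  then show ?thesis unfolding D norm_mult by (simp add: mult.assoc)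
qed

section \<open>The Bessel series\<close>

text \<open>For s > 0 this is I_k (2 sqrt s) / s^(k/2) with the modified Bessel function I_k. The
  normalisation makes it entire in \<open>s\<close>, and differentiation raises \<open>k\<close> by
  one.\<close>

definition bessel_series :: "nat \<Rightarrow> real \<Rightarrow> real" where
  "bessel_series k s = (\<Sum>j. s ^ j / (fact j * fact (j + k)))"

lemma bessel_series_summable: "summable (\<lambda>j. s ^ j / (fact j * fact (j + k) :: real))"
proof (rule summable_comparison_test')
  show "summable (\<lambda>j. norm s ^ j / fact j)" using summable_exp[of "norm s"] by (simp add: divide_inverse mult.commute)
  show "norm (s ^ j / (fact j * fact (j + k))) \<le> norm s ^ j / fact j" for j
  proof -
    have "norm s ^ j / (fact j * fact (j + k)) \<le> norm s ^ j / (fact j * 1)"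
      by (intro divide_left_mono mult_left_mono fact_ge_1 mult_pos_pos) auto
    then show ?thesis by (simp add: power_abs)
  qed
qed

lemma bessel_series_sums: "(\<lambda>j. s ^ j / (fact j * fact (j + k))) sums bessel_series k s"
  unfolding bessel_series_def by (rule summable_sums[OF bessel_series_summable])

lemma bessel_series_DERIV [derivative_intros]:
  assumes "(f has_real_derivative f') (at x)"
  shows "((\<lambda>x. bessel_series k (f x)) has_real_derivative bessel_series (Suc k) (f x) * f') (at x)"
proof -
  let ?c = "\<lambda>j. 1 / (fact j * fact (j + k)) :: real"
  have "((\<lambda>s. \<Sum>j. ?c j * s ^ j) has_real_derivative (\<Sum>j. diffs ?c j * s ^ j)) (at s)" for s
    using bessel_series_summable[where k = k] by (intro termdiffs_strong_converges_everywhere) simp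
  moreover have "diffs ?c j * s ^ j = s ^ j / (fact j * fact (j + Suc k))" for j s
  proof -
    have "real (Suc j) * (1 / (fact (Suc j) * fact (Suc j + k))) = (1 / (fact j * fact (j + Suc k)) :: real)"
      unfolding fact_Suc[of j] add_Suc add_Suc_right by (simp del: fact_Suc of_nat_Suc)
    then show ?thesis unfolding diffs_def by (simp del: fact_Suc of_nat_Suc)
  qed
  ultimately have "(bessel_series k has_real_derivative bessel_series (Suc k) s) (at s)" for s
    unfolding bessel_series_def[abs_def] by simp
  then show ?thesis using assms by (rule DERIV_chain2)
qed

text \<open>The three-term recurrence of the Bessel functions: the term of order \<open>k\<close> is
  j + (k + 1) times the term of order \<open>k + 1\<close>, and the summand j shifts the series to
  order \<open>k + 2\<close>.\<close>

lemma bessel_series_recurrence: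
  "bessel_series k s = s * bessel_series (Suc (Suc k)) s + (real k + 1) * bessel_series (Suc k) s"
proof -
  have 1: "(\<lambda>j. s * (s ^ j / (fact j * fact (j + Suc (Suc k))))) sums (s * bessel_series (Suc (Suc k)) s)"
    by (intro sums_mult bessel_series_sums)
  let ?g = "\<lambda>j. real j * s ^ j / (fact j * fact (j + Suc k))"
  have "(\<lambda>j. ?g (Suc j)) sums (s * bessel_series (Suc (Suc k)) s)"
  proof -
    have "?g (Suc j) = s * (s ^ j / (fact j * fact (j + Suc (Suc k))))" for j
      by (simp add: field_simps del: of_nat_Suc) 
    then show ?thesis using 1 by simp
  qed
  then have 2: "?g sums (s * bessel_series (Suc (Suc k)) s)" by (subst (asm) sums_Suc_iff) simp
  have 3: "(\<lambda>j. (real k + 1) * (s ^ j / (fact j * fact (j + Suc k)))) sums ((real k + 1) * bessel_series (Suc k) s)"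
    by (intro sums_mult bessel_series_sums)
  have eq: "?g j + (real k + 1) * (s ^ j / (fact j * fact (j + Suc k))) = s ^ j / (fact j * fact (j + k))" for j
  proof -
    have f: "fact (j + Suc k) = (real j + (real k + 1)) * fact (j + k)" by (simp add: algebra_simps)
    have p: "real j + (real k + 1) > 0" by simp
    have "?g j + (real k + 1) * (s ^ j / (fact j * fact (j + Suc k))) = (real j + (real k + 1)) * s ^ j / (fact j * fact (j + Suc k))"
      by (simp add: add_divide_distrib[symmetric] algebra_simps)
    also have "\<dots> = s ^ j / (fact j * fact (j + k))" unfolding f using p by simp
    finally show ?thesis .
  qed
  from sums_add[OF 2 3] have "(\<lambda>j. s ^ j / (fact j * fact (j + k))) sums
     (s * bessel_series (Suc (Suc k)) s + (real k + 1) * bessel_series (Suc k) s)"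
    unfolding eq .
  then show ?thesis using bessel_series_sums sums_unique2 by blast
qed

lemma bessel_series_ge_partial:
  assumes "s \<ge> 0"
  shows "(\<Sum>j<n. s ^ j / (fact j * fact (j + k))) \<le> bessel_series k s"
  unfolding bessel_series_def using assms by (intro sum_le_suminf bessel_series_summable) auto

lemma bessel_series_pos:
  assumes "s \<ge> 0"
  shows "bessel_series k s > 0"
proof -
  have "1 / fact k \<le> bessel_series k s"
    using bessel_series_ge_partial[OF assms, where n = 1 and k = k] by simp
  moreover have "(0::real) < 1 / fact k" by simp
  ultimately show ?thesis by linarith
qed

lemma bessel_series_3_le:
  assumes "s \<ge> 0"
  shows "bessel_series 3 s \<le> bessel_series 2 s / 3"
proof -
  have "s ^ j / (fact j * fact (j + 3)) \<le> s ^ j / (fact j * fact (j + 2)) / 3" for j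
  proof -
    have f: "fact (j + 3) = real (j + 3) * fact (j + 2)" by (simp add: eval_nat_numeral)
    have "s ^ j / (fact j * fact (j + 3)) = s ^ j / (fact j * fact (j + 2)) / real (j + 3)"
      unfolding f by (simp add: mult_ac)
    also have "\<dots> \<le> s ^ j / (fact j * fact (j + 2)) / 3"
      using assms by (intro divide_left_mono) auto
    finally show ?thesis .
  qed
  then show ?thesis
    by (rule sums_le[OF _ bessel_series_sums sums_divide[OF bessel_series_sums]])
qed

lemma bessel_series_2_le:
  assumes "s \<ge> 0"
  shows "bessel_series 2 s \<le> exp (s / 3) / 2"
proof -
  have "fact (j + 2) \<ge> 2 * (3::real) ^ j" for j
  proof (induction j)
    case (Suc j)
    have "2 * 3 ^ Suc j = 3 * (2 * (3::real) ^ j)" by simp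
    also have "\<dots> \<le> real (j + 3) * fact (j + 2)" using Suc by (intro mult_mono) auto
    also have "\<dots> = fact (Suc j + 2)" by (simp add: algebra_simps)
    finally show ?case .
  qed simp
  then have "s ^ j / (fact j * fact (j + 2)) \<le> s ^ j / (fact j * (2 * 3 ^ j))" for j
    using assms by (intro divide_left_mono mult_left_mono mult_pos_pos) auto
  moreover have "s ^ j / (fact j * (2 * 3 ^ j)) = (s / 3) ^ j /\<^sub>R fact j / 2" for j
    by (simp add: power_divide field_simps)
  ultimately have "s ^ j / (fact j * fact (j + 2)) \<le> (s / 3) ^ j /\<^sub>R fact j / 2" for j by simp
  then show ?thesis
    by (rule sums_le[OF _ bessel_series_sums sums_divide[OF exp_converges]])
qed

text \<open>
  With \<open>N z = bessel_series 2 (z\<^sup>2 / 4)\<close> and \<open>y = N'\<close>, the function \<open>h = N' / N\<close> satisfies the Riccati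
  equation \<open>h' = 1 - 5 h / z - h\<^sup>2\<close>. For a trial function \<open>\<sigma>\<close> with antiderivative \<open>\<Sigma>\<close>, the derivative of
  \<open>(h - \<sigma>) z\<^sup>5 N exp \<Sigma>\<close> is \<open>z\<^sup>5 N exp \<Sigma>\<close> times the defect of \<open>\<sigma>\<close>.
\<close>

lemma riccati_comparison_DERIV:
  fixes \<sigma> \<Sigma> :: "real \<Rightarrow> real"
  defines "N \<equiv> \<lambda>z. bessel_series 2 (z\<^sup>2 / 4)" and "y \<equiv> \<lambda>z. z / 2 * bessel_series 3 (z\<^sup>2 / 4)"
  assumes z: "z > 0" and s: "(\<sigma> has_real_derivative \<sigma>') (at z)" and S: "(\<Sigma> has_real_derivative \<sigma> z) (at z)"
  shows "((\<lambda>z. (y z - \<sigma> z * N z) * (z ^ 5 * exp (\<Sigma> z))) has_real_derivative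
     z ^ 5 * exp (\<Sigma> z) * N z * (1 - \<sigma>' - 5 * \<sigma> z / z - (\<sigma> z)\<^sup>2)) (at z)"
proof -
  have q: "((\<lambda>z. z\<^sup>2 / 4) has_real_derivative z / 2) (at z)"
    by (auto intro!: derivative_eq_intros)
  have N: "(N has_real_derivative y z) (at z)"
    unfolding N_def y_def using bessel_series_DERIV[OF q, of 2] by (simp add: mult.commute eval_nat_numeral)
  have rec: "N z = z\<^sup>2 / 4 * bessel_series 4 (z\<^sup>2 / 4) + 3 * bessel_series 3 (z\<^sup>2 / 4)"
    unfolding N_def using bessel_series_recurrence[of 2 "z\<^sup>2 / 4"] by (simp add: eval_nat_numeral)
  have "((\<lambda>z. z / 2) has_real_derivative 1 / 2) (at z)" by (auto intro!: derivative_eq_intros)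
  from DERIV_mult[OF this bessel_series_DERIV[OF q, of 3]]
  have "(y has_real_derivative bessel_series 3 (z\<^sup>2 / 4) / 2 + z / 2 * (bessel_series 4 (z\<^sup>2 / 4) * (z / 2))) (at z)"
    unfolding y_def by (simp add: eval_nat_numeral algebra_simps)
  moreover have "bessel_series 3 (z\<^sup>2 / 4) / 2 + z / 2 * (bessel_series 4 (z\<^sup>2 / 4) * (z / 2)) = N z - 5 * y z / z"
    using z unfolding rec y_def by (simp add: power2_eq_square field_simps)
  ultimately have y: "(y has_real_derivative N z - 5 * y z / z) (at z)" by metis
  show ?thesis
    by (rule derivative_eq_intros N y s S refl)+
       (use z in \<open>simp add: divide_simps\<close>, simp add: power2_eq_square eval_nat_numeral algebra_simps)
qed

text \<open>The trial function is the asymptotic expansion of I_3 (z) / I_2 (z), cut after 1 / z^2.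
  Its defect (15 / 4) / z^3 (1 - 15 / (16 z)) is nonnegative on the range, so the weighted
  difference is nondecreasing and inherits its sign from the starting point.\<close>

lemma bessel_quotient_lower:
  assumes "z \<ge> 3 / 2"
  shows "(1 - 5 / (2 * z) + 15 / (8 * z\<^sup>2)) * bessel_series 2 (z\<^sup>2 / 4) \<le> z / 2 * bessel_series 3 (z\<^sup>2 / 4)"
proof -
  let ?\<sigma> = "\<lambda>z::real. 1 - 5 / (2 * z) + 15 / (8 * z\<^sup>2)"
  let ?S = "\<lambda>z::real. z - 5 / 2 * ln z - 15 / (8 * z)"
  let ?F = "\<lambda>z. (z / 2 * bessel_series 3 (z\<^sup>2 / 4) - ?\<sigma> z * bessel_series 2 (z\<^sup>2 / 4)) * (z ^ 5 * exp (?S z))"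
  have "?F (3 / 2) \<le> ?F z"
  proof (rule DERIV_nonneg_imp_nondecreasing[OF assms])
    fix x :: real assume x: "3 / 2 \<le> x" "x \<le> z"
    then have xp: "x > 0" by simp
    have 1: "(?\<sigma> has_real_derivative 5 / (2 * x\<^sup>2) - 15 / (4 * x ^ 3)) (at x)"
      by ((rule derivative_eq_intros refl | (use xp in \<open>simp; fail\<close>))+)
         (use xp in \<open>simp add: divide_simps\<close>, simp add: power2_eq_square eval_nat_numeral algebra_simps)
    have 2: "(?S has_real_derivative ?\<sigma> x) (at x)"
      by ((rule derivative_eq_intros refl | (use xp in \<open>simp; fail\<close>))+)
         (use xp in \<open>simp add: divide_simps\<close>, simp add: power2_eq_square eval_nat_numeral algebra_simps)
    have defect: "1 - (5 / (2 * x\<^sup>2) - 15 / (4 * x ^ 3)) - 5 * ?\<sigma> x / x - (?\<sigma> x)\<^sup>2 = (15 / 4) / x ^ 3 * (1 - 15 / (16 * x))"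
      using xp by (simp add: divide_simps) (simp add: power2_eq_square eval_nat_numeral algebra_simps)
    have "15 / (16 * x) \<le> 1" using x by (simp add: field_simps)
    then have nn: "0 \<le> 15 / 4 / x ^ 3 * (1 - 15 / (16 * x))" using xp by (intro mult_nonneg_nonneg) auto
    have "bessel_series 2 (x\<^sup>2 / 4) \<ge> 0" using bessel_series_pos[of "x\<^sup>2 / 4" 2] by simp
    then have "0 \<le> x ^ 5 * exp (?S x) * bessel_series 2 (x\<^sup>2 / 4)"
      using xp by (intro mult_nonneg_nonneg) auto
    then have "0 \<le> x ^ 5 * exp (?S x) * bessel_series 2 (x\<^sup>2 / 4) *
      (1 - (5 / (2 * x\<^sup>2) - 15 / (4 * x ^ 3)) - 5 * ?\<sigma> x / x - (?\<sigma> x)\<^sup>2)"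
      unfolding defect using nn by (rule mult_nonneg_nonneg)
    then show "\<exists>d. (?F has_real_derivative d) (at x) \<and> 0 \<le> d"
      using riccati_comparison_DERIV[OF xp 1 2] by blast
  qed
  \<comment> \<open>At z = 3 / 2 the trial function equals only 1 / 6 and z^2 / 4 = 9 / 16, so crude
    bounds for the two series suffice.\<close>
  moreover have "?F (3 / 2) \<ge> 0"
  proof -
    have "bessel_series 2 (9 / 16) \<le> exp (3 / 16) / 2" using bessel_series_2_le[of "9 / 16"] by simp
    moreover have "exp (3 / 16) \<le> 1 + 3 / 16 + (3 / 16 :: real)\<^sup>2" by (rule exp_bound) auto
    moreover have "bessel_series 3 (9 / 16) \<ge> 1 / 6"
      using bessel_series_ge_partial[where s = "9 / 16" and n = 1 and k = 3] by (simp add: eval_nat_numeral)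
    ultimately show ?thesis by (intro mult_nonneg_nonneg) (auto simp: power2_eq_square)
  qed
  ultimately have "0 \<le> ?F z" by linarith
  moreover have "z ^ 5 * exp (?S z) > 0" using assms by simp
  ultimately show ?thesis by (simp only: zero_le_mult_iff) linarith
qed

text \<open>The next coefficient of the expansion is 15 / 8. The larger value 5 makes the defect
  negative from 3 / 2 on, while both bounds still agree to second order in 1 / z.\<close>

lemma bessel_quotient_upper:
  assumes "z \<ge> 3 / 2"
  shows "z / 2 * bessel_series 3 (z\<^sup>2 / 4) \<le> (1 - 5 / (2 * z) + 15 / (8 * z\<^sup>2) + 5 / z ^ 3) * bessel_series 2 (z\<^sup>2 / 4)"
proof -
  let ?\<sigma> = "\<lambda>z::real. 1 - 5 / (2 * z) + 15 / (8 * z\<^sup>2) + 5 / z ^ 3"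
  let ?S = "\<lambda>z::real. z - 5 / 2 * ln z - 15 / (8 * z) - 5 / (2 * z\<^sup>2)"
  let ?F = "\<lambda>z. (z / 2 * bessel_series 3 (z\<^sup>2 / 4) - ?\<sigma> z * bessel_series 2 (z\<^sup>2 / 4)) * (z ^ 5 * exp (?S z))"
  have "?F (3 / 2) \<ge> ?F z"
  proof (rule DERIV_nonpos_imp_nonincreasing[OF assms])
    fix x :: real assume x: "3 / 2 \<le> x" "x \<le> z"
    then have xp: "x > 0" by simp
    have 1: "(?\<sigma> has_real_derivative 5 / (2 * x\<^sup>2) - 15 / (4 * x ^ 3) - 15 / x ^ 4) (at x)"
      by ((rule derivative_eq_intros refl | (use xp in \<open>simp; fail\<close>))+)
         (use xp in \<open>simp add: divide_simps\<close>, simp add: power2_eq_square eval_nat_numeral algebra_simps)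
    have 2: "(?S has_real_derivative ?\<sigma> x) (at x)"
      by ((rule derivative_eq_intros refl | (use xp in \<open>simp; fail\<close>))+)
         (use xp in \<open>simp add: divide_simps\<close>, simp add: power2_eq_square eval_nat_numeral algebra_simps)
    have defect: "1 - (5 / (2 * x\<^sup>2) - 15 / (4 * x ^ 3) - 15 / x ^ 4) - 5 * ?\<sigma> x / x - (?\<sigma> x)\<^sup>2 =
       - (25 * x ^ 3 / 4 - 735 * x\<^sup>2 / 64 + 75 * x / 4 + 25) / x ^ 6"
      using xp by (simp add: divide_simps) (simp add: power2_eq_square eval_nat_numeral algebra_simps)
    \<comment> \<open>The square is completed from the two leading terms of the cubic; the linear
      coefficient (147 / 64)^2 it requires is below 75 / 4.\<close>
    have "0 \<le> x * (5 / 2 * x - 147 / 64)\<^sup>2" using xp by simp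
    then have "25 * x ^ 3 / 4 - 735 * x\<^sup>2 / 64 + (147 / 64)\<^sup>2 * x \<ge> 0"
      by (simp add: power2_eq_square eval_nat_numeral algebra_simps)
    then have "25 * x ^ 3 / 4 - 735 * x\<^sup>2 / 64 + 75 * x / 4 + 25 \<ge> 0"
      using xp by (simp add: power2_eq_square)
    then have np: "- (25 * x ^ 3 / 4 - 735 * x\<^sup>2 / 64 + 75 * x / 4 + 25) / x ^ 6 \<le> 0"
      using xp by (intro divide_nonpos_pos) auto
    have "bessel_series 2 (x\<^sup>2 / 4) \<ge> 0" using bessel_series_pos[of "x\<^sup>2 / 4" 2] by simp
    then have "0 \<le> x ^ 5 * exp (?S x) * bessel_series 2 (x\<^sup>2 / 4)"
      using xp by (intro mult_nonneg_nonneg) auto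
    then have "x ^ 5 * exp (?S x) * bessel_series 2 (x\<^sup>2 / 4) *
      (1 - (5 / (2 * x\<^sup>2) - 15 / (4 * x ^ 3) - 15 / x ^ 4) - 5 * ?\<sigma> x / x - (?\<sigma> x)\<^sup>2) \<le> 0"
      unfolding defect using np by (rule mult_nonneg_nonpos)
    then show "\<exists>d. (?F has_real_derivative d) (at x) \<and> d \<le> 0"
      using riccati_comparison_DERIV[OF xp 1 2] by blast
  qed
  moreover have "?F (3 / 2) \<le> 0"
  proof -
    have "bessel_series 3 (9 / 16) \<le> bessel_series 2 (9 / 16) / 3" using bessel_series_3_le[of "9 / 16"] by simp
    moreover have "bessel_series 2 (9 / 16) > 0" by (rule bessel_series_pos) simp
    ultimately show ?thesis by (intro mult_nonpos_nonneg) (auto simp: power2_eq_square eval_nat_numeral)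
  qed
  ultimately have "?F z \<le> 0" by linarith
  moreover have "z ^ 5 * exp (?S z) > 0" using assms by simp
  ultimately have "\<not> 0 < z / 2 * bessel_series 3 (z\<^sup>2 / 4) - ?\<sigma> z * bessel_series 2 (z\<^sup>2 / 4)"
    using mult_pos_pos by (metis not_less)
  then show ?thesis by simp
qed

text \<open>By \<open>bessel_quotient_lower\<close> the logarithmic derivative is at least 1 - 5 /
  (2 z), so the quotient by exp (z - 5 / 2 ln z) is nondecreasing. Its value at 4 is at least 8 / 5
  times 32 / 55, which exceeds 9 / 10.\<close>

lemma bessel_series_2_exp_lower:
  assumes "z \<ge> 4"
  shows "bessel_series 2 (z\<^sup>2 / 4) \<ge> 9 / 10 * exp (z - 5 / 2 * ln z)"
proof -
  let ?F = "\<lambda>z. bessel_series 2 (z\<^sup>2 / 4) * exp (5 / 2 * ln z - z)"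
  have "?F 4 \<le> ?F z"
  proof (rule DERIV_nonneg_imp_nondecreasing[OF assms])
    fix x :: real assume x: "4 \<le> x" "x \<le> z"
    then have xp: "x > 0" by simp
    have q: "((\<lambda>z. z\<^sup>2 / 4) has_real_derivative x / 2) (at x)"
      by (auto intro!: derivative_eq_intros)
    have N: "((\<lambda>z. bessel_series 2 (z\<^sup>2 / 4)) has_real_derivative x / 2 * bessel_series 3 (x\<^sup>2 / 4)) (at x)"
      using bessel_series_DERIV[OF q, of 2] by (simp add: mult.commute eval_nat_numeral)
    have E: "((\<lambda>z. exp (5 / 2 * ln z - z)) has_real_derivative exp (5 / 2 * ln x - x) * (5 / (2 * x) - 1)) (at x)"
      using xp by (auto intro!: derivative_eq_intros)
    have "(1 - 5 / (2 * x) + 15 / (8 * x\<^sup>2)) * bessel_series 2 (x\<^sup>2 / 4) \<le> x / 2 * bessel_series 3 (x\<^sup>2 / 4)"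
      using x by (intro bessel_quotient_lower) auto
    moreover have "15 / (8 * x\<^sup>2) * bessel_series 2 (x\<^sup>2 / 4) \<ge> 0"
      using bessel_series_pos[of "x\<^sup>2 / 4" 2] xp by (intro mult_nonneg_nonneg) auto
    ultimately have "x / 2 * bessel_series 3 (x\<^sup>2 / 4) + bessel_series 2 (x\<^sup>2 / 4) * (5 / (2 * x) - 1) \<ge> 0"
      by (simp add: algebra_simps)
    then have "exp (5 / 2 * ln x - x) * (x / 2 * bessel_series 3 (x\<^sup>2 / 4) + bessel_series 2 (x\<^sup>2 / 4) * (5 / (2 * x) - 1)) \<ge> 0"
      by (intro mult_nonneg_nonneg) auto
    then show "\<exists>d. (?F has_real_derivative d) (at x) \<and> 0 \<le> d"
      using DERIV_mult[OF N E] by (intro exI[of _ "exp (5 / 2 * ln x - x) * (x / 2 * bessel_series 3 (x\<^sup>2 / 4) + bessel_series 2 (x\<^sup>2 / 4) * (5 / (2 * x) - 1))"] conjI) (simp_all add: algebra_simps)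
  qed
  moreover have "?F 4 \<ge> 9 / 10"
  proof -
    have "(\<Sum>j<5. 4 ^ j / (fact j * fact (j + 2))) \<le> bessel_series 2 4" by (rule bessel_series_ge_partial) simp
    then have b: "8 / 5 \<le> bessel_series 2 4" by (simp add: eval_nat_numeral fact_numeral)
    have "exp 4 = exp (1::real) ^ 4" by (simp add: exp_of_nat_mult[symmetric])
    also have "\<dots> \<le> (272 / 100) ^ 4" using e_less_272 by (intro power_mono) auto
    finally have e: "exp 4 \<le> (55::real)" by (simp add: power_divide)
    have "exp (5 / 2 * ln 4) = (32::real)"
    proof -
      have "ln 4 = 2 * ln (2::real)" using ln_realpow[of 2 2] by simp
      then have "5 / 2 * ln 4 = ln ((2::real) ^ 5)" by (subst ln_realpow) auto
      then show ?thesis by simp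
    qed
    then have "exp (5 / 2 * ln 4 - 4) = 32 / exp (4::real)" by (simp add: exp_diff)
    moreover have "32 / exp (4::real) \<ge> 32 / 55" using e by (intro divide_left_mono) auto
    ultimately have "?F 4 \<ge> 8 / 5 * (32 / 55)" using b by (intro mult_mono) auto
    then show ?thesis by simp
  qed
  ultimately have "9 / 10 \<le> ?F z" by linarith
  then have "9 / 10 * exp (z - 5 / 2 * ln z) \<le> ?F z * exp (z - 5 / 2 * ln z)" by (intro mult_right_mono) auto
  also have "\<dots> = bessel_series 2 (z\<^sup>2 / 4)" by (simp add: mult.assoc mult_exp_exp)
  finally show ?thesis .
qed

section \<open>The circle method\<close>

definition fps_complex :: "real fps \<Rightarrow> complex fps" where
  "fps_complex f = Abs_fps (\<lambda>n. complex_of_real (fps_nth f n))"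

lemma fps_complex_simps:
  "fps_complex 1 = 1" "fps_complex fps_X = fps_X"
  "fps_complex (f + g) = fps_complex f + fps_complex g"
  "fps_complex (- f) = - fps_complex f"
  "fps_complex (f * g) = fps_complex f * fps_complex g"
  by (auto simp: fps_complex_def fps_eq_iff fps_mult_nth fps_X_def)

lemma fps_complex_power: "fps_complex (f ^ n) = fps_complex f ^ n"
  by (induction n) (simp_all add: fps_complex_simps)

lemma fps_complex_sum: "finite A \<Longrightarrow> fps_complex (\<Sum>i\<in>A. f i) = (\<Sum>i\<in>A. fps_complex (f i))"
  by (induction A rule: finite_induct) (simp_all add: fps_complex_simps, simp add: fps_complex_def fps_eq_iff)

lemma fps_complex_pentagonal: "fps_complex (pentagonal_fps d) = pentagonal_fps d"
proof (rule fps_ext)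
  fix n
  have "fps_complex (pentagonal_sum (fps_X ^ d) n) = pentagonal_sum (fps_X ^ d) n"
    unfolding pentagonal_sum_def
    by (simp only: fps_complex_simps fps_complex_power fps_complex_sum finite_lessThan)
  then show "fps_nth (fps_complex (pentagonal_fps d)) n = fps_nth (pentagonal_fps d) n"
    by (simp add: pentagonal_fps_def fps_complex_def fps_eq_iff)
qed

text \<open>The finite products converge uniformly near 0 to the Euler product and coefficientwise
  to the pentagonal series, so the second limit is the Taylor series of the first.\<close>

lemma euler_prod_power_has_fps_expansion:
  assumes "d > 0"
  shows "(\<lambda>q. euler_prod (q ^ d)) has_fps_expansion (pentagonal_fps d :: complex fps)"
proof -
  have holo: "(\<lambda>q::complex. euler_prod (q ^ d)) holomorphic_on ball 0 1"
    using assms by (intro euler_prod_holomorphic_compose holomorphic_intros norm_power_less_one) auto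
  have ex: "(\<lambda>q::complex. euler_prod (q ^ d)) has_fps_expansion fps_expansion (\<lambda>q. euler_prod (q ^ d)) 0"
    by (rule has_fps_expansion_fps_expansion[of "ball 0 1"]) (auto intro: holo)
  have "fps_expansion (\<lambda>q::complex. euler_prod (q ^ d)) 0 = pentagonal_fps d"
  proof (rule uniform_limit_imp_fps_expansion_eq)
    show "(\<lambda>N. \<Prod>i<N. 1 - (fps_X ^ d) ^ Suc i) \<longlonglongrightarrow> (pentagonal_fps d :: complex fps)"
      by (rule euler_pentagonal_fps[OF assms])
    have "q ^ d \<in> cball 0 (1 / 2)" if "q \<in> ball 0 (1 / 2)" for q :: complex
    proof -
      have "norm q ^ d \<le> norm q ^ 1" using that assms by (intro power_decreasing) auto
      then show ?thesis using that by (simp add: norm_power)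
    qed
    then show "uniform_limit (ball 0 (1/2)) (\<lambda>N q::complex. \<Prod>i<N. 1 - (q ^ d) ^ Suc i) (\<lambda>q. euler_prod (q ^ d)) sequentially"
      by (intro uniform_limit_compose'[OF euler_prod_uniform_limit[of "1/2"], where h = "\<lambda>q. q ^ d"]) auto
    show "\<forall>\<^sub>F N in sequentially. (\<lambda>q::complex. \<Prod>i<N. 1 - (q ^ d) ^ Suc i) has_fps_expansion (\<Prod>i<N. 1 - (fps_X ^ d) ^ Suc i)"
      by (intro always_eventually allI) (auto intro!: fps_expansion_intros simp del: power_Suc)
    show "\<forall>\<^sub>F N in sequentially. (\<lambda>q::complex. \<Prod>i<N. 1 - (q ^ d) ^ Suc i) holomorphic_on ball 0 (1/2)"
      by (intro always_eventually allI holomorphic_intros)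
  qed (use ex in auto)
  with ex show ?thesis by simp
qed

lemma diamond_fun_holomorphic: "m > 0 \<Longrightarrow> diamond_fun m holomorphic_on ball (0::complex) 1"
  using diamond_fun_holomorphic_compose(1)[of "\<lambda>z. z" "ball 0 1" m] by (auto intro: holomorphic_intros)

text \<open>The identity with cleared denominators holds for the Taylor series of
  \<open>diamond_fun\<close> and for the formal product alike; the common factor has constant term 1
  and can be cancelled.\<close>

theorem broken_diamond_eq_deriv:
  "(deriv ^^ n) (diamond_fun (2 * k + 1)) 0 / fact n = complex_of_real (\<Delta> k n)"
proof -
  let ?m = "2 * k + 1"
  let ?F = "diamond_fun ?m :: complex \<Rightarrow> complex"
  have ex: "?F has_fps_expansion fps_expansion ?F 0"
    by (rule has_fps_expansion_fps_expansion[of "ball 0 1"]) (auto intro: diamond_fun_holomorphic)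
  have p1: "euler_prod has_fps_expansion (pentagonal_fps 1 :: complex fps)"
    using euler_prod_power_has_fps_expansion[of 1] by simp
  have lhs: "(\<lambda>q. ?F q * (euler_prod q ^ 3 * euler_prod (q ^ (4 * k + 2)))) has_fps_expansion
     (fps_expansion ?F 0 * (pentagonal_fps 1 ^ 3 * pentagonal_fps (4 * k + 2)))"
    by (intro fps_expansion_intros ex p1 euler_prod_power_has_fps_expansion) simp
  have rhs: "(\<lambda>q::complex. euler_prod (q ^ 2) * euler_prod (q ^ ?m)) has_fps_expansion (pentagonal_fps 2 * pentagonal_fps ?m)"
    by (intro fps_expansion_intros euler_prod_power_has_fps_expansion) auto
  have "\<forall>\<^sub>F q in nhds 0. q \<in> ball (0::complex) 1"
    by (intro eventually_nhds_in_open) auto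
  then have ev: "\<forall>\<^sub>F q in nhds 0. ?F q * (euler_prod q ^ 3 * euler_prod (q ^ (4 * k + 2))) = euler_prod (q ^ 2) * euler_prod (q ^ ?m)"
  proof eventually_elim
    case (elim q)
    have e: "2 * ?m = 4 * k + 2" by simp
    have "norm q < 1" using elim by simp
    then have "euler_prod q \<noteq> 0" "euler_prod (q ^ (4 * k + 2)) \<noteq> 0"
      by (intro euler_prod_nonzero norm_power_less_one; simp)+
    then show ?case unfolding diamond_fun_def e by simp
  qed
  have "(\<lambda>q. ?F q * (euler_prod q ^ 3 * euler_prod (q ^ (4 * k + 2)))) has_fps_expansion (pentagonal_fps 2 * pentagonal_fps ?m)"
    by (subst has_fps_expansion_cong[OF ev refl]) (rule rhs)
  then have "fps_expansion ?F 0 * (pentagonal_fps 1 ^ 3 * pentagonal_fps (4 * k + 2)) = pentagonal_fps 2 * pentagonal_fps ?m"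
    using lhs fps_expansion_unique_complex by blast
  also have "\<dots> = fps_complex (broken_diamond_gf k * (pentagonal_fps 1 ^ 3 * pentagonal_fps (4 * k + 2)))"
    unfolding broken_diamond_gf_identity by (simp only: fps_complex_simps fps_complex_pentagonal)
  also have "\<dots> = fps_complex (broken_diamond_gf k) * (pentagonal_fps 1 ^ 3 * pentagonal_fps (4 * k + 2))"
    by (simp only: fps_complex_simps fps_complex_pentagonal fps_complex_power)
  finally have eq: "fps_expansion ?F 0 * (pentagonal_fps 1 ^ 3 * pentagonal_fps (4 * k + 2)) =
    fps_complex (broken_diamond_gf k) * (pentagonal_fps 1 ^ 3 * pentagonal_fps (4 * k + 2))" .
  have "fps_nth (pentagonal_fps 1 ^ 3 * pentagonal_fps (4 * k + 2) :: complex fps) 0 = 1"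
    by (simp add: pentagonal_fps_def pentagonal_sum_def power3_eq_cube)
  then have "pentagonal_fps 1 ^ 3 * pentagonal_fps (4 * k + 2) \<noteq> (0 :: complex fps)" by auto
  with eq have "fps_expansion ?F 0 = fps_complex (broken_diamond_gf k)" by simp
  then have "fps_nth (fps_expansion ?F 0) n = complex_of_real (\<Delta> k n)"
    by (simp add: fps_complex_def broken_diamond_def)
  then show ?thesis by (simp add: fps_expansion_def)
qed

lemma broken_diamond_contour_integral:
  assumes "a > 0"
  shows "((\<lambda>t. diamond_fun (2 * k + 1) (exp (- t)) * exp (of_nat n * t)) has_contour_integral
      2 * of_real pi * \<i> * of_real (\<Delta> k n)) (linepath (Complex a (- pi)) (Complex a pi))"
proof -
  let ?F = "diamond_fun (2 * k + 1) :: complex \<Rightarrow> complex"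
  define r where "r = exp (- a)"
  have r: "0 < r" "r < 1" using assms by (auto simp: r_def)
  have "((\<lambda>u. ?F u / (u - 0) ^ Suc n) has_contour_integral (2 * pi * \<i>) / fact n * (deriv ^^ n) ?F 0) (circlepath 0 r)"
  proof (rule Cauchy_has_contour_integral_higher_derivative_circlepath)
    have "cball 0 r \<subseteq> ball (0::complex) 1" using r by (auto simp: subset_eq)
    then have "?F holomorphic_on cball 0 r"
      by (rule holomorphic_on_subset[OF diamond_fun_holomorphic, rotated]) simp
    then show "continuous_on (cball 0 r) ?F" by (rule holomorphic_on_imp_continuous_on)
    show "?F holomorphic_on ball 0 r"
      by (rule holomorphic_on_subset[OF \<open>?F holomorphic_on cball 0 r\<close>]) auto
  qed (use r in auto)
  then have "((\<lambda>u. ?F u / u ^ Suc n) has_contour_integral 2 * pi * \<i> * of_real (\<Delta> k n)) (circlepath 0 r)"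
    by (simp add: broken_diamond_eq_deriv[symmetric])
  \<comment> \<open>The circle has to start at - r, the image of both ends Im t = - pi and Im t = pi
    of the segment. In \<open>circlepath\<close> a negative radius describes this starting
    point.\<close>
  then have "((\<lambda>u. ?F u / u ^ Suc n) has_contour_integral 2 * pi * \<i> * of_real (\<Delta> k n)) (shiftpath (1 / 2) (circlepath 0 r))"
    by (rule has_contour_integral_shiftpath) auto
  also have "shiftpath (1 / 2) (circlepath 0 r) = circlepath 0 (- r)"
  proof
    fix x :: real
    have "exp (2 * complex_of_real pi * \<i> * of_real (1 / 2 + x)) = - exp (2 * complex_of_real pi * \<i> * of_real x)"
    proof -
      have "2 * complex_of_real pi * \<i> * of_real (1 / 2 + x) = \<i> * of_real pi + 2 * complex_of_real pi * \<i> * of_real x"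
        by (simp add: algebra_simps)
      then show ?thesis by (simp only: exp_add) simp
    qed
    moreover have "exp (2 * complex_of_real pi * \<i> * of_real (1 / 2 + x - 1)) = - exp (2 * complex_of_real pi * \<i> * of_real x)"
    proof -
      have "2 * complex_of_real pi * \<i> * of_real (1 / 2 + x - 1) = - (\<i> * of_real pi) + 2 * complex_of_real pi * \<i> * of_real x"
        by (simp add: algebra_simps)
      then show ?thesis by (simp only: exp_add exp_minus) simp
    qed
    ultimately show "shiftpath (1 / 2) (circlepath 0 r) x = circlepath 0 (- r) x"
      unfolding shiftpath_def circlepath by (simp only: if_split) simp
  qed
  finally have "((\<lambda>x. ?F (circlepath 0 (- r) x) / circlepath 0 (- r) x ^ Suc n *
      vector_derivative (circlepath 0 (- r)) (at x within {0..1})) has_integral 2 * pi * \<i> * of_real (\<Delta> k n)) {0..1}"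
    by (simp add: has_contour_integral_def)
  \<comment> \<open>The substitution q = exp (- t) gives q^(- n - 1) dq = - exp (n t) dt. While q
    runs counterclockwise, Im t decreases, so the segment appears descending first and is reversed
    at the end.\<close>
  moreover have "?F (circlepath 0 (- r) x) / circlepath 0 (- r) x ^ Suc n *
      vector_derivative (circlepath 0 (- r)) (at x within {0..1}) =
     - (?F (exp (- linepath (Complex a pi) (Complex a (- pi)) x)) * exp (of_nat n * linepath (Complex a pi) (Complex a (- pi)) x) *
      (Complex a (- pi) - Complex a pi))" if "x \<in> {0..1}" for x
  proof -
    let ?l = "linepath (Complex a pi) (Complex a (- pi)) x"
    have l: "?l = of_real a + \<i> * of_real pi - 2 * of_real pi * \<i> * of_real x"
      by (simp add: linepath_def complex_eq_iff algebra_simps)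
    have "exp (- ?l) = exp (- of_real a) * exp (- (\<i> * of_real pi)) * exp (2 * of_real pi * \<i> * of_real x)"
      unfolding exp_add[symmetric] l by (simp add: algebra_simps)
    also have "exp (- (\<i> * of_real pi)) = -1" by (simp add: exp_minus)
    also have "exp (- complex_of_real a) = of_real r" by (simp add: r_def exp_of_real[symmetric])
    finally have u: "exp (- ?l) = circlepath 0 (- r) x" by (simp add: circlepath)
    have d: "vector_derivative (circlepath 0 (- r)) (at x within {0..1}) = 2 * of_real pi * \<i> * exp (- ?l)"
      using that unfolding u by (subst vector_derivative_circlepath01) (auto simp: circlepath)
    have w: "Complex a (- pi) - Complex a pi = - (2 * of_real pi * \<i>)" by (simp add: complex_eq_iff)
    have e: "exp (of_nat n * ?l) = 1 / exp (- ?l) ^ n" by (simp add: exp_of_nat_mult exp_minus field_simps)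
    have alg: "y / v ^ Suc n * (c * v) = - (y * (1 / v ^ n) * (- c))" if "v \<noteq> 0" for y v c :: complex
      using that by simp
    show ?thesis unfolding d u[symmetric] w e by (rule alg) simp
  qed
  ultimately have hi: "((\<lambda>x. - (?F (exp (- linepath (Complex a pi) (Complex a (- pi)) x)) * exp (of_nat n * linepath (Complex a pi) (Complex a (- pi)) x) *
      (Complex a (- pi) - Complex a pi))) has_integral 2 * pi * \<i> * of_real (\<Delta> k n)) {0..1}"
    by (subst (asm) has_integral_cong) auto
  have "((\<lambda>t. ?F (exp (- t)) * exp (of_nat n * t)) has_contour_integral - (2 * pi * \<i> * of_real (\<Delta> k n))) (linepath (Complex a pi) (Complex a (- pi)))"
    unfolding has_contour_integral_linepath using has_integral_neg[OF hi] by (simp only: minus_minus)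
  then have "((\<lambda>t. ?F (exp (- t)) * exp (of_nat n * t)) has_contour_integral - (- (2 * pi * \<i> * of_real (\<Delta> k n)))) (reversepath (linepath (Complex a pi) (Complex a (- pi))))"
    by (intro has_contour_integral_reversepath) auto
  then show ?thesis by simp
qed

section \<open>The main term as a contour integral\<close>

definition bessel_main :: "real \<Rightarrow> real \<Rightarrow> real" where
  "bessel_main A x = A\<^sup>2 / (2 * pi) * bessel_series 2 (A * x)"

text \<open>exp (A / t) is expanded and integrated term by term. The terms \<open>j < 2\<close> are
  holomorphic; \<open>j = i + 2\<close> picks the coefficient of t^i in exp (x t). The shift by 2,
  caused by the factor t in front, is the order of the Bessel function.\<close>

lemma bessel_main_circle_integral:
  fixes A x :: real
  shows "((\<lambda>t. t / (2 * of_real pi) * exp (of_real A / t + of_real x * t)) has_contour_integral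
     2 * of_real pi * \<i> * of_real (bessel_main A x)) (circlepath 0 1)"
proof -
  let ?g = "\<lambda>t. t / (2 * of_real pi) * exp (of_real A / t + of_real x * t)"
  let ?term = "\<lambda>j t. t / (2 * of_real pi) * exp (of_real x * t) * ((of_real A / t) ^ j / fact j)"
  let ?c = "\<lambda>j. if j < 2 then 0 else 2 * complex_of_real pi * \<i> * (of_real (A ^ j * x ^ (j - 2) / (2 * pi * fact j * fact (j - 2))))"
  have trm: "(?term j has_contour_integral ?c j) (circlepath 0 1)" for j
  proof (cases "j < 2")
    case True
    have "((\<lambda>t. of_real A ^ j / (2 * of_real pi) * t ^ (1 - j) * exp (of_real x * t)) has_contour_integral 0) (circlepath 0 1)"
      by (rule Cauchy_theorem_convex_simple[of _ UNIV]) (auto intro!: holomorphic_intros)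
    moreover have "of_real A ^ j / (2 * of_real pi) * t ^ (1 - j) * exp (of_real x * t) = ?term j t"
      if "t \<in> path_image (circlepath 0 1)" for t :: complex
    proof -
      have "t \<noteq> 0" using that by auto
      moreover have "j = 0 \<or> j = 1" using True by auto
      ultimately show ?thesis by auto
    qed
    ultimately have "(?term j has_contour_integral 0) (circlepath 0 1)" by (rule has_contour_integral_eq)
    with True show ?thesis by simp
  next
    case False
    then obtain i where i: "j = i + 2" by (metis add.commute le_Suc_ex not_less)
    have "((\<lambda>t. exp (of_real x * t) / (t - 0) ^ Suc i) has_contour_integral
      (2 * pi * \<i>) / fact i * (deriv ^^ i) (\<lambda>t. exp (of_real x * t)) 0) (circlepath 0 1)"
      by (rule Cauchy_has_contour_integral_higher_derivative_circlepath)
         (auto intro!: holomorphic_intros continuous_intros)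
    moreover have "(deriv ^^ i) (\<lambda>t. exp (complex_of_real x * t)) 0 = of_real x ^ i"
    proof -
      have "(\<lambda>t. exp (complex_of_real x * t)) has_fps_expansion fps_exp (of_real x)"
        by (rule fps_expansion_intros)
      from fps_nth_fps_expansion[OF this, of i] show ?thesis by (simp add: field_simps)
    qed
    ultimately have "((\<lambda>t. exp (of_real x * t) / t ^ Suc i) has_contour_integral
      (2 * pi * \<i>) / fact i * of_real x ^ i) (circlepath 0 1)" by simp
    then have "((\<lambda>t. of_real A ^ j / (2 * of_real pi * fact j) * (exp (of_real x * t) / t ^ Suc i)) has_contour_integral
      of_real A ^ j / (2 * of_real pi * fact j) * ((2 * pi * \<i>) / fact i * of_real x ^ i)) (circlepath 0 1)"
      by (rule has_contour_integral_lmul)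
    moreover have "of_real A ^ j / (2 * of_real pi * fact j) * (exp (of_real x * t) / t ^ Suc i) = ?term j t"
      if "t \<in> path_image (circlepath 0 1)" for t :: complex
    proof -
      have "t \<noteq> 0" using that by auto
      moreover have "t ^ j = t * t ^ Suc i" unfolding i by simp
      ultimately show ?thesis unfolding power_divide by (simp add: field_simps del: power_Suc)
    qed
    ultimately have h: "(?term j has_contour_integral of_real A ^ j / (2 * of_real pi * fact j) * ((2 * pi * \<i>) / fact i * of_real x ^ i)) (circlepath 0 1)"
      by (rule has_contour_integral_eq)
    have e: "of_real A ^ j / (2 * of_real pi * fact j) * ((2 * pi * \<i>) / fact i * of_real x ^ i) = ?c j"
      unfolding i by (simp add: field_simps)
    from h show ?thesis unfolding e .
  qed
  have sums: "((\<lambda>t. \<Sum>j<J. ?term j t) has_contour_integral (\<Sum>j<J. ?c j)) (circlepath 0 1)" for J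
    by (intro has_contour_integral_sum trm) auto
  have ul: "uniform_limit (path_image (circlepath 0 1)) (\<lambda>J t. \<Sum>j<J. ?term j t) ?g sequentially"
  proof -
    have "uniform_limit (path_image (circlepath 0 1)) (\<lambda>J t. \<Sum>j<J. ?term j t) (\<lambda>t. \<Sum>j. ?term j t) sequentially"
    proof (rule Weierstrass_m_test)
      show "summable (\<lambda>j. exp \<bar>x\<bar> * (\<bar>A\<bar> ^ j /\<^sub>R fact j))"
        by (intro summable_mult sums_summable[OF exp_converges])
      fix j and t :: complex assume "t \<in> path_image (circlepath 0 1)"
      then have t: "norm t = 1" by simp
      have "Re (of_real x * t) \<le> \<bar>x\<bar>" using complex_Re_le_cmod[of "of_real x * t"] t by (simp add: norm_mult)
      then have "norm (exp (of_real x * t)) \<le> exp \<bar>x\<bar>" by simp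
      moreover have "norm (t / (2 * complex_of_real pi)) \<le> 1" using t pi_ge_two by (simp add: norm_divide norm_mult)
      ultimately have "norm (t / (2 * of_real pi)) * norm (exp (of_real x * t)) * norm ((of_real A / t) ^ j / fact j) \<le> 1 * exp \<bar>x\<bar> * (\<bar>A\<bar> ^ j / fact j)"
        using t by (intro mult_mono) (auto simp: norm_divide norm_power)
      then show "norm (?term j t) \<le> exp \<bar>x\<bar> * (\<bar>A\<bar> ^ j /\<^sub>R fact j)"
        unfolding norm_mult by (simp add: field_simps)
    qed
    moreover have "(\<Sum>j. ?term j t) = ?g t" for t :: complex
    proof -
      have "(\<lambda>j. ?term j t) sums (t / (2 * of_real pi) * exp (of_real x * t) * exp (of_real A / t))"
        using exp_converges[of "of_real A / t"] by (intro sums_mult) (simp add: scaleR_conv_of_real field_simps)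
      then show ?thesis by (simp add: sums_iff exp_add mult_ac)
    qed
    ultimately show ?thesis by simp
  qed
  have sph: "path_image (circlepath 0 1) = sphere (0::complex) 1" by simp
  have "\<forall>\<^sub>F J in sequentially. (\<lambda>t. \<Sum>j<J. ?term j t) contour_integrable_on circlepath 0 1"
    using sums unfolding contour_integrable_on_def by (intro always_eventually) blast
  note lims = contour_integral_uniform_limit_circlepath[OF this ul[unfolded sph]]
  have int: "?g contour_integrable_on circlepath 0 1" by (rule lims(1)) auto
  have lim: "(\<lambda>J. contour_integral (circlepath 0 1) (\<lambda>t. \<Sum>j<J. ?term j t)) \<longlonglongrightarrow> contour_integral (circlepath 0 1) ?g"
    by (rule lims(2)) auto
  have "(\<lambda>J. \<Sum>j<J. ?c j) \<longlonglongrightarrow> contour_integral (circlepath 0 1) ?g"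
    using lim unfolding contour_integral_unique[OF sums] .
  then have s1: "?c sums contour_integral (circlepath 0 1) ?g" by (simp add: sums_def)
  have "(\<lambda>j. A\<^sup>2 / (2 * pi) * ((A * x) ^ j / (fact j * fact (j + 2)))) sums bessel_main A x"
    unfolding bessel_main_def by (intro sums_mult bessel_series_sums)
  moreover have "A\<^sup>2 / (2 * pi) * ((A * x) ^ j / (fact j * fact (j + 2))) = A ^ (j + 2) * x ^ j / (2 * pi * fact (j + 2) * fact j)" for j
    by (simp add: power_add power_mult_distrib power2_eq_square field_simps del: fact_Suc)
  ultimately have "(\<lambda>j. A ^ (j + 2) * x ^ j / (2 * pi * fact (j + 2) * fact j)) sums bessel_main A x" by simp
  then have "(\<lambda>j. 2 * complex_of_real pi * \<i> * of_real (A ^ (j + 2) * x ^ j / (2 * pi * fact (j + 2) * fact j))) sums (2 * complex_of_real pi * \<i> * of_real (bessel_main A x))"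
    by (intro sums_mult) (simp only: sums_of_real_iff)
  then have "(\<lambda>j. ?c (j + 2)) sums (2 * complex_of_real pi * \<i> * of_real (bessel_main A x))" by simp
  then have "?c sums (2 * complex_of_real pi * \<i> * of_real (bessel_main A x))"
    by (subst (asm) sums_iff_shift) (simp add: lessThan_Suc eval_nat_numeral)
  then have "contour_integral (circlepath 0 1) ?g = 2 * of_real pi * \<i> * of_real (bessel_main A x)"
    using s1 sums_unique2 by blast
  then show ?thesis using int by (metis has_contour_integral_integral)
qed

text \<open>The essential singularity at 0 is the only one, so circle and rectangle enclose the same
  residue. The right side of the rectangle is the segment of the Cauchy integral; the other three
  sides become part of the error.\<close>

lemma bessel_main_rect_integral:
  fixes A x a :: real
  assumes "a > 0"
  defines "g \<equiv> \<lambda>t. t / (2 * of_real pi) * exp (of_real A / t + of_real x * t)"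
  shows "contour_integral (rectpath (Complex (-1) (- pi)) (Complex a pi)) g = 2 * of_real pi * \<i> * of_real (bessel_main A x)"
proof -
  have holo: "g holomorphic_on UNIV - {0}"
    unfolding g_def by (auto intro!: holomorphic_intros)
  have "(g has_contour_integral 2 * pi * \<i> * residue g 0) (circlepath 0 1)"
    by (rule base_residue[of UNIV]) (use holo in auto)
  then have res: "2 * pi * \<i> * residue g 0 = 2 * of_real pi * \<i> * of_real (bessel_main A x)"
    using bessel_main_circle_integral[of A x] unfolding g_def by (rule has_contour_integral_unique)
  have box: "0 \<in> box (Complex (-1) (- pi)) (Complex a pi)"
    using assms by (simp add: in_box_complex_iff)
  have "contour_integral (rectpath (Complex (-1) (- pi)) (Complex a pi)) g =
     2 * pi * \<i> * (\<Sum>p\<in>{0}. winding_number (rectpath (Complex (-1) (- pi)) (Complex a pi)) p * residue g p)"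
  proof (rule Residue_theorem[of UNIV])
    show "path_image (rectpath (Complex (-1) (- pi)) (Complex a pi)) \<subseteq> UNIV - {0}"
      using box path_image_rectpath_cbox_minus_box[of "Complex (-1) (- pi)" "Complex a pi"] assms by auto
  qed (use holo in auto)
  then show ?thesis using winding_number_rectpath[OF box] res by simp
qed

section \<open>Estimates on the vertical segment\<close>

lemma one_minus_cos_ge:
  fixes x :: real
  assumes "\<bar>x\<bar> \<le> pi"
  shows "1 - cos x \<ge> 2 * x\<^sup>2 / pi\<^sup>2"
proof -
  define t where "t = \<bar>x\<bar> / pi"
  have t: "0 \<le> t" "t \<le> 1" using assms by (auto simp: t_def)
  have "concave_on {0..pi / 2} sin"
    by (rule f''_le0_imp_concave[where f' = cos and f'' = "\<lambda>x. - sin x"])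
       (auto intro!: derivative_eq_intros sin_ge_zero)
  then have "(1 - t) * sin 0 + t * sin (pi / 2) \<le> sin ((1 - t) *\<^sub>R 0 + t *\<^sub>R (pi / 2))"
    using t by (intro concave_onD) auto
  then have "t \<le> sin (\<bar>x\<bar> / 2)" by (simp add: t_def)
  then have "t\<^sup>2 \<le> (sin (\<bar>x\<bar> / 2))\<^sup>2" using t by (intro power_mono) auto
  moreover have "cos x = 1 - 2 * (sin (\<bar>x\<bar> / 2))\<^sup>2"
    using cos_double_sin[of "\<bar>x\<bar> / 2"] by simp
  ultimately show ?thesis by (simp add: t_def power_divide)
qed

lemma exp_neg_bounds:
  fixes a :: real
  assumes "0 \<le> a"
  shows "1 - exp (- a) \<le> a" "a - a\<^sup>2 / 2 \<le> 1 - exp (- a)"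
proof -
  show "1 - exp (- a) \<le> a" using exp_ge_add_one_self[of "- a"] by linarith
  have "exp (- a) \<le> 1 - a + a\<^sup>2 / 2"
  proof -
    let ?f = "\<lambda>a::real. 1 - a + a\<^sup>2 / 2 - exp (- a)"
    have "?f 0 \<le> ?f a"
    proof (rule DERIV_nonneg_imp_nondecreasing[OF assms])
      fix x :: real
      have "(?f has_real_derivative (- 1 + x + exp (- x))) (at x)"
        by (auto intro!: derivative_eq_intros)
      moreover have "- 1 + x + exp (- x) \<ge> 0" using exp_ge_add_one_self[of "- x"] by linarith
      ultimately show "\<exists>d. (?f has_real_derivative d) (at x) \<and> 0 \<le> d" by blast
    qed
    then show ?thesis by simp
  qed
  then show "a - a\<^sup>2 / 2 \<le> 1 - exp (- a)" by linarith
qed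

lemma Re_inverse_one_minus:
  fixes q :: complex
  assumes "q \<noteq> 1"
  shows "Re (1 / (1 - q)) = 1 / 2 + (1 - (norm q)\<^sup>2) / (2 * (norm (1 - q))\<^sup>2)"
proof -
  have alg: "(1 - c) / N = 1 / 2 + (1 - Q) / (2 * N)" if "N > 0" "N = 1 - 2 * c + Q" for c N Q :: real
  proof -
    have c: "c = (1 + Q - N) / 2" using that(2) by simp
    show ?thesis unfolding c using that(1) by (simp add: field_simps)
  qed
  have "(norm (1 - q))\<^sup>2 > 0" using assms by simp
  moreover have "Re (1 / (1 - q)) = (1 - Re q) / (norm (1 - q))\<^sup>2"
    by (simp add: Re_divide cmod_power2)
  moreover have "(norm (1 - q))\<^sup>2 = 1 - 2 * Re q + (norm q)\<^sup>2"
    unfolding cmod_power2 by (simp add: power2_eq_square algebra_simps)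
  ultimately show ?thesis using alg by metis
qed

text \<open>The minor arc: away from the positive real axis \<open>1 / (1 - q)\<close> stays bounded.\<close>

lemma Re_inverse_one_minus_exp_le:
  fixes t :: complex
  assumes a: "0 < Re t" "Re t \<le> 1 / 10" and i: "\<bar>Im t\<bar> \<le> pi" and minor: "Re (1 / t) \<le> 1 / 2"
  shows "Re (1 / (1 - exp (- t))) \<le> 2"
proof -
  let ?a = "Re t" and ?b = "Im t"
  let ?r = "exp (- ?a)"
  have r1: "9 / 10 \<le> ?r" "?r < 1" using exp_neg_bounds(1)[of ?a] a by auto
  have "?a\<^sup>2 \<le> ?a * (1 / 10)" unfolding power2_eq_square using a by (intro mult_left_mono) auto
  then have "19 / 20 * ?a \<le> 1 - ?r" using exp_neg_bounds(2)[of ?a] a by linarith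
  then have "(19 / 20 * ?a)\<^sup>2 \<le> (1 - ?r)\<^sup>2" using a by (intro power_mono) auto
  moreover have "(19 / 20 * ?a)\<^sup>2 = 361 / 400 * ?a\<^sup>2" by (simp add: power_mult_distrib power_divide)
  ultimately have r2: "9 / 10 * ?a\<^sup>2 \<le> (1 - ?r)\<^sup>2"
    using zero_le_power2[of ?a] by linarith
  have pi2: "pi\<^sup>2 \<le> 10"
  proof -
    have "pi \<le> 315 / 100" using pi_approx by simp
    then have "pi\<^sup>2 \<le> (315 / 100)\<^sup>2" by (intro power_mono) auto
    then show ?thesis by (simp add: power2_eq_square)
  qed
  have "2 * ?b\<^sup>2 / 10 \<le> 2 * ?b\<^sup>2 / pi\<^sup>2" using pi2 by (intro divide_left_mono) auto
  also have "\<dots> \<le> 1 - cos ?b" by (rule one_minus_cos_ge[OF i])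
  finally have c: "?b\<^sup>2 / 5 \<le> 1 - cos ?b" by simp
  have n: "(norm (1 - exp (- t)))\<^sup>2 = (1 - ?r)\<^sup>2 + 2 * ?r * (1 - cos ?b)"
  proof -
    have alg: "(1 - r * c)\<^sup>2 + (r * s)\<^sup>2 = 1 - 2 * r * c + r\<^sup>2 * (c\<^sup>2 + s\<^sup>2)" for r c s :: real
      by (simp add: power2_eq_square algebra_simps)
    have "(norm (1 - exp (- t)))\<^sup>2 = (1 - ?r * cos ?b)\<^sup>2 + (?r * sin ?b)\<^sup>2"
      by (simp add: cmod_power2 Re_exp Im_exp)
    also have "\<dots> = 1 - 2 * ?r * cos ?b + ?r\<^sup>2 * ((cos ?b)\<^sup>2 + (sin ?b)\<^sup>2)"
      by (rule alg)
    also have "\<dots> = 1 - 2 * ?r * cos ?b + ?r\<^sup>2" by simp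
    finally show ?thesis by (simp add: power2_eq_square algebra_simps)
  qed
  have "2 * ?r * (1 - cos ?b) \<ge> 2 * (9 / 10) * (?b\<^sup>2 / 5)"
    using r1 c by (intro mult_mono) auto
  then have n2: "(norm (1 - exp (- t)))\<^sup>2 \<ge> 9 / 25 * (?a\<^sup>2 + ?b\<^sup>2)" (is "?goal")
  proof -
    assume "2 * (9 / 10) * (?b\<^sup>2 / 5) \<le> 2 * ?r * (1 - cos ?b)"
    then have Y: "9 / 25 * ?b\<^sup>2 \<le> 2 * ?r * (1 - cos ?b)" by simp
    have "9 / 25 * ?a\<^sup>2 \<le> 9 / 10 * ?a\<^sup>2" by simp
    then have "9 / 25 * ?a\<^sup>2 + 9 / 25 * ?b\<^sup>2 \<le> (1 - ?r)\<^sup>2 + 2 * ?r * (1 - cos ?b)"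
      using r2 Y by (intro add_mono) (rule order_trans)
    then show ?goal unfolding n distrib_left .
  qed
  have s: "?a\<^sup>2 + ?b\<^sup>2 > 0" using a by (simp add: add_pos_nonneg)
  have "1 - (norm (exp (- t)))\<^sup>2 = 1 - exp (- (2 * ?a))" by (simp add: power2_eq_square mult_exp_exp)
  also have "\<dots> \<le> 2 * ?a" using exp_neg_bounds(1)[of "2 * ?a"] a by simp
  finally have num: "1 - (norm (exp (- t)))\<^sup>2 \<le> 2 * ?a" .
  have "Re (1 / t) = ?a / (?a\<^sup>2 + ?b\<^sup>2)" by (simp add: Re_divide)
  then have ab: "?a \<le> (?a\<^sup>2 + ?b\<^sup>2) / 2" using minor s by (simp add: field_simps)
  have ne: "exp (- t) \<noteq> 1" using n2 s by auto
  have np: "(norm (1 - exp (- t)))\<^sup>2 > 0" using ne by simp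
  \<comment> \<open>The condition Re (1 / t) \<le> 1 / 2 means a \<le> (a^2 + b^2) / 2. So the
    numerator is at most 2 a \<le> a^2 + b^2, which is at most 25 / 9, hence at most 3 times the
    square of norm (1 - q).\<close>
  have "(1 - (norm (exp (- t)))\<^sup>2) \<le> 3 / 2 * (2 * (norm (1 - exp (- t)))\<^sup>2)"
  proof -
    define S where "S = ?a\<^sup>2 + ?b\<^sup>2"
    have "?a \<le> S / 2" "9 / 25 * S \<le> (norm (1 - exp (- t)))\<^sup>2" "0 < S"
      using ab n2 s by (simp_all only: S_def)
    then show ?thesis using num by linarith
  qed
  then have "(1 - (norm (exp (- t)))\<^sup>2) / (2 * (norm (1 - exp (- t)))\<^sup>2) \<le> 3 / 2"
    using np by (simp add: field_simps)
  then have "1 / 2 + (1 - (norm (exp (- t)))\<^sup>2) / (2 * (norm (1 - exp (- t)))\<^sup>2) \<le> 1 / 2 + 3 / 2"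
    by (rule add_left_mono)
  also have "1 / 2 + 3 / 2 = (2::real)" by simp
  finally show ?thesis unfolding Re_inverse_one_minus[OF ne] .
qed

definition diamond_main :: "nat \<Rightarrow> complex \<Rightarrow> complex" where
  "diamond_main m t = t / (2 * of_real pi) * exp (of_real (diamond_growth m) / t - of_real ((real m + 1) / 24) * t)"

lemma norm_diamond_main:
  "norm (diamond_main m t) = norm t / (2 * pi) * exp (diamond_growth m * Re (1 / t) - (real m + 1) / 24 * Re t)"
proof -
  have "Re (of_real (diamond_growth m) / t) = diamond_growth m * Re (1 / t)"
    by (simp add: Re_divide)
  then show ?thesis unfolding diamond_main_def by (simp add: norm_mult norm_divide)
qed

lemma pi_squared_bounds: "986 / 100 \<le> pi\<^sup>2" "pi\<^sup>2 \<le> 987 / 100"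
proof -
  have p: "31415 / 10000 \<le> pi" "pi \<le> 31416 / 10000" using pi_approx by auto
  have "(31415 / 10000)\<^sup>2 \<le> pi\<^sup>2" "pi\<^sup>2 \<le> (31416 / 10000)\<^sup>2" using p by (auto intro!: power_mono)
  then show "986 / 100 \<le> pi\<^sup>2" "pi\<^sup>2 \<le> 987 / 100" by (auto simp: power2_eq_square)
qed

text \<open>The values are 7 pi^2 / 18 for m = 3 and 2 pi^2 / 5 for m = 5; in the second case the
  third bound is an equality.\<close>

lemma diamond_growth_bounds:
  assumes "m \<in> {3, 5}"
  shows "383 / 100 \<le> diamond_growth m" "diamond_growth m \<le> 395 / 100" "diamond_growth m \<le> 2 * pi\<^sup>2 / real m"
  using assms pi_squared_bounds by (auto simp: diamond_growth_def)

lemma Re_dual_exponent: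
  "Re (2 * of_real pi ^ 2 / (of_nat m * t)) = 2 * pi\<^sup>2 / real m * Re (1 / t)"
proof -
  have "2 * of_real pi ^ 2 / (of_nat m * t) = of_real (2 * pi\<^sup>2 / real m) * (1 / t)"
    by (simp add: field_simps)
  moreover have "Re (of_real x * w) = x * Re w" for x w by simp
  ultimately show ?thesis by metis
qed

text \<open>The region Re (1 / t) \<ge> 1 / 2 is the disc of centre 1 and radius 1. There norm v
  \<le> exp (- pi^2 / m) \<le> 1 / 7, just enough for \<open>diamond_dual_near_one\<close>, and the
  decay of v absorbs exp (A Re (1 / t)).\<close>

lemma diamond_major_arc:
  fixes t :: complex
  assumes m: "m \<in> {3, 5}" and t: "0 < Re t" "norm t \<le> 4" and R: "1 / 2 \<le> Re (1 / t)"
  shows "norm (diamond_fun m (exp (- t)) - diamond_main m t) \<le> 80"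
proof -
  let ?v = "exp (- (2 * of_real pi ^ 2 / (of_nat m * t)))"
  let ?A = "diamond_growth m"
  have mp: "m > 0" using m by auto
  have nv: "norm ?v = exp (- (2 * pi\<^sup>2 / real m * Re (1 / t)))"
    unfolding norm_exp_eq_Re uminus_complex.simps Re_dual_exponent ..
  have "2 * pi\<^sup>2 / real m * Re (1 / t) \<ge> 2 * pi\<^sup>2 / real m * (1 / 2)" using R by (intro mult_left_mono) auto
  moreover have "2 * pi\<^sup>2 / real m * (1 / 2) \<ge> 1972 / 1000" using m pi_squared_bounds by auto
  ultimately have "2 * pi\<^sup>2 / real m * Re (1 / t) \<ge> 1972 / 1000" by linarith
  then have "norm ?v \<le> exp (- (1972 / 1000))" unfolding nv exp_le_cancel_iff by linarith
  also have "exp (- (1972 / 1000)) \<le> (1 / 7 :: real)"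
  proof -
    \<comment> \<open>exp 1.972 is about 7.18, so the margin is narrow and a power as high as 90 is
      taken in the bound (1 + y / 90)^90 \<le> exp y.\<close>
    have "7 \<le> (1 + (1972 / 1000) / 90 :: real) ^ 90" by (simp add: power_divide)
    also have "\<dots> \<le> exp ((1972 / 1000) / 90) ^ 90" by (intro power_mono exp_ge_add_one_self) auto
    also have "\<dots> = exp ((1972 / 1000) :: real)" by (simp add: exp_of_nat_mult[symmetric])
    finally show ?thesis by (simp add: exp_minus field_simps)
  qed
  finally have v7: "norm ?v \<le> 1 / 7" .
  have "diamond_fun m (exp (- t)) = diamond_main m t * diamond_dual m ?v"
    unfolding diamond_main_def by (rule diamond_fun_inversion[OF t(1) mp])
  then have eq: "diamond_fun m (exp (- t)) - diamond_main m t = diamond_main m t * (diamond_dual m ?v - 1)"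
    by (simp add: algebra_simps)
  have "norm (diamond_main m t) \<le> 1 * exp (?A * Re (1 / t))"
    unfolding norm_diamond_main
  proof (rule mult_mono)
    show "norm t / (2 * pi) \<le> 1" using t pi_approx by (simp add: divide_simps)
    show "exp (?A * Re (1 / t) - (real m + 1) / 24 * Re t) \<le> exp (?A * Re (1 / t))" using t by simp
  qed auto
  moreover have "norm (diamond_dual m ?v - 1) \<le> 80 * norm ?v" by (rule diamond_dual_near_one[OF v7 mp])
  ultimately have "norm (diamond_main m t * (diamond_dual m ?v - 1)) \<le> (1 * exp (?A * Re (1 / t))) * (80 * norm ?v)"
    unfolding norm_mult by (intro mult_mono) auto
  also have "\<dots> = 80 * exp ((?A - 2 * pi\<^sup>2 / real m) * Re (1 / t))"
    unfolding nv by (simp add: mult_exp_exp algebra_simps)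
  also have "\<dots> \<le> 80 * exp 0"
    using diamond_growth_bounds(3)[OF m] R by (intro mult_left_mono exp_le_cancel_iff[THEN iffD2] mult_nonpos_nonneg) auto
  finally show ?thesis unfolding eq by simp
qed

text \<open>At real a \<le> 1 / 10 the dual factor has norm at most 3, and t / (2 pi) contributes at
  most a / 6.\<close>

lemma diamond_fun_real_le:
  fixes a :: real
  assumes m: "m \<in> {3, 5}" and a: "0 < a" "a \<le> 1 / 10"
  shows "diamond_fun m (exp (- a)) \<le> a / 2 * exp (diamond_growth m / a)"
proof -
  let ?t = "complex_of_real a"
  let ?v = "exp (- (2 * of_real pi ^ 2 / (of_nat m * ?t)))"
  have mp: "m > 0" using m by auto
  have nv: "norm ?v = exp (- (2 * pi\<^sup>2 / real m * (1 / a)))"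
    unfolding norm_exp_eq_Re uminus_complex.simps Re_dual_exponent by (simp add: Re_divide power2_eq_square)
  have "2 * pi\<^sup>2 / real m * (1 / a) \<ge> 39 / 10 * 10"
    using m pi_squared_bounds a by (intro mult_mono) (auto simp: field_simps)
  then have "norm ?v \<le> exp (- 39)" unfolding nv exp_le_cancel_iff by linarith
  also have "exp (- 39) \<le> (1 / 40 :: real)"
    using exp_ge_add_one_self[of "39::real"] by (simp add: exp_minus field_simps)
  finally have v: "norm ?v \<le> 1 / 40" .
  have "norm (diamond_dual m ?v - 1) \<le> 80 * norm ?v" using v by (intro diamond_dual_near_one mp) auto
  then have d: "norm (diamond_dual m ?v) \<le> 3" using v norm_triangle_sub[of "diamond_dual m ?v" 1] by simp
  have "diamond_fun m (exp (- ?t)) = of_real (diamond_fun m (exp (- a)))"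
    using diamond_of_real(1)[of "exp (- a)" m] a mp by (simp add: exp_of_real[symmetric])
  then have "diamond_fun m (exp (- a)) \<le> norm (diamond_fun m (exp (- ?t)))" by simp
  also have "\<dots> = norm (diamond_main m ?t) * norm (diamond_dual m ?v)"
    unfolding norm_mult[symmetric] diamond_main_def
    by (rule arg_cong[where f = norm], rule diamond_fun_inversion) (use a mp in auto)
  also have "\<dots> \<le> (a / 6 * exp (diamond_growth m / a)) * 3"
  proof (rule mult_mono[OF _ d])
    have "a / (2 * pi) \<le> a / 6" using a pi_approx by (intro divide_left_mono) auto
    moreover have "exp (diamond_growth m * Re (1 / ?t) - (real m + 1) / 24 * Re ?t) \<le> exp (diamond_growth m / a)"
      using a by (simp add: Re_divide power2_eq_square)
    ultimately show "norm (diamond_main m ?t) \<le> a / 6 * exp (diamond_growth m / a)"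
      unfolding norm_diamond_main using a by (intro mult_mono) auto
  qed (use a in auto)
  finally show ?thesis by simp
qed

text \<open>Compared with the real point exp (- a), the two inverse Euler products save exp (2 (2 -
  1 / a)), because 1 / (1 - exp (- a)) \<ge> 1 / a and Re (1 / (1 - q)) \<le> 2. The exponent A / a
  drops to (A - 2) / a, and 28 bounds exp 4 / 2. The main term itself is at most exp (A / 2) \<le> 8
  here.\<close>

lemma diamond_minor_arc:
  fixes t :: complex
  assumes m: "m \<in> {3, 5}" and t: "0 < Re t" "Re t \<le> 1 / 10" "\<bar>Im t\<bar> \<le> pi" "norm t \<le> 4" and R: "Re (1 / t) \<le> 1 / 2"
  shows "norm (diamond_fun m (exp (- t)) - diamond_main m t) \<le> 8 + 28 * Re t * exp ((diamond_growth m - 2) / Re t)"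
proof -
  let ?a = "Re t" and ?A = "diamond_growth m"
  have mp: "m > 0" using m by auto
  have "norm (diamond_main m t) \<le> 1 * exp (?A * (1 / 2))"
    unfolding norm_diamond_main
  proof (rule mult_mono)
    show "norm t / (2 * pi) \<le> 1" using t pi_approx by (simp add: divide_simps)
    have "?A * Re (1 / t) \<le> ?A * (1 / 2)" using R diamond_growth_bounds[OF m] by (intro mult_left_mono) auto
    moreover have "(real m + 1) / 24 * Re t \<ge> 0" using t by simp
    ultimately show "exp (?A * Re (1 / t) - (real m + 1) / 24 * Re t) \<le> exp (?A * (1 / 2))"
      unfolding exp_le_cancel_iff by linarith
  qed auto
  also have "exp (?A * (1 / 2)) \<le> exp (2::real)" using diamond_growth_bounds[OF m] by simp
  also have "exp (2::real) = exp 1 ^ 2" by (simp add: exp_of_nat_mult[symmetric])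
  also have "\<dots> \<le> (272 / 100)\<^sup>2" using e_less_272 by (intro power_mono) auto
  finally have main: "norm (diamond_main m t) \<le> 8" by (simp add: power2_eq_square)
  have "norm (diamond_fun m (exp (- t))) \<le> diamond_fun m (norm (exp (- t))) *
       exp (- 2 * (1 / (1 - norm (exp (- t))) - Re (1 / (1 - exp (- t)))))"
    using t by (intro diamond_fun_norm_le mp) simp
  also have "\<dots> \<le> (?a / 2 * exp (?A / ?a)) * exp (4 - 2 / ?a)"
  proof (rule mult_mono)
    show "diamond_fun m (norm (exp (- t))) \<le> ?a / 2 * exp (?A / ?a)"
      using diamond_fun_real_le[OF m t(1,2)] by simp
    have "1 / ?a \<le> 1 / (1 - exp (- ?a))"
      using t exp_neg_bounds(1)[of ?a] by (intro divide_left_mono) auto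
    then show "exp (- 2 * (1 / (1 - norm (exp (- t))) - Re (1 / (1 - exp (- t))))) \<le> exp (4 - 2 / ?a)"
      using Re_inverse_one_minus_exp_le[OF t(1-3) R] by simp
  qed (use t in auto)
  also have "\<dots> = ?a / 2 * exp 4 * exp ((?A - 2) / ?a)"
    by (simp add: mult_exp_exp diff_divide_distrib algebra_simps)
  also have "\<dots> \<le> ?a / 2 * 56 * exp ((?A - 2) / ?a)"
  proof (intro mult_right_mono mult_left_mono)
    have "exp (4::real) = exp 1 ^ 4" by (simp add: exp_of_nat_mult[symmetric])
    also have "\<dots> \<le> (272 / 100) ^ 4" using e_less_272 by (intro power_mono) auto
    finally show "exp (4::real) \<le> 56" by (simp add: power_divide)
  qed (use t in auto)
  finally have "norm (diamond_fun m (exp (- t))) \<le> 28 * ?a * exp ((?A - 2) / ?a)" by simp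
  with main show ?thesis using norm_triangle_ineq4[of "diamond_fun m (exp (- t))" "diamond_main m t"] by linarith
qed

lemma diamond_line_bound:
  fixes t :: complex
  assumes m: "m \<in> {3, 5}" and t: "0 < Re t" "Re t \<le> 1 / 10" "\<bar>Im t\<bar> \<le> pi"
  shows "norm (diamond_fun m (exp (- t)) - diamond_main m t) \<le> 88 + 28 * Re t * exp ((diamond_growth m - 2) / Re t)"
proof -
  have "norm t \<le> \<bar>Re t\<bar> + \<bar>Im t\<bar>" by (rule cmod_le)
  also have "\<dots> \<le> 4" using t pi_approx by simp
  finally have n: "norm t \<le> 4" .
  have "28 * Re t * exp ((diamond_growth m - 2) / Re t) \<ge> 0" using t by simp
  then show ?thesis
    using diamond_major_arc[OF m t(1) n] diamond_minor_arc[OF m t n] by linarith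
qed

text \<open>The segment is closed to a rectangle around 0, whose integral of the main term is
  \<open>bessel_main\<close>. The three added sides cost at most 3 exp (n a) after division by 2 pi,
  which turns 88 into 91. The abscissa \<open>a\<close> stays free so that it can be balanced
  against n.\<close>

theorem broken_diamond_main_term:
  fixes a :: real
  assumes m: "m = 2 * k + 1" "m \<in> {3, 5}" and a: "0 < a" "a \<le> 1 / 10" and n: "n \<ge> 1"
  shows "\<bar>\<Delta> k n - bessel_main (diamond_growth m) (real n - (real m + 1) / 24)\<bar> \<le>
    exp (real n * a) * (91 + 28 * a * exp ((diamond_growth m - 2) / a))"
proof -
  let ?A = "diamond_growth m" and ?x = "real n - (real m + 1) / 24"
  define g where "g = (\<lambda>t::complex. t / (2 * of_real pi) * exp (of_real ?A / t + of_real ?x * t))"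
  define K where "K = 88 + 28 * a * exp ((?A - 2) / a)"
  define a1 a2 a3 a4 where "a1 = Complex (-1) (- pi)" and "a2 = Complex a (- pi)" and "a3 = Complex a pi" and "a4 = Complex (-1) pi"
  have K: "K \<ge> 0" using a by (simp add: K_def)
  have x: "0 \<le> ?x" "?x \<le> real n" using m(2) n by auto
  have g_eq: "g t = diamond_main m t * exp (of_nat n * t)" for t
  proof -
    have "of_real ?A / t + of_real ?x * t = (of_real ?A / t - of_real ((real m + 1) / 24) * t) + of_nat n * t"
      by (simp add: algebra_simps)
    then show ?thesis unfolding g_def diamond_main_def by (simp only: exp_add mult.assoc)
  qed
  have holo: "g holomorphic_on - {0}" unfolding g_def by (auto intro!: holomorphic_intros)
  have seg: "Re t = a" "\<bar>Im t\<bar> \<le> pi" if "t \<in> closed_segment a2 a3" for t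
    using that by (auto simp: a2_def a3_def closed_segment_same_Re closed_segment_eq_real_ivl)
  have seg1: "Im t = - pi" "-1 \<le> Re t" "Re t \<le> a" if "t \<in> closed_segment a1 a2" for t
    using that a by (auto simp: a1_def a2_def closed_segment_same_Im closed_segment_eq_real_ivl)
  have seg3: "Im t = pi" "-1 \<le> Re t" "Re t \<le> a" if "t \<in> closed_segment a3 a4" for t
    using that a by (auto simp: a3_def a4_def closed_segment_same_Im closed_segment_eq_real_ivl split: if_splits)
  have seg4: "Re t = -1" "\<bar>Im t\<bar> \<le> pi" if "t \<in> closed_segment a4 a1" for t
    using that by (auto simp: a4_def a1_def closed_segment_same_Re closed_segment_eq_real_ivl split: if_splits)
  have intg: "g contour_integrable_on linepath u v" if "0 \<notin> closed_segment u v" for u v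
    using that by (intro contour_integrable_continuous_linepath holomorphic_on_imp_continuous_on holomorphic_on_subset[OF holo]) auto
  have z: "0 \<notin> closed_segment a1 a2" "0 \<notin> closed_segment a2 a3" "0 \<notin> closed_segment a3 a4" "0 \<notin> closed_segment a4 a1"
    using seg(1)[of 0] seg1(1)[of 0] seg3(1)[of 0] seg4(1)[of 0] a by auto
  note ints = z[THEN intg]
  have "contour_integral (rectpath a1 a3) g =
      contour_integral (linepath a1 a2) g + contour_integral (linepath a2 a3) g +
      contour_integral (linepath a3 a4) g + contour_integral (linepath a4 a1) g"
  proof -
    have "Complex (Re a3) (Im a1) = a2" "Complex (Re a1) (Im a3) = a4"
      by (auto simp: a1_def a2_def a3_def a4_def)
    then have r: "rectpath a1 a3 = linepath a1 a2 +++ linepath a2 a3 +++ linepath a3 a4 +++ linepath a4 a1"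
      by (simp add: rectpath_def Let_def)
    show ?thesis unfolding r using ints by (simp add: contour_integrable_joinI add.assoc)
  qed
  then have rect: "2 * of_real pi * \<i> * of_real (bessel_main ?A ?x) =
      contour_integral (linepath a1 a2) g + contour_integral (linepath a2 a3) g +
      contour_integral (linepath a3 a4) g + contour_integral (linepath a4 a1) g"
    using bessel_main_rect_integral[OF a(1), of ?A ?x] unfolding g_def a1_def a3_def by simp
  have D: "((\<lambda>t. diamond_fun m (exp (- t)) * exp (of_nat n * t)) has_contour_integral 2 * of_real pi * \<i> * of_real (\<Delta> k n)) (linepath a2 a3)"
    using broken_diamond_contour_integral[OF a(1), of k n] unfolding m(1) a2_def a3_def .
  have "((\<lambda>t. diamond_fun m (exp (- t)) * exp (of_nat n * t) - g t) has_contour_integral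
     2 * of_real pi * \<i> * of_real (\<Delta> k n) - contour_integral (linepath a2 a3) g) (linepath a2 a3)"
    by (intro has_contour_integral_diff D has_contour_integral_integral ints)
  then have b2: "norm (2 * of_real pi * \<i> * of_real (\<Delta> k n) - contour_integral (linepath a2 a3) g) \<le> (K * exp (real n * a)) * norm (a3 - a2)"
  proof (rule has_contour_integral_bound_linepath)
    fix t assume t: "t \<in> closed_segment a2 a3"
    have "diamond_fun m (exp (- t)) * exp (of_nat n * t) - g t = (diamond_fun m (exp (- t)) - diamond_main m t) * exp (of_nat n * t)"
      unfolding g_eq by (simp add: algebra_simps)
    moreover have "norm (diamond_fun m (exp (- t)) - diamond_main m t) \<le> K"
      using diamond_line_bound[OF m(2), of t] seg[OF t] a by (simp add: K_def)
    moreover have "norm (exp (of_nat n * t)) = exp (real n * a)" using seg(1)[OF t] by simp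
    ultimately show "norm (diamond_fun m (exp (- t)) * exp (of_nat n * t) - g t) \<le> K * exp (real n * a)"
      by (simp only: norm_mult mult_right_mono exp_ge_zero)
  qed (use K in auto)
  \<comment> \<open>On the three added sides Re (1 / t) \<le> a / 9 \<le> 1 / 90, so the singular
    factor exp (A / t) is bounded by a constant.\<close>
  have gb: "norm (g t) \<le> 2 * exp (real n * a)" if t: "-1 \<le> Re t" "Re t \<le> a" "norm t \<le> 5" "Re (1 / t) \<le> a / 9" for t
  proof -
    have "Re (of_real ?A / t) = ?A * Re (1 / t)" by (simp add: Re_divide)
    then have "norm (g t) = norm t / (2 * pi) * exp (?A * Re (1 / t) + ?x * Re t)"
      unfolding g_def by (simp add: norm_mult norm_divide)
    also have "\<dots> \<le> 1 * exp (1 / 20 + real n * a)"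
    proof (rule mult_mono)
      show "norm t / (2 * pi) \<le> 1" using t(3) pi_approx by (simp add: divide_simps)
      have "?A * Re (1 / t) \<le> ?A * (1 / 90)" using t(4) a diamond_growth_bounds[OF m(2)] by (intro mult_left_mono) auto
      moreover have "?A * (1 / 90) \<le> 1 / 20" using diamond_growth_bounds[OF m(2)] by simp
      moreover have "?x * Re t \<le> ?x * a" using t(2) x by (intro mult_left_mono) auto
      moreover have "?x * a \<le> real n * a" using x a by (intro mult_right_mono) auto
      ultimately show "exp (?A * Re (1 / t) + ?x * Re t) \<le> exp (1 / 20 + real n * a)"
        unfolding exp_le_cancel_iff by linarith
    qed auto
    also have "\<dots> \<le> 2 * exp (real n * a)"
    proof -
      have "exp (1 / 20) \<le> 1 + 1 / 20 + (1 / 20 :: real)\<^sup>2" by (rule exp_bound) auto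
      then have "exp (1 / 20 :: real) \<le> 2" by (simp add: power2_eq_square)
      then show ?thesis unfolding exp_add by simp
    qed
    finally show ?thesis .
  qed
  have cm: "norm t \<le> 5" if "-1 \<le> Re t" "Re t \<le> a" "\<bar>Im t\<bar> \<le> pi" for t
    using cmod_le[of t] that a pi_less_4 by linarith
  have hb: "Re (1 / t) \<le> a / 9" if "Re t \<le> a" "\<bar>Im t\<bar> = pi" for t
  proof -
    have i: "(Im t)\<^sup>2 \<ge> 9" using that(2) pi_squared_bounds(1) power2_abs[of "Im t"] by simp
    have "Re (1 / t) = Re t / ((Re t)\<^sup>2 + (Im t)\<^sup>2)" by (simp add: Re_divide)
    also have "\<dots> \<le> a / 9"
    proof (cases "Re t \<le> 0")
      case True
      then have "Re t / ((Re t)\<^sup>2 + (Im t)\<^sup>2) \<le> 0" by (intro divide_nonpos_nonneg) auto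
      then show ?thesis using a by (smt (verit) divide_nonneg_nonneg)
    next
      case False
      have "9 \<le> (Re t)\<^sup>2 + (Im t)\<^sup>2" using i zero_le_power2[of "Re t"] by linarith
      with False show ?thesis using that by (intro frac_le) auto
    qed
    finally show ?thesis .
  qed
  have b1: "norm (contour_integral (linepath a1 a2) g) \<le> (2 * exp (real n * a)) * norm (a2 - a1)"
    by (rule has_contour_integral_bound_linepath[OF has_contour_integral_integral[OF ints(1)]])
       (auto intro!: gb cm hb dest: seg1)
  have b3: "norm (contour_integral (linepath a3 a4) g) \<le> (2 * exp (real n * a)) * norm (a4 - a3)"
    by (rule has_contour_integral_bound_linepath[OF has_contour_integral_integral[OF ints(3)]])
       (auto intro!: gb cm hb dest: seg3)
  have b4: "norm (contour_integral (linepath a4 a1) g) \<le> (2 * exp (real n * a)) * norm (a1 - a4)"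
  proof (rule has_contour_integral_bound_linepath[OF has_contour_integral_integral[OF ints(4)]])
    fix t assume t: "t \<in> closed_segment a4 a1"
    have "Re (1 / t) \<le> 0" using seg4(1)[OF t] by (simp add: Re_divide divide_nonpos_nonneg)
    then have "Re (1 / t) \<le> a / 9" using a by (smt (verit) divide_nonneg_nonneg)
    then show "norm (g t) \<le> 2 * exp (real n * a)" using seg4[OF t] a by (intro gb cm) auto
  qed simp
  have l: "norm (a2 - a1) \<le> 11 / 10" "norm (a4 - a3) \<le> 11 / 10" "norm (a1 - a4) = 2 * pi" "norm (a3 - a2) = 2 * pi"
  proof -
    have "a2 - a1 = of_real (a + 1)" "a4 - a3 = - of_real (a + 1)" "a1 - a4 = \<i> * of_real (- (2 * pi))" "a3 - a2 = \<i> * of_real (2 * pi)"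
      by (auto simp: a1_def a2_def a3_def a4_def complex_eq_iff)
    then show "norm (a2 - a1) \<le> 11 / 10" "norm (a4 - a3) \<le> 11 / 10" "norm (a1 - a4) = 2 * pi" "norm (a3 - a2) = 2 * pi"
      using a by (simp_all add: norm_mult del: of_real_minus of_real_add of_real_mult)
  qed
  let ?e = "exp (real n * a)"
  have "2 * pi * \<bar>\<Delta> k n - bessel_main ?A ?x\<bar> = norm (2 * complex_of_real pi * \<i> * of_real (\<Delta> k n) - 2 * of_real pi * \<i> * of_real (bessel_main ?A ?x))"
  proof -
    have "2 * complex_of_real pi * \<i> * of_real (\<Delta> k n) - 2 * of_real pi * \<i> * of_real (bessel_main ?A ?x)
       = (2 * of_real pi * \<i>) * of_real (\<Delta> k n - bessel_main ?A ?x)" by (simp add: algebra_simps)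
    then show ?thesis by (simp only: norm_mult norm_of_real) simp
  qed
  also have "\<dots> \<le> norm (2 * of_real pi * \<i> * of_real (\<Delta> k n) - contour_integral (linepath a2 a3) g) +
     norm (contour_integral (linepath a1 a2) g) + norm (contour_integral (linepath a3 a4) g) + norm (contour_integral (linepath a4 a1) g)"
  proof -
    have "norm ((u - y) - x - z - w) \<le> norm (u - y) + norm x + norm z + norm w" for u x y z w :: complex
      by (smt (verit) norm_triangle_ineq4)
    moreover have "u - (x + y + z + w) = (u - y) - x - z - w" for u x y z w :: complex by simp
    ultimately show ?thesis unfolding rect by metis
  qed
  also have "\<dots> \<le> (K * ?e) * (2 * pi) + (2 * ?e) * (11 / 10) + (2 * ?e) * (11 / 10) + (2 * ?e) * (2 * pi)"
  proof (intro add_mono)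
    show "norm (contour_integral (linepath a1 a2) g) \<le> (2 * ?e) * (11 / 10)"
      by (rule order_trans[OF b1]) (intro mult_left_mono l, simp)
    show "norm (contour_integral (linepath a3 a4) g) \<le> (2 * ?e) * (11 / 10)"
      by (rule order_trans[OF b3]) (intro mult_left_mono l, simp)
  qed (use b2 b4 in \<open>simp_all only: l\<close>)
  also have "\<dots> \<le> 2 * pi * (?e * (K + 3))"
  proof -
    \<comment> \<open>The horizontal sides cost 4.4 exp (n a), less than one unit 2 pi exp (n a);
      the left side costs two such units.\<close>
    have "(2 * ?e) * (11 / 10) + (2 * ?e) * (11 / 10) \<le> ?e * (2 * pi)" using pi_approx by simp
    then show ?thesis by (simp add: algebra_simps)
  qed
  finally have "\<bar>\<Delta> k n - bessel_main ?A ?x\<bar> \<le> ?e * (K + 3)" by simp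
  then show ?thesis by (simp add: K_def add.commute add.left_commute)
qed

section \<open>The inequality for large arguments\<close>

lemma log_bessel_second_derivative:
  fixes A x :: real
  assumes A: "A > 0" and x: "x > 0" and w: "w = 1 / (2 * sqrt (A * x))" "w \<le> 1 / 10"
  defines "u \<equiv> \<lambda>y. A * (bessel_series 3 (A * y) / bessel_series 2 (A * y))"
  shows "((\<lambda>y. ln (bessel_main A y)) has_real_derivative u x) (at x)"
    and "\<exists>D. (u has_real_derivative D) (at x) \<and>
           4 * A\<^sup>2 * (w ^ 3 - 5 * w ^ 4) \<le> - D \<and> - D \<le> 4 * A\<^sup>2 * (w ^ 3 - 5 * w ^ 4 + 13 * w ^ 5)"
proof -
  have Ax: "((\<lambda>y. A * y) has_real_derivative A) (at x)" by (auto intro!: derivative_eq_intros)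
  define b2 b3 b4 where "b2 = bessel_series 2 (A * x)" and "b3 = bessel_series 3 (A * x)" and "b4 = bessel_series 4 (A * x)"
  have b2: "b2 > 0" unfolding b2_def using A x by (intro bessel_series_pos) simp
  have d2: "((\<lambda>y. bessel_series 2 (A * y)) has_real_derivative b3 * A) (at x)"
    using bessel_series_DERIV[OF Ax, of 2] by (simp add: b3_def eval_nat_numeral)
  have d3: "((\<lambda>y. bessel_series 3 (A * y)) has_real_derivative b4 * A) (at x)"
    using bessel_series_DERIV[OF Ax, of 3] by (simp add: b4_def eval_nat_numeral)
  have "((\<lambda>y. ln (bessel_main A y)) has_real_derivative inverse (bessel_main A x) * (A\<^sup>2 / (2 * pi) * (b3 * A))) (at x)"
    unfolding bessel_main_def
    by (rule DERIV_chain2[OF DERIV_ln DERIV_cmult[OF d2]]) (use b2 A in \<open>simp add: b2_def[symmetric]\<close>)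
  moreover have "inverse (bessel_main A x) * (A\<^sup>2 / (2 * pi) * (b3 * A)) = u x"
    using b2 A by (simp add: bessel_main_def u_def b2_def[symmetric] b3_def[symmetric] field_simps)
  ultimately show "((\<lambda>y. ln (bessel_main A y)) has_real_derivative u x) (at x)" by simp
  define D where "D = A * ((b4 * A * b2 - b3 * (b3 * A)) / (b2 * b2))"
  have D: "(u has_real_derivative D) (at x)"
    unfolding u_def D_def b2_def b3_def
    by (rule DERIV_cmult[OF DERIV_divide[OF d3[unfolded b2_def b3_def] d2[unfolded b2_def b3_def]]])
       (use b2 in \<open>simp add: b2_def\<close>)
  define z where "z = 2 * sqrt (A * x)"
  have wz: "w = 1 / z" using w(1) by (simp add: z_def)
  have zp: "z > 0" using A x by (simp add: z_def)
  have z2: "z\<^sup>2 / 4 = A * x" using A x by (simp add: z_def power_mult_distrib)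
  have z10: "z \<ge> 10" using w(2) zp unfolding wz by (simp add: field_simps)
  define h where "h = z / 2 * (b3 / b2)"
  have wp: "0 < w" using zp wz by simp
  have hl: "1 - 5 / 2 * w + 15 / 8 * w\<^sup>2 \<le> h"
  proof -
    have "(1 - 5 / (2 * z) + 15 / (8 * z\<^sup>2)) * b2 \<le> z / 2 * b3"
      using bessel_quotient_lower[of z] z10 unfolding z2 b2_def b3_def by simp
    then have "1 - 5 / (2 * z) + 15 / (8 * z\<^sup>2) \<le> z / 2 * b3 / b2" using b2 by (simp add: pos_le_divide_eq)
    then show ?thesis by (simp add: h_def wz power_divide)
  qed
  have hu: "h \<le> 1 - 5 / 2 * w + 15 / 8 * w\<^sup>2 + 5 * w ^ 3"
  proof -
    have "z / 2 * b3 \<le> (1 - 5 / (2 * z) + 15 / (8 * z\<^sup>2) + 5 / z ^ 3) * b2"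
      using bessel_quotient_upper[of z] z10 unfolding z2 b2_def b3_def by simp
    then have "z / 2 * b3 / b2 \<le> 1 - 5 / (2 * z) + 15 / (8 * z\<^sup>2) + 5 / z ^ 3" using b2 by (simp add: pos_divide_le_eq)
    then show ?thesis by (simp add: h_def wz power_divide)
  qed
  have rec: "b2 = z\<^sup>2 / 4 * b4 + 3 * b3"
    using bessel_series_recurrence[of 2 "A * x"] unfolding z2 b2_def b3_def b4_def by (simp add: eval_nat_numeral)
  \<comment> \<open>Eliminating \<open>b4\<close> by the recurrence leaves an expression in h alone.
    With h = 1 - 5 w / 2 + 15 w^2 / 8 + O(w^3) the constants cancel and w - 5 w^2 remains, common to
    both bounds.\<close>
  have mD: "- D = 4 * A\<^sup>2 * w\<^sup>2 * (h\<^sup>2 + 6 * w * h - 1)"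
  proof -
    have b4: "b4 = 4 * (b2 - 3 * b3) / z\<^sup>2" using rec zp by (simp add: field_simps)
    show ?thesis unfolding D_def b4 h_def wz using b2 zp
      by (simp add: divide_simps) (simp add: power2_eq_square algebra_simps)
  qed
  have w1: "w * w \<le> 1 / 10 * w" using wp w(2) by (intro mult_right_mono) auto
  have l0: "0 \<le> 1 - 5 / 2 * w + 15 / 8 * w\<^sup>2" using w(2) zero_le_power2[of w] by linarith
  have F: "4 * A\<^sup>2 * w\<^sup>2 \<ge> 0" by simp
  have low: "w - 5 * w\<^sup>2 \<le> h\<^sup>2 + 6 * w * h - 1"
  proof -
    let ?l = "1 - 5 / 2 * w + 15 / 8 * w\<^sup>2"
    have "?l\<^sup>2 \<le> h\<^sup>2" using hl l0 by (intro power_mono) auto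
    moreover have "6 * w * ?l \<le> 6 * w * h" using hl wp by (intro mult_left_mono) auto
    moreover have "?l\<^sup>2 + 6 * w * ?l - 1 = w - 5 * w\<^sup>2 + (15 / 8 * w ^ 3 + 225 / 64 * w ^ 4)"
      by (simp add: power2_eq_square eval_nat_numeral algebra_simps)
    moreover have "15 / 8 * w ^ 3 + 225 / 64 * w ^ 4 \<ge> 0" using wp by simp
    ultimately show ?thesis by linarith
  qed
  have up: "h\<^sup>2 + 6 * w * h - 1 \<le> w - 5 * w\<^sup>2 + 13 * w ^ 3"
  proof -
    let ?l = "1 - 5 / 2 * w + 15 / 8 * w\<^sup>2 + 5 * w ^ 3"
    have "0 \<le> h" using hl l0 by linarith
    then have "h\<^sup>2 \<le> ?l\<^sup>2" using hu by (intro power_mono) auto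
    moreover have "6 * w * h \<le> 6 * w * ?l" using hu wp by (intro mult_left_mono) auto
    moreover have "?l\<^sup>2 + 6 * w * ?l - 1 = w - 5 * w\<^sup>2 + w ^ 3 * (95 / 8 + 545 / 64 * w + 75 / 4 * w\<^sup>2 + 25 * w ^ 3)"
      by (simp add: power2_eq_square eval_nat_numeral algebra_simps)
    \<comment> \<open>95 / 8 = 11.875, and for w \<le> 1 / 10 the remaining terms still keep the sum
      below 13.\<close>
    moreover have "w ^ 3 * (95 / 8 + 545 / 64 * w + 75 / 4 * w\<^sup>2 + 25 * w ^ 3) \<le> w ^ 3 * 13"
    proof (rule mult_left_mono)
      have "w\<^sup>2 \<le> (1 / 10)\<^sup>2" "w ^ 3 \<le> (1 / 10) ^ 3" using wp w(2) by (auto intro!: power_mono)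
      then have "w\<^sup>2 \<le> 1 / 100" "w ^ 3 \<le> 1 / 1000" by (auto simp: power_divide)
      then show "95 / 8 + 545 / 64 * w + 75 / 4 * w\<^sup>2 + 25 * w ^ 3 \<le> 13" using w(2) by linarith
    qed (use wp in simp)
    ultimately show ?thesis by linarith
  qed
  have "4 * A\<^sup>2 * (w ^ 3 - 5 * w ^ 4) = 4 * A\<^sup>2 * w\<^sup>2 * (w - 5 * w\<^sup>2)"
    "4 * A\<^sup>2 * (w ^ 3 - 5 * w ^ 4 + 13 * w ^ 5) = 4 * A\<^sup>2 * w\<^sup>2 * (w - 5 * w\<^sup>2 + 13 * w ^ 3)"
    by (simp_all add: power2_eq_square eval_nat_numeral algebra_simps)
  then have "4 * A\<^sup>2 * (w ^ 3 - 5 * w ^ 4) \<le> - D \<and> - D \<le> 4 * A\<^sup>2 * (w ^ 3 - 5 * w ^ 4 + 13 * w ^ 5)"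
    unfolding mD using low up F by (metis mult_left_mono)
  with D show "\<exists>D. (u has_real_derivative D) (at x) \<and>
           4 * A\<^sup>2 * (w ^ 3 - 5 * w ^ 4) \<le> - D \<and> - D \<le> 4 * A\<^sup>2 * (w ^ 3 - 5 * w ^ 4 + 13 * w ^ 5)" by blast
qed

text \<open>After subtraction of c y^2 / 2 the function is convex and lies above its tangent at x;
  adding the tangent inequalities at x - 1 and x + 1 removes the slope.\<close>

lemma second_difference_ge:
  fixes f f' f'' :: "real \<Rightarrow> real"
  assumes "\<And>y. y \<in> {x - 1..x + 1} \<Longrightarrow> (f has_real_derivative f' y) (at y)"
    and "\<And>y. y \<in> {x - 1..x + 1} \<Longrightarrow> (f' has_real_derivative f'' y) (at y)"
    and "\<And>y. y \<in> {x - 1..x + 1} \<Longrightarrow> c \<le> f'' y"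
  shows "c \<le> f (x - 1) + f (x + 1) - 2 * f x"
proof -
  let ?g = "\<lambda>y. f y - c / 2 * y\<^sup>2" and ?g' = "\<lambda>y. f' y - c * y" and ?g'' = "\<lambda>y. f'' y - c"
  have g: "?g' x * (y - x) \<le> ?g y - ?g x" if "y \<in> {x - 1..x + 1}" for y
  proof (rule f''_imp_f'[where C = "{x - 1..x + 1}" and f'' = ?g''])
    show "(?g has_real_derivative ?g' z) (at z)" if "z \<in> {x - 1..x + 1}" for z
      using assms(1)[OF that] by (auto intro!: derivative_eq_intros)
    show "(?g' has_real_derivative ?g'' z) (at z)" if "z \<in> {x - 1..x + 1}" for z
      using assms(2)[OF that] by (auto intro!: derivative_eq_intros)
  qed (use assms(3) that in auto)
  have "?g' x * ((x - 1) - x) + ?g' x * ((x + 1) - x) \<le> (?g (x - 1) - ?g x) + (?g (x + 1) - ?g x)"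
    by (intro add_mono g) auto
  then show ?thesis by (simp add: power2_eq_square algebra_simps add_divide_distrib)
qed

text \<open>On the interval from x - 1 to x + 1 the value w (y) stays between \<open>V\<close> and
  \<open>W\<close>, and both polynomials bounding the second derivative are increasing in w up to 1
  / 10.\<close>

lemma log_bessel_second_difference:
  fixes A x :: real
  assumes A: "A > 0" and x: "x > 1" and W: "1 / (2 * sqrt (A * (x - 1))) \<le> W" "W \<le> 1 / 10"
    and V: "0 \<le> V" "V \<le> 1 / (2 * sqrt (A * (x + 1)))"
  defines "\<gamma> \<equiv> 2 * ln (bessel_main A x) - ln (bessel_main A (x - 1)) - ln (bessel_main A (x + 1))"
  shows "4 * A\<^sup>2 * (V ^ 3 - 5 * V ^ 4) \<le> \<gamma>" "\<gamma> \<le> 4 * A\<^sup>2 * (W ^ 3 - 5 * W ^ 4 + 13 * W ^ 5)"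
proof -
  define u where "u = (\<lambda>y. A * (bessel_series 3 (A * y) / bessel_series 2 (A * y)))"
  define w where "w = (\<lambda>y. 1 / (2 * sqrt (A * y)))"
  have w: "V \<le> w y" "w y \<le> W" if "y \<in> {x - 1..x + 1}" for y
  proof -
    have p: "0 < A * (x - 1)" "A * (x - 1) \<le> A * y" "A * y \<le> A * (x + 1)" using A x that by auto
    have "1 / (2 * sqrt (A * (x + 1))) \<le> w y" "w y \<le> 1 / (2 * sqrt (A * (x - 1)))"
      unfolding w_def using p by (auto intro!: divide_left_mono mult_pos_pos)
    then show "V \<le> w y" "w y \<le> W" using V W by auto
  qed
  have c: "y > 0" "w y = 1 / (2 * sqrt (A * y))" "w y \<le> 1 / 10" if "y \<in> {x - 1..x + 1}" for y
    using w[OF that] that x W(2) by (auto simp: w_def)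
  have ex: "\<exists>D. (u has_real_derivative D) (at y) \<and> 4 * A\<^sup>2 * (w y ^ 3 - 5 * w y ^ 4) \<le> - D \<and>
     - D \<le> 4 * A\<^sup>2 * (w y ^ 3 - 5 * w y ^ 4 + 13 * w y ^ 5)" if "y \<in> {x - 1..x + 1}" for y
    unfolding u_def by (rule log_bessel_second_derivative(2)[OF A c[OF that]])
  then obtain D where D: "\<And>y. y \<in> {x - 1..x + 1} \<Longrightarrow> (u has_real_derivative D y) (at y)"
    "\<And>y. y \<in> {x - 1..x + 1} \<Longrightarrow> 4 * A\<^sup>2 * (w y ^ 3 - 5 * w y ^ 4) \<le> - D y"
    "\<And>y. y \<in> {x - 1..x + 1} \<Longrightarrow> - D y \<le> 4 * A\<^sup>2 * (w y ^ 3 - 5 * w y ^ 4 + 13 * w y ^ 5)"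
    by metis
  have L: "((\<lambda>y. ln (bessel_main A y)) has_real_derivative u y) (at y)" if "y \<in> {x - 1..x + 1}" for y
    unfolding u_def by (rule log_bessel_second_derivative(1)[OF A c[OF that]])
  have mono1: "b ^ 3 - 5 * b ^ 4 \<le> c ^ 3 - 5 * c ^ 4" if "0 \<le> b" "b \<le> c" "c \<le> 1 / 10" for b c :: real
  proof (rule DERIV_nonneg_imp_nondecreasing[OF that(2)])
    fix t assume t: "b \<le> t" "t \<le> c"
    have "((\<lambda>t. t ^ 3 - 5 * t ^ 4) has_real_derivative t\<^sup>2 * (3 - 20 * t)) (at t)"
      by (auto intro!: derivative_eq_intros simp: power2_eq_square eval_nat_numeral algebra_simps)
    moreover have "t\<^sup>2 * (3 - 20 * t) \<ge> 0" using t that by (intro mult_nonneg_nonneg) auto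
    ultimately show "\<exists>d. ((\<lambda>t. t ^ 3 - 5 * t ^ 4) has_real_derivative d) (at t) \<and> 0 \<le> d" by blast
  qed
  have mono2: "b ^ 3 - 5 * b ^ 4 + 13 * b ^ 5 \<le> c ^ 3 - 5 * c ^ 4 + 13 * c ^ 5" if "0 \<le> b" "b \<le> c" "c \<le> 1 / 10" for b c :: real
    using mono1[OF that] power_mono[OF that(2,1), of 5] by linarith
  have "4 * A\<^sup>2 * (V ^ 3 - 5 * V ^ 4) \<le> - D y" if "y \<in> {x - 1..x + 1}" for y
    by (rule order_trans[OF mult_left_mono[OF mono1[OF V(1) w(1)[OF that]]] D(2)[OF that]])
       (use w[OF that] W in auto)
  then have "4 * A\<^sup>2 * (V ^ 3 - 5 * V ^ 4) \<le> - ln (bessel_main A (x - 1)) + - ln (bessel_main A (x + 1)) - 2 * - ln (bessel_main A x)"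
    by (intro second_difference_ge[where f = "\<lambda>y. - ln (bessel_main A y)" and f' = "\<lambda>y. - u y" and f'' = "\<lambda>y. - D y"]
        DERIV_minus L D(1))
  then show "4 * A\<^sup>2 * (V ^ 3 - 5 * V ^ 4) \<le> \<gamma>" by (simp add: \<gamma>_def)
  have "- (4 * A\<^sup>2 * (W ^ 3 - 5 * W ^ 4 + 13 * W ^ 5)) \<le> D y" if "y \<in> {x - 1..x + 1}" for y
  proof -
    have "0 \<le> w y" using w(1)[OF that] V by linarith
    then have "4 * A\<^sup>2 * (w y ^ 3 - 5 * w y ^ 4 + 13 * w y ^ 5) \<le> 4 * A\<^sup>2 * (W ^ 3 - 5 * W ^ 4 + 13 * W ^ 5)"
      using w[OF that] W by (intro mult_left_mono mono2) auto
    with D(3)[OF that] show ?thesis by linarith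
  qed
  then have "- (4 * A\<^sup>2 * (W ^ 3 - 5 * W ^ 4 + 13 * W ^ 5)) \<le> ln (bessel_main A (x - 1)) + ln (bessel_main A (x + 1)) - 2 * ln (bessel_main A x)"
    by (intro second_difference_ge[where f' = u and f'' = D] L D(1))
  then show "\<gamma> \<le> 4 * A\<^sup>2 * (W ^ 3 - 5 * W ^ 4 + 13 * W ^ 5)" by (simp add: \<gamma>_def)
qed

text \<open>The choice a = sqrt ((A - 2) / n) balances n a against (A - 2) / a: both equal
  \<open>v\<close>. The error then has size exp (2 v), the main term size exp z up to powers of z,
  and 2 v / z is about sqrt ((A - 2) / A) < 0.703. The exponential gap beats any power of z; the
  fifth is the one the second differences require.\<close>

lemma broken_diamond_relative_error:
  assumes m: "m = 2 * k + 1" "m \<in> {3, 5}" and n: "n \<ge> 699"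
  defines "A \<equiv> diamond_growth m" and "x \<equiv> real n - (real m + 1) / 24"
  shows "\<bar>\<Delta> k n - bessel_main A x\<bar> \<le> 200 * (1 / (2 * sqrt (A * x))) ^ 5 * bessel_main A x"
proof -
  define z where "z = 2 * sqrt (A * x)"
  define a where "a = sqrt ((A - 2) / real n)"
  define v where "v = sqrt ((A - 2) * real n)"
  have A: "383 / 100 \<le> A" "A \<le> 395 / 100" unfolding A_def using diamond_growth_bounds[OF m(2)] by auto
  have x: "69875 / 100 \<le> x" "real n - 1 / 4 \<le> x" "x \<le> real n" using m(2) n by (auto simp: x_def)
  have n': "real n \<ge> 699" using n by simp
  have z2: "z\<^sup>2 = 4 * (A * x)" using A x by (simp add: z_def power_mult_distrib)
  have zp: "z > 0" using A x by (simp add: z_def)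
  have "383 / 100 * (69875 / 100) \<le> A * x" using A x by (intro mult_mono) auto
  then have "103\<^sup>2 \<le> z\<^sup>2" unfolding z2 by simp
  then have z: "z \<ge> 103" using zp power2_le_imp_le[of 103 z] by simp
  have ap: "a > 0" using A n' by (simp add: a_def)
  have "(A - 2) / real n \<le> 195 / 100 / 699" using A n' by (intro frac_le) auto
  also have "\<dots> \<le> (53 / 1000)\<^sup>2" by (simp add: power2_eq_square)
  finally have a: "a \<le> 53 / 1000" unfolding a_def by (intro real_le_lsqrt) auto
  have na: "real n * a = v" "(A - 2) / a = v"
  proof -
    have "a * a = (A - 2) / real n" using A by (simp add: a_def)
    then have "(A - 2) = real n * a * a" using n' by (simp add: field_simps)
    then have "(A - 2) / a = real n * a" using ap by (simp add: field_simps)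
    moreover have "real n * a = v"
    proof (rule power2_eq_imp_eq)
      show "(real n * a)\<^sup>2 = v\<^sup>2" using A n' by (simp add: a_def v_def power_mult_distrib power2_eq_square[of "real n"])
    qed (use A ap in \<open>auto simp: v_def\<close>)
    ultimately show "real n * a = v" "(A - 2) / a = v" by auto
  qed
  \<comment> \<open>(A - 2) / A is at most 1.95 / 3.95 < 0.49368, while 0.703^2 = 0.494209. This
    slack and the constant 0.015 pay for the shift n \<le> x + 1 / 4.\<close>
  have v2: "2 * v \<le> 703 / 1000 * z + (15 / 1000)"
  proof (rule power2_le_imp_le)
    have "(2 * v)\<^sup>2 = 4 * ((A - 2) * real n)" using A by (simp add: v_def power_mult_distrib)
    also have "\<dots> \<le> 4 * ((49368 / 100000) * A * (x + 1 / 4))"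
    proof -
      have "A - 2 \<le> 49368 / 100000 * A" "0 \<le> A - 2" using A by auto
      then have "(A - 2) * real n \<le> 49368 / 100000 * A * (x + 1 / 4)" using x by (intro mult_mono) auto
      then show ?thesis by simp
    qed
    also have "\<dots> = (49368 / 100000) * z\<^sup>2 + (49368 / 100000) * A" unfolding z2 by (simp add: algebra_simps)
    also have "\<dots> \<le> ((703 / 1000) * z + (15 / 1000))\<^sup>2"
    proof -
      have "((703 / 1000) * z + (15 / 1000))\<^sup>2 = (494209 / 1000000) * z\<^sup>2 + (2109 / 100000) * z + (225 / 1000000)"
        by (simp add: power2_eq_square algebra_simps)
      then show ?thesis using A z zero_le_power2[of z] by linarith
    qed
    finally show "(2 * v)\<^sup>2 \<le> ((703 / 1000) * z + (15 / 1000))\<^sup>2" .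
  qed (use z in simp)
  have v35: "v \<ge> 35"
  proof -
    have "183 / 100 * 699 \<le> (A - 2) * real n" using A n' by (intro mult_mono) auto
    then show ?thesis unfolding v_def by (intro real_le_rsqrt) (simp add: power2_eq_square)
  qed
  have ev: "91 \<le> 1 / 2 * exp v"
  proof -
    have "(1 + v / 2)\<^sup>2 \<le> (exp (v / 2))\<^sup>2" using v35 by (intro power_mono exp_ge_add_one_self) auto
    moreover have "(exp (v / 2))\<^sup>2 = exp v" by (simp add: power2_eq_square mult_exp_exp)
    moreover have "((185 / 10))\<^sup>2 \<le> (1 + v / 2)\<^sup>2" using v35 by (intro power_mono) auto
    ultimately show ?thesis by (simp add: power2_eq_square)
  qed
  have "\<bar>\<Delta> k n - bessel_main A x\<bar> \<le> exp (real n * a) * (91 + 28 * a * exp ((A - 2) / a))"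
    unfolding A_def x_def by (rule broken_diamond_main_term[OF m ap]) (use a n in auto)
  also have "\<dots> \<le> exp v * (2 * exp v)"
  proof -
    have "28 * a * exp v \<le> 3 / 2 * exp v" using a by (intro mult_right_mono) auto
    then have "91 + 28 * a * exp v \<le> 2 * exp v" using ev by linarith
    then show ?thesis unfolding na by (rule mult_left_mono) simp
  qed
  also have "\<dots> = 2 * exp (2 * v)" by (simp add: mult_exp_exp)
  also have "\<dots> \<le> 2 * exp ((703 / 1000) * z + (15 / 1000))" using v2 by simp
  also have "\<dots> \<le> 2 * exp (5 + z - 15 / 2 * ln z)"
  proof -
    have e86: "86 \<le> exp (9 / 2 :: real)"
    proof -
      have "86 \<le> (1 + 1 / 4 + (1 / 4)\<^sup>2 / 2 :: real) ^ 18" by (simp add: power_divide)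
      also have "\<dots> \<le> exp (1 / 4) ^ 18" by (intro power_mono exp_lower_Taylor_quadratic) auto
      also have "\<dots> = exp (9 / 2 :: real)" by (simp add: exp_of_nat_mult[symmetric])
      finally show ?thesis .
    qed
    \<comment> \<open>The tangent to the logarithm at exp (9 / 2), about 90, is nearly optimal for
      the smallest admissible values of z, just above 103.\<close>
    have "ln z = ln (z / exp (9 / 2)) + 9 / 2" using zp by (simp add: ln_div)
    also have "ln (z / exp (9 / 2)) \<le> z / exp (9 / 2) - 1" using zp by (intro ln_le_minus_one) simp
    also have "z / exp (9 / 2) \<le> z / 86" using e86 zp by (intro divide_left_mono) auto
    finally have "ln z \<le> z / 86 + 7 / 2" by simp
    then have "703 / 1000 * z + (15 / 1000) \<le> 5 + z - 15 / 2 * ln z" using z by simp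
    then show ?thesis by simp
  qed
  also have "\<dots> \<le> 200 * (1 / z) ^ 5 * bessel_main A x"
  proof -
    have "bessel_series 2 (z\<^sup>2 / 4) \<ge> 9 / 10 * exp (z - 5 / 2 * ln z)"
      using z by (intro bessel_series_2_exp_lower) simp
    then have b: "bessel_series 2 (A * x) \<ge> 9 / 10 * exp (z - 5 / 2 * ln z)" unfolding z2 by simp
    have A2: "A\<^sup>2 / (2 * pi) \<ge> 22 / 10"
    proof -
      have "(383 / 100)\<^sup>2 \<le> A\<^sup>2" using A by (intro power_mono) auto
      moreover have "2 * pi \<le> 63 / 10" using pi_approx by simp
      ultimately have "(146 / 10) / (63 / 10) \<le> A\<^sup>2 / (2 * pi)" by (intro frac_le) (auto simp: power2_eq_square)
      then show ?thesis by simp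
    qed
    have "22 / 10 * (9 / 10 * exp (z - 5 / 2 * ln z)) \<le> bessel_main A x"
      unfolding bessel_main_def using A2 b by (intro mult_mono) auto
    then have "200 * (1 / z) ^ 5 * ((198 / 100) * exp (z - 5 / 2 * ln z)) \<le> 200 * (1 / z) ^ 5 * bessel_main A x"
      using zp by (intro mult_left_mono) auto
    moreover have "(1 / z) ^ 5 * exp (z - 5 / 2 * ln z) = exp (z - 15 / 2 * ln z)"
    proof -
      have "1 / z = exp (- ln z)" using zp by (simp add: exp_minus inverse_eq_divide)
      then have "(1 / z) ^ 5 = exp (5 * (- ln z))" by (simp only: exp_of_nat_mult[symmetric]) simp
      then show ?thesis by (simp add: mult_exp_exp)
    qed
    ultimately have "396 * exp (z - 15 / 2 * ln z) \<le> 200 * (1 / z) ^ 5 * bessel_main A x" by (simp add: mult_ac)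
    moreover have "exp (5 + z - 15 / 2 * ln z) \<le> 198 * exp (z - 15 / 2 * ln z)"
    proof -
      have "exp (5::real) = exp 1 ^ 5" by (simp add: exp_of_nat_mult[symmetric])
      also have "\<dots> \<le> (272 / 100) ^ 5" using e_less_272 by (intro power_mono) auto
      also have "\<dots> \<le> (198::real)" by (simp add: power_divide)
      finally have "exp 5 * exp (z - 15 / 2 * ln z) \<le> 198 * exp (z - 15 / 2 * ln z)" by (intro mult_right_mono) auto
      then show ?thesis by (simp add: mult_exp_exp add_diff_eq)
    qed
    ultimately show ?thesis by linarith
  qed
  finally show ?thesis by (simp add: z_def)
qed

lemma turan_from_bounds:
  fixes u v :: real
  assumes "0 < l" "l \<le> u" "u \<le> r" "l \<le> v" "v \<le> r" and gap: "(r - l)\<^sup>2 + r ^ 4 < 4 * l ^ 3"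
  shows "4 * u * v - (1 - (1 - u) * (1 - v))\<^sup>2 > 0"
proof -
  have "(u - v)\<^sup>2 \<le> (r - l)\<^sup>2" using assms by (intro abs_le_square_iff[THEN iffD1]) auto
  moreover have "l * l * (l + l) \<le> u * v * (u + v)" using assms by (intro mult_mono add_mono) auto
  moreover have "(u * v)\<^sup>2 \<le> (r * r)\<^sup>2" using assms by (intro power_mono mult_mono) auto
  moreover have "4 * u * v - (1 - (1 - u) * (1 - v))\<^sup>2 = 2 * (u * v * (u + v)) - (u - v)\<^sup>2 - (u * v)\<^sup>2"
    by (simp add: power2_eq_square algebra_simps)
  moreover have "l * l * (l + l) = 2 * l ^ 3" "(r * r)\<^sup>2 = r ^ 4" by (auto simp: power2_eq_square eval_nat_numeral)
  ultimately show ?thesis using gap by linarith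
qed

text \<open>To first order the deviation is d1 + d3 - 2 d2, at most 4 e; raising 4 to 5 covers the
  quadratic terms and the denominator.\<close>

lemma ratio_perturbation:
  fixes e :: real
  assumes e: "0 \<le> e" "e \<le> 1 / 100" and d: "\<bar>d1\<bar> \<le> e" "\<bar>d2\<bar> \<le> e" "\<bar>d3\<bar> \<le> e"
  shows "\<bar>(1 + d1) * (1 + d3) / (1 + d2)\<^sup>2 - 1\<bar> \<le> 5 * e"
proof -
  have p: "(1 + d2)\<^sup>2 > 0" using d e by simp
  have q: "(1 + d2)\<^sup>2 \<ge> 98 / 100"
  proof -
    have "((99 / 100))\<^sup>2 \<le> (1 + d2)\<^sup>2" using d e by (intro power_mono) auto
    then show ?thesis by (simp add: power2_eq_square)
  qed
  have "(1 + d1) * (1 + d3) - (1 + d2)\<^sup>2 = d1 + d3 - 2 * d2 + d1 * d3 - d2 * d2"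
    by (simp add: power2_eq_square algebra_simps)
  moreover have "\<bar>d1 * d3\<bar> \<le> e * (1 / 100)" unfolding abs_mult using d e by (intro mult_mono) auto
  moreover have "\<bar>d2 * d2\<bar> \<le> e * (1 / 100)" unfolding abs_mult using d e by (intro mult_mono) auto
  ultimately have "\<bar>(1 + d1) * (1 + d3) - (1 + d2)\<^sup>2\<bar> \<le> 402 / 100 * e" using d by linarith
  also have "\<dots> \<le> 5 * e * (1 + d2)\<^sup>2"
    using mult_left_mono[OF q, of "5 * e"] e by linarith
  finally have "\<bar>(1 + d1) * (1 + d3) - (1 + d2)\<^sup>2\<bar> / (1 + d2)\<^sup>2 \<le> 5 * e" using p by (simp add: pos_divide_le_eq)
  moreover have "(1 + d1) * (1 + d3) / (1 + d2)\<^sup>2 - 1 = ((1 + d1) * (1 + d3) - (1 + d2)\<^sup>2) / (1 + d2)\<^sup>2"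
    using p by (simp add: diff_divide_distrib)
  ultimately show ?thesis using p by (simp add: abs_divide)
qed

lemma one_minus_exp_neg_bounds:
  fixes g :: real
  assumes "0 \<le> g"
  shows "g - g\<^sup>2 / 2 \<le> 1 - exp (- g)" "1 - exp (- g) \<le> g"
  using exp_neg_bounds[OF assms] by auto

text \<open>\<open>W\<close> belongs to x - 1 and \<open>V\<close> to x + 2, the ends of the range
  that the second differences at n and n + 1 cover together. All bounds are brought into the form p
  (1 - 5 W + c W^2), so that only the coefficient c differs: - 97 below and 33 above.\<close>

theorem broken_diamond_turan_large:
  assumes m: "m = 2 * k + 1" "m \<in> {3, 5}" and n: "n \<ge> 700"
  shows "4 * (1 - \<Theta> k n) * (1 - \<Theta> k (n + 1)) - (1 - \<Theta> k n * \<Theta> k (n + 1))\<^sup>2 > 0"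
proof -
  define A where "A = diamond_growth m"
  define x where "x = real n - (real m + 1) / 24"
  have A: "383 / 100 \<le> A" "A \<le> 395 / 100" unfolding A_def using diamond_growth_bounds[OF m(2)] by auto
  have x: "x \<ge> 69975 / 100" using m(2) n by (auto simp: x_def)
  define W where "W = 1 / (2 * sqrt (A * (x - 1)))"
  define V where "V = 1 / (2 * sqrt (A * (x + 2)))"
  define p where "p = 4 * A\<^sup>2 * W ^ 3"
  define M where "M = bessel_main A"
  have Ax: "A * (x - 1) > 0" using A x by simp
  have Wp: "W > 0" using Ax by (simp add: W_def)
  have Vp: "V > 0" using A x by (simp add: V_def)
  have W2: "W\<^sup>2 = 1 / (4 * (A * (x - 1)))" using Ax by (simp add: W_def power_divide power_mult_distrib)
  have V2: "V\<^sup>2 = 1 / (4 * (A * (x + 2)))" using A x by (simp add: V_def power_divide power_mult_distrib)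
  have W100: "W \<le> 1 / 100"
  proof (rule power2_le_imp_le)
    have "383 / 100 * (69875 / 100) \<le> A * (x - 1)" using A x by (intro mult_mono) auto
    then have "1 / (4 * (A * (x - 1))) \<le> 1 / 10000" by (intro divide_left_mono) auto
    then show "W\<^sup>2 \<le> (1 / 100)\<^sup>2" unfolding W2 by (simp add: power_divide)
  qed simp
  have VW: "V \<le> W" unfolding V_def W_def using A x Ax by (intro divide_left_mono mult_pos_pos) auto
  have p1: "58 * W ^ 3 \<le> p" "p \<le> 63 * W ^ 3"
  proof -
    have "(383 / 100)\<^sup>2 \<le> A\<^sup>2" "A\<^sup>2 \<le> (395 / 100)\<^sup>2" using A by (auto intro!: power_mono)
    then have "58 \<le> 4 * A\<^sup>2" "4 * A\<^sup>2 \<le> 63" by (auto simp: power2_eq_square)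
    then show "58 * W ^ 3 \<le> p" "p \<le> 63 * W ^ 3" unfolding p_def using Wp by (auto intro!: mult_right_mono)
  qed
  have pp: "p > 0" using p1(1) Wp by (smt (verit) zero_less_power)
  have ww: "W\<^sup>2 \<le> 1 / 100 * W" unfolding power2_eq_square using W100 Wp by (intro mult_right_mono) auto
  have w3: "W ^ 3 \<le> 1 / 100 * W\<^sup>2"
  proof -
    have "W ^ 3 = W * W\<^sup>2" by (simp add: power2_eq_square eval_nat_numeral)
    also have "\<dots> \<le> 1 / 100 * W\<^sup>2" using W100 by (intro mult_right_mono) auto
    finally show ?thesis .
  qed
  \<comment> \<open>As 1 / V^2 = 1 / W^2 + 12 A, the value V is about W (1 - 6 A W^2), and 6 A <
    25.\<close>
  have VWq: "W * (1 - 25 * W\<^sup>2) \<le> V"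
  proof (rule power2_le_imp_le)
    define c where "c = W\<^sup>2"
    have c: "0 \<le> c" "c \<le> 1 / 10000" using ww W100 by (auto simp: c_def)
    have "A * (x - 1) = 1 / (4 * c)" unfolding c_def W2 using Ax by simp
    then have "4 * (A * (x + 2)) = 1 / c + 12 * A" by (simp add: algebra_simps)
    moreover have "12 * A \<le> 48" using A by simp
    moreover have cp: "c > 0" using Wp by (simp add: c_def)
    ultimately have "4 * (A * (x + 2)) \<le> 1 / c + 48" by linarith
    then have "1 / (1 / c + 48) \<le> V\<^sup>2" unfolding V2 using A x by (intro divide_left_mono mult_pos_pos) (auto intro: add_pos_pos simp: cp)
    moreover have "c * (1 - 25 * c)\<^sup>2 \<le> 1 / (1 / c + 48)"
    proof -
      have "(1 - 25 * c)\<^sup>2 * (1 + 48 * c) \<le> 1"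
      proof -
        have "(1 - 25 * c)\<^sup>2 * (1 + 48 * c) = 1 - c * (2 + 1775 * c - 30000 * c\<^sup>2)"
          by (simp add: power2_eq_square algebra_simps)
        moreover have "c\<^sup>2 \<le> 1 / 10000 * c" unfolding power2_eq_square using c by (intro mult_right_mono) auto
        then have "0 \<le> 2 + 1775 * c - 30000 * c\<^sup>2" using c by linarith
        then have "0 \<le> c * (2 + 1775 * c - 30000 * c\<^sup>2)" using c by (intro mult_nonneg_nonneg) auto
        ultimately show ?thesis by linarith
      qed
      then have "c * ((1 - 25 * c)\<^sup>2 * (1 + 48 * c)) \<le> c * 1" using c by (intro mult_left_mono) auto
      then have "c * (1 - 25 * c)\<^sup>2 \<le> c / (1 + 48 * c)" using c by (simp add: pos_le_divide_eq mult_ac)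
      also have "\<dots> = 1 / (1 / c + 48)" using cp by (simp add: field_simps)
      finally show ?thesis .
    qed
    moreover have "(W * (1 - 25 * W\<^sup>2))\<^sup>2 = c * (1 - 25 * c)\<^sup>2" by (simp add: c_def power_mult_distrib)
    ultimately show "(W * (1 - 25 * W\<^sup>2))\<^sup>2 \<le> V\<^sup>2" by linarith
  qed (use Vp in simp)
  have V3: "W ^ 3 * (1 - 75 * W\<^sup>2) \<le> V ^ 3"
  proof -
    have q: "0 \<le> 1 - 25 * W\<^sup>2" using ww W100 by linarith
    have "1 - 75 * c \<le> (1 - 25 * c) ^ 3" if "0 \<le> c" "c \<le> 1 / 25" for c :: real
    proof -
      have "(1 - 25 * c) ^ 3 = 1 - 75 * c + c\<^sup>2 * (1875 - 15625 * c)"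
        by (simp add: power2_eq_square eval_nat_numeral algebra_simps)
      moreover have "0 \<le> c\<^sup>2 * (1875 - 15625 * c)" using that by (intro mult_nonneg_nonneg) auto
      ultimately show ?thesis by linarith
    qed
    from this[of "W\<^sup>2"] q have "1 - 75 * W\<^sup>2 \<le> (1 - 25 * W\<^sup>2) ^ 3" by simp
    then have "W ^ 3 * (1 - 75 * W\<^sup>2) \<le> W ^ 3 * (1 - 25 * W\<^sup>2) ^ 3" using Wp by (intro mult_left_mono) auto
    also have "\<dots> = (W * (1 - 25 * W\<^sup>2)) ^ 3" by (simp add: power_mult_distrib)
    also have "\<dots> \<le> V ^ 3" using VWq q Wp by (intro power_mono mult_nonneg_nonneg) auto
    finally show ?thesis .
  qed
  have V4: "V ^ 4 \<le> W ^ 4" using VW Vp by (intro power_mono) auto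
  have Mpos: "M y > 0" if "y > 0" for y
    unfolding M_def bessel_main_def using A that by (intro mult_pos_pos bessel_series_pos) auto
  define e where "e = 200 * W ^ 5"
  have e: "0 \<le> e" "e \<le> 4 * (p * W\<^sup>2)" "e \<le> 1 / 100"
  proof -
    show "0 \<le> e" using Wp by (simp add: e_def)
    have "e = 200 * (W ^ 3 * W\<^sup>2)" by (simp add: e_def power2_eq_square eval_nat_numeral)
    also have "\<dots> \<le> 4 * (58 * W ^ 3 * W\<^sup>2)" using Wp by simp
    also have "\<dots> \<le> 4 * (p * W\<^sup>2)" using p1(1) by (intro mult_left_mono mult_right_mono) auto
    finally show "e \<le> 4 * (p * W\<^sup>2)" .
    have "W ^ 5 \<le> (1 / 100) ^ 5" using Wp W100 by (intro power_mono) auto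
    then show "e \<le> 1 / 100" by (simp add: e_def power_divide)
  qed
  have rel: "\<exists>d. \<bar>d\<bar> \<le> e \<and> \<Delta> k j = M y * (1 + d)" if j: "real j = real n + i" "y = x + i" "-1 \<le> i" for j y i
  proof -
    have y: "y = real j - (real m + 1) / 24" using j by (simp add: x_def)
    have yp: "y > 0" using j x by simp
    have "1 / (2 * sqrt (A * y)) \<le> W" unfolding W_def using A x j Ax by (intro divide_left_mono mult_pos_pos) auto
    then have wy: "(1 / (2 * sqrt (A * y))) ^ 5 \<le> W ^ 5" using A yp by (intro power_mono) auto
    have "j \<ge> 699" using j n by linarith
    from broken_diamond_relative_error[OF m this]
    have "\<bar>\<Delta> k j - M y\<bar> \<le> 200 * (1 / (2 * sqrt (A * y))) ^ 5 * M y"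
      unfolding A_def[symmetric] y[symmetric] M_def .
    also have "\<dots> \<le> e * M y" unfolding e_def using wy Mpos[OF yp] by (intro mult_right_mono mult_left_mono) auto
    finally have "\<bar>\<Delta> k j - M y\<bar> \<le> e * M y" .
    then have "\<bar>(\<Delta> k j - M y) / M y\<bar> \<le> e" using Mpos[OF yp] by (simp add: abs_divide pos_divide_le_eq)
    moreover have "\<Delta> k j = M y * (1 + (\<Delta> k j - M y) / M y)" using Mpos[OF yp] by (simp add: field_simps)
    ultimately show ?thesis by blast
  qed
  \<comment> \<open>Here 97 = 75 + 22 and 33 = 13 + 20. The loss from V to W costs 75, the Bessel
    bound 13, and the perturbation 5 e \<le> 20 p W^2. On the lower side the term g^2 / 2 of 1 - exp
    (- g) costs at most p W^2 more.\<close>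
  have bounds: "p * (1 - 5 * W - 97 * W\<^sup>2) \<le> 1 - \<Theta> k j \<and> 1 - \<Theta> k j \<le> p * (1 - 5 * W + 33 * W\<^sup>2)"
    if j: "real j = real n + i" "0 \<le> i" "i \<le> 1" for j i
  proof -
    define y where "y = x + i"
    have j1: "real (j - 1) = real n + (i - 1)" "real (j + 1) = real n + (i + 1)" using j n by auto
    have "\<exists>d. \<bar>d\<bar> \<le> e \<and> \<Delta> k (j - 1) = M (y - 1) * (1 + d)"
      by (rule rel[OF j1(1)]) (use j in \<open>auto simp: y_def\<close>)
    moreover have "\<exists>d. \<bar>d\<bar> \<le> e \<and> \<Delta> k j = M y * (1 + d)"
      by (rule rel[OF j(1)]) (use j in \<open>auto simp: y_def\<close>)
    moreover have "\<exists>d. \<bar>d\<bar> \<le> e \<and> \<Delta> k (j + 1) = M (y + 1) * (1 + d)"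
      by (rule rel[OF j1(2)]) (use j in \<open>auto simp: y_def\<close>)
    ultimately obtain d1 d2 d3 where d: "\<bar>d1\<bar> \<le> e" "\<Delta> k (j - 1) = M (y - 1) * (1 + d1)"
      "\<bar>d2\<bar> \<le> e" "\<Delta> k j = M y * (1 + d2)" "\<bar>d3\<bar> \<le> e" "\<Delta> k (j + 1) = M (y + 1) * (1 + d3)"
      by (elim exE conjE) (rule that)
    have yp: "y - 1 > 0" using x j by (simp add: y_def)
    have Mp: "M (y - 1) > 0" "M y > 0" "M (y + 1) > 0" using yp by (auto intro!: Mpos)
    define g where "g = 2 * ln (M y) - ln (M (y - 1)) - ln (M (y + 1))"
    have Wy: "1 / (2 * sqrt (A * (y - 1))) \<le> W"
      unfolding W_def using A x j Ax by (intro divide_left_mono mult_pos_pos) (auto simp: y_def)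
    have Vy: "V \<le> 1 / (2 * sqrt (A * (y + 1)))"
      unfolding V_def using A x j by (intro divide_left_mono mult_pos_pos) (auto simp: y_def)
    have "4 * A\<^sup>2 * (V ^ 3 - 5 * V ^ 4) \<le> g" and g2: "g \<le> 4 * A\<^sup>2 * (W ^ 3 - 5 * W ^ 4 + 13 * W ^ 5)"
      unfolding g_def M_def
      using log_bessel_second_difference[of A y W V] A yp Wy Vy W100 Vp by auto
    moreover have "4 * A\<^sup>2 * (W ^ 3 * (1 - 75 * W\<^sup>2) - 5 * W ^ 4) \<le> 4 * A\<^sup>2 * (V ^ 3 - 5 * V ^ 4)"
      using V3 V4 by (intro mult_left_mono) auto
    moreover have "4 * A\<^sup>2 * (W ^ 3 * (1 - 75 * W\<^sup>2) - 5 * W ^ 4) = p * (1 - 5 * W - 75 * W\<^sup>2)"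
      by (simp add: p_def power2_eq_square eval_nat_numeral algebra_simps)
    ultimately have g1: "p * (1 - 5 * W - 75 * W\<^sup>2) \<le> g" by linarith
    have "4 * A\<^sup>2 * (W ^ 3 - 5 * W ^ 4 + 13 * W ^ 5) = p * (1 - 5 * W + 13 * W\<^sup>2)"
      by (simp add: p_def power2_eq_square eval_nat_numeral algebra_simps)
    with g2 have g2: "g \<le> p * (1 - 5 * W + 13 * W\<^sup>2)" by simp
    have "0 \<le> p * (1 - 5 * W - 75 * W\<^sup>2)" using pp ww W100 by (intro mult_nonneg_nonneg) auto
    with g1 have g0: "0 \<le> g" by linarith
    have "p * (1 - 5 * W + 13 * W\<^sup>2) \<le> p * 1" using pp ww Wp by (intro mult_left_mono) auto
    with g2 have gp: "g \<le> p" by linarith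
    have "g\<^sup>2 \<le> p\<^sup>2" using g0 gp by (intro power_mono) auto
    also have "p\<^sup>2 \<le> p * (63 * W ^ 3)" unfolding power2_eq_square using p1(2) pp by (intro mult_left_mono) auto
    also have "\<dots> \<le> p * (2 * W\<^sup>2)" using w3 pp zero_le_power2[of W] by (intro mult_left_mono) linarith+
    finally have gg: "g\<^sup>2 / 2 \<le> p * W\<^sup>2" by simp
    define \<rho> where "\<rho> = exp (- g)"
    have rho: "0 < \<rho>" "\<rho> \<le> 1" using g0 by (auto simp: \<rho>_def)
    have Mr: "M (y - 1) * M (y + 1) / (M y)\<^sup>2 = \<rho>"
    proof -
      have "\<rho> = exp (ln (M (y - 1))) * exp (ln (M (y + 1))) / (exp (ln (M y)) * exp (ln (M y)))"
        unfolding \<rho>_def g_def by (simp only: exp_add[symmetric] exp_diff[symmetric]) (simp add: algebra_simps)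
      then show ?thesis using Mp by (simp add: power2_eq_square)
    qed
    define q where "q = (1 + d1) * (1 + d3) / (1 + d2)\<^sup>2"
    have "\<Theta> k j = \<rho> * q"
      unfolding broken_diamond_ratio_def d(2,4,6) Mr[symmetric] q_def by (simp add: power_mult_distrib mult_ac)
    moreover have "\<bar>\<rho> * q - \<rho>\<bar> \<le> 5 * e"
    proof -
      have "\<bar>q - 1\<bar> \<le> 5 * e" unfolding q_def by (rule ratio_perturbation[OF e(1,3) d(1,3,5)])
      then have "\<rho> * \<bar>q - 1\<bar> \<le> 1 * (5 * e)" using rho by (intro mult_mono) auto
      moreover have "\<bar>\<rho> * q - \<rho>\<bar> = \<rho> * \<bar>q - 1\<bar>"
      proof -
        have "\<rho> * q - \<rho> = \<rho> * (q - 1)" by (simp add: algebra_simps)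
        then show ?thesis using rho(1) by (simp only: abs_mult abs_of_pos)
      qed
      ultimately show ?thesis by simp
    qed
    ultimately have "\<bar>\<Theta> k j - \<rho>\<bar> \<le> 5 * e" by simp
    moreover have "g - g\<^sup>2 / 2 \<le> 1 - \<rho>" "1 - \<rho> \<le> g" unfolding \<rho>_def using one_minus_exp_neg_bounds[OF g0] by auto
    moreover have "p * (1 - 5 * W - 97 * W\<^sup>2) = p * (1 - 5 * W - 75 * W\<^sup>2) - 22 * (p * W\<^sup>2)"
      "p * (1 - 5 * W + 33 * W\<^sup>2) = p * (1 - 5 * W + 13 * W\<^sup>2) + 20 * (p * W\<^sup>2)" by (simp_all add: algebra_simps)
    moreover have "0 \<le> p * W\<^sup>2" using pp by simp
    ultimately show ?thesis using g1 g2 gg e(2) by linarith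
  qed
  define l r where "l = p * (1 - 5 * W - 97 * W\<^sup>2)" and "r = p * (1 - 5 * W + 33 * W\<^sup>2)"
  have l: "94 / 100 * p \<le> l"
  proof -
    have "94 / 100 \<le> 1 - 5 * W - 97 * W\<^sup>2" using ww W100 by linarith
    then have "p * (94 / 100) \<le> l" unfolding l_def using pp by (intro mult_left_mono) auto
    then show ?thesis by (simp add: mult.commute)
  qed
  have r: "0 \<le> r" "r \<le> p"
  proof -
    have "0 \<le> 1 - 5 * W + 33 * W\<^sup>2" "1 - 5 * W + 33 * W\<^sup>2 \<le> 1" using ww W100 Wp zero_le_power2[of W] by linarith+
    then have "0 \<le> r" "r \<le> p * 1" unfolding r_def using pp by (auto intro!: mult_nonneg_nonneg mult_left_mono simp del: mult_1_right)
    then show "0 \<le> r" "r \<le> p" by auto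
  qed
  have gap: "(r - l)\<^sup>2 + r ^ 4 < 4 * l ^ 3"
  proof -
    \<comment> \<open>130 = 97 + 33. One factor W \<le> 1 / 100 brings the squared length down to
      about 2.91 p^3, against 4 l^3 \<ge> 3.32 p^3; the fourth power of r is negligible.\<close>
    have "r - l = 130 * (p * W\<^sup>2)" by (simp add: l_def r_def algebra_simps)
    then have "(r - l)\<^sup>2 = 16900 * p\<^sup>2 * (W * W ^ 3)" by (simp add: power2_eq_square eval_nat_numeral)
    also have "\<dots> \<le> 16900 * p\<^sup>2 * (1 / 100 * (p / 58))"
      using p1(1) W100 Wp by (intro mult_left_mono mult_mono) auto
    also have "\<dots> = 169 / 58 * p ^ 3" by (simp add: power2_eq_square eval_nat_numeral)
    finally have 1: "(r - l)\<^sup>2 \<le> 169 / 58 * p ^ 3" .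
    have "W ^ 3 \<le> (1 / 100) ^ 3" using Wp W100 by (intro power_mono) auto
    then have "p \<le> 1 / 1000" using p1(2) by (simp add: power_divide)
    then have "p ^ 3 * p \<le> p ^ 3 * (1 / 1000)" using pp by (intro mult_left_mono) auto
    moreover have "r ^ 4 \<le> p ^ 4" using r by (intro power_mono) auto
    moreover have "p ^ 4 = p ^ 3 * p" by (simp add: eval_nat_numeral)
    ultimately have 2: "r ^ 4 \<le> 1 / 1000 * p ^ 3" by linarith
    have "((94 / 100) * p) ^ 3 \<le> l ^ 3" using l pp by (intro power_mono) auto
    moreover have "((94 / 100) * p) ^ 3 = 103823 / 125000 * p ^ 3" by (simp add: power_mult_distrib power_divide)
    ultimately have "83 / 100 * p ^ 3 \<le> l ^ 3" using zero_less_power[OF pp, of 3] by linarith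
    moreover have "p ^ 3 > 0" using pp by simp
    ultimately show ?thesis using 1 2 by linarith
  qed
  have b1: "l \<le> 1 - \<Theta> k n" "1 - \<Theta> k n \<le> r" using bounds[of n 0] by (auto simp: l_def r_def)
  have b2: "l \<le> 1 - \<Theta> k (n + 1)" "1 - \<Theta> k (n + 1) \<le> r" using bounds[of "n + 1" 1] by (auto simp: l_def r_def)
  have "0 < l" using l pp by simp
  from turan_from_bounds[OF this b1 b2 gap] show ?thesis by simp
qed

section \<open>The inequality for small arguments\<close>

text \<open>
  A sparse series with constant term 1 and all other coefficients in \<open>{-1, 0, 1}\<close> is encoded by a list of taps, which
  runs through the coefficients from degree 1 on. The functions below are defined by pattern matching as far as
  possible, since the simplifier traverses all arguments of a conditional anew.
\<close>

datatype tap = Skip | Skip2 | Skip4 | Skip8 | Plus | Minus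

fun skip_by :: "tap \<Rightarrow> nat \<Rightarrow> tap list \<Rightarrow> tap list" where
  "skip_by t 0 cs = cs"
| "skip_by t (Suc n) cs = t # skip_by t n cs"

text \<open>A gap is covered by steps of 8 and at most one step each of 4, 2 and 1, which keeps a
  list of taps far shorter than the degree it reaches.\<close>

definition skips :: "nat \<Rightarrow> tap list \<Rightarrow> tap list" where
  "skips n cs = skip_by Skip8 (n div 8)
     (skip_by Skip4 (n mod 8 div 4) (skip_by Skip2 (n mod 4 div 2) (skip_by Skip (n mod 2) cs)))"

text \<open>The exponents j (3 j - 1) / 2 and j (3 j + 1) / 2 are j apart, and the next pair starts
  2 j + 1 later; the subtracted 1 is the degree consumed by the tap itself. Signs alternate from
  pair to pair, hence the exchange of \<open>t\<close> and \<open>t'\<close>.\<close>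

fun pentagonal_taps_from :: "nat \<Rightarrow> nat \<Rightarrow> nat \<Rightarrow> tap \<Rightarrow> tap \<Rightarrow> tap list" where
  "pentagonal_taps_from d 0 j t t' = []"
| "pentagonal_taps_from d (Suc n) j t t' =
     t # skips (d * j - 1) (t # skips (d * (2 * j + 1) - 1) (pentagonal_taps_from d n (j + 1) t' t))"

text \<open>With T pairs the series is exact below degree d (T + 1)^2. For d = 1 the value 27^2 =
  729 exceeds 722, and the generous summand 8 settles d = 2, 3, 5, 6, 10 by one formula.\<close>

definition pentagonal_length :: "nat \<Rightarrow> nat" where
  "pentagonal_length d = (if d = 1 then 26 else 26 div d + 8)"

definition pentagonal_taps :: "nat \<Rightarrow> tap \<Rightarrow> tap \<Rightarrow> tap list" where
  "pentagonal_taps d t t' = skips (d - 1) (pentagonal_taps_from d (pentagonal_length d) 1 t t')"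

text \<open>The second list holds the earlier coefficients, latest first. The last equation also
  stops in the middle of a long skip: all further taps would meet negative degrees.\<close>

fun subtract_taps :: "tap list \<Rightarrow> int list \<Rightarrow> int \<Rightarrow> int" where
  "subtract_taps (Skip # cs) (b # bs) s = subtract_taps cs bs s"
| "subtract_taps (Skip2 # cs) (b1 # b2 # bs) s = subtract_taps cs bs s"
| "subtract_taps (Skip4 # cs) (b1 # b2 # b3 # b4 # bs) s = subtract_taps cs bs s"
| "subtract_taps (Skip8 # cs) (b1 # b2 # b3 # b4 # b5 # b6 # b7 # b8 # bs) s = subtract_taps cs bs s"
| "subtract_taps (Plus # cs) (b # bs) s = subtract_taps cs bs (s - b)"
| "subtract_taps (Minus # cs) (b # bs) s = subtract_taps cs bs (s + b)"
| "subtract_taps _ _ s = s"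

fun deconvolve :: "tap list \<Rightarrow> int list \<Rightarrow> int list \<Rightarrow> int list" where
  "deconvolve cs [] acc = rev acc"
| "deconvolve cs (f # fs) acc = deconvolve cs fs (subtract_taps cs acc f # acc)"

text \<open>With C the series of the taps, \<open>deconvolve\<close> solves (1 + C) B = F, whereas
  the subtraction here computes (1 - C) F. Multiplication by a pentagonal series therefore takes the
  taps with opposite signs.\<close>

fun convolve :: "tap list \<Rightarrow> int list \<Rightarrow> int list \<Rightarrow> int list" where
  "convolve cs [] acc = []"
| "convolve cs (f # fs) acc = subtract_taps cs acc f # convolve cs fs (f # acc)"

definition diamond_list :: "nat \<Rightarrow> nat \<Rightarrow> int list" where
  "diamond_list m N =
     deconvolve (pentagonal_taps 1 Minus Plus) (deconvolve (pentagonal_taps 1 Minus Plus) (deconvolve (pentagonal_taps 1 Minus Plus)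
       (deconvolve (pentagonal_taps (2 * m) Minus Plus)
         (convolve (pentagonal_taps m Plus Minus) (convolve (pentagonal_taps 2 Plus Minus) (1 # replicate N 0) []) []) []) []) []) []"

text \<open>For \<open>0 \<le> r < b\<close>, \<open>quotient_bits k r b q\<close> appends the first \<open>k\<close> binary digits of \<open>r / b\<close> to \<open>q\<close>.\<close>

fun quotient_bits :: "nat \<Rightarrow> int \<Rightarrow> int \<Rightarrow> int \<Rightarrow> int"
  and quotient_bits_step :: "nat \<Rightarrow> int \<Rightarrow> int \<Rightarrow> int \<Rightarrow> int \<Rightarrow> int" where
  "quotient_bits 0 r b q = q"
| "quotient_bits (Suc k) r b q = quotient_bits_step k (r + r - b) (r + r) b (q + q)"
| "quotient_bits_step k d r b q = (if d < 0 then quotient_bits k r b q else quotient_bits k d b (q + 1))"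

fun ratio_list :: "int list \<Rightarrow> int list" where
  "ratio_list (a # b # xs) = quotient_bits 36 (b - a) a 0 # ratio_list (b # xs)"
| "ratio_list _ = []"

text \<open>Provides 0 \<le> b - a < a, the condition under which \<open>quotient_bits\<close>
  produces digits in \<open>ratio_list\<close>.\<close>

fun slow_growth :: "int list \<Rightarrow> bool" where
  "slow_growth (a # b # xs) \<longleftrightarrow> 0 \<le> b - a \<and> b - a - a < 0 \<and> slow_growth (b # xs)"
| "slow_growth _ \<longleftrightarrow> True"

text \<open>
  With \<open>\<rho> n = \<Delta> k (n + 1) / \<Delta> k n\<close> the claim reads \<open>\<rho> n (\<rho> (n - 1) - \<rho> (n + 1))\<^sup>2 < 4 \<rho> (n - 1) (\<rho> (n - 1) - \<rho> n) (\<rho> n - \<rho> (n + 1))\<close>.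
  The test receives the first 36 binary digits of consecutive values of \<open>\<rho> - 1\<close>; \<open>p\<close> and \<open>r\<close> bound the scaled differences
  from below, and \<open>p + r + 3\<close> bounds their sum from above.
\<close>

definition turan_test :: "int \<Rightarrow> int \<Rightarrow> int \<Rightarrow> int \<Rightarrow> bool" where
  "turan_test x y p r \<longleftrightarrow> 0 \<le> p \<and> 0 \<le> r \<and> (2 ^ 36 + y + 1) * ((p + r + 3) * (p + r + 3)) \<le> 4 * ((2 ^ 36 + x) * (p * r))"

fun turan_check :: "int list \<Rightarrow> bool" where
  "turan_check (x # y # z # xs) \<longleftrightarrow> turan_test x y (x - y - 1) (y - z - 1) \<and> turan_check (y # z # xs)"
| "turan_check _ \<longleftrightarrow> True"

definition diamond_check :: "int list \<Rightarrow> bool" where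
  "diamond_check xs \<longleftrightarrow> slow_growth xs \<and> turan_check (ratio_list xs)"

section \<open>Correctness of the sparse convolutions\<close>

fun tap_fps :: "tap list \<Rightarrow> real fps" where
  "tap_fps [] = 0"
| "tap_fps (Skip # cs) = fps_X * tap_fps cs"
| "tap_fps (Skip2 # cs) = fps_X ^ 2 * tap_fps cs"
| "tap_fps (Skip4 # cs) = fps_X ^ 4 * tap_fps cs"
| "tap_fps (Skip8 # cs) = fps_X ^ 8 * tap_fps cs"
| "tap_fps (Plus # cs) = fps_X * (1 + tap_fps cs)"
| "tap_fps (Minus # cs) = fps_X * (- 1 + tap_fps cs)"

lemma tap_fps_skips: "tap_fps (skips n cs) = fps_X ^ n * tap_fps cs"
proof -
  have rep: "tap_fps (skip_by t k ds) = fps_X ^ (w * k) * tap_fps ds"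
    if "\<And>es. tap_fps (t # es) = fps_X ^ w * tap_fps es" for t w k ds
    by (induction k) (simp_all add: that power_add mult_ac)
  have "8 * (n div 8) + (4 * (n mod 8 div 4) + (2 * (n mod 4 div 2) + 1 * (n mod 2))) = n"
    using mult_div_mod_eq[of 8 n] mult_div_mod_eq[of 4 "n mod 8"] mult_div_mod_eq[of 2 "n mod 4"]
      mod_mod_cancel[of 4 8 n] mod_mod_cancel[of 2 4 n] by simp
  moreover have "tap_fps (skip_by Skip k ds) = fps_X ^ (1 * k) * tap_fps ds"
    "tap_fps (skip_by Skip2 k ds) = fps_X ^ (2 * k) * tap_fps ds"
    "tap_fps (skip_by Skip4 k ds) = fps_X ^ (4 * k) * tap_fps ds"
    "tap_fps (skip_by Skip8 k ds) = fps_X ^ (8 * k) * tap_fps ds" for k ds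
    by (rule rep, simp)+
  ultimately show ?thesis
    unfolding skips_def by (simp only: mult.assoc[symmetric] power_add[symmetric] add.assoc)
qed

lemma tap_fps_flip:
  "tap_fps (pentagonal_taps_from d n j Plus Minus) = - tap_fps (pentagonal_taps_from d n j Minus Plus)"
proof (induction n arbitrary: j rule: less_induct)
  case (less n)
  show ?case
  proof (cases n)
    case (Suc n')
    from less.IH[of n' "j + 1"] Suc
    have IH: "tap_fps (pentagonal_taps_from d n' (j + 1) Plus Minus) = - tap_fps (pentagonal_taps_from d n' (j + 1) Minus Plus)"
      by simp
    have alg: "x * (1 + a * (x * (1 + b * s))) = - (x * (- 1 + a * (x * (- 1 + b * - s))))" for x a b s :: "real fps"
      by (simp add: algebra_simps)
    show ?thesis unfolding Suc pentagonal_taps_from.simps tap_fps.simps tap_fps_skips IH by (rule alg)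
  qed simp
qed

text \<open>The starting pair \<open>i\<close> is free for the induction. The power in front is the
  degree passed so far, one less than the first exponent of the pair because the next tap consumes
  that degree.\<close>

lemma tap_fps_pentagonal_taps_from:
  assumes "d > 0"
  shows "fps_X ^ (d * ((Suc i)\<^sup>2 + triangle i) - 1) * tap_fps (pentagonal_taps_from d n (Suc i) Minus Plus) =
    (\<Sum>t<n. (-1) ^ Suc t * ((fps_X ^ d) ^ ((Suc (i + t))\<^sup>2 + triangle (i + t)) + (fps_X ^ d) ^ ((Suc (i + t))\<^sup>2 + triangle (Suc (i + t)))))"
proof (induction n arbitrary: i)
  case (Suc n)
  let ?e = "d * ((Suc i)\<^sup>2 + triangle i)"
  let ?S = "tap_fps (pentagonal_taps_from d n (Suc (Suc i)) Minus Plus)"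
  let ?f = "\<lambda>i t. (-1) ^ Suc t * ((fps_X ^ d) ^ ((Suc (i + t))\<^sup>2 + triangle (i + t)) + (fps_X ^ d) ^ ((Suc (i + t))\<^sup>2 + triangle (Suc (i + t)))) :: real fps"
  have e: "?e > 0" using assms by simp
  have p1: "fps_X ^ (?e - 1) * fps_X = (fps_X ^ ?e :: real fps)"
    using e by (metis power_minus_mult)
  have p2: "fps_X * fps_X ^ (d * Suc i - 1) = (fps_X ^ (d * Suc i) :: real fps)"
    using assms by (metis power_minus_mult mult.commute mult_pos_pos zero_less_Suc)
  have e2: "?e + d * Suc i = d * ((Suc i)\<^sup>2 + triangle (Suc i))" by (simp add: algebra_simps)
  have e3: "?e + d * Suc i + d * (2 * Suc i + 1) = d * ((Suc (Suc i))\<^sup>2 + triangle (Suc i))"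
    by (simp add: power2_eq_square algebra_simps)
  have e3p: "?e + d * Suc i + (d * (2 * Suc i + 1) - 1) = d * ((Suc (Suc i))\<^sup>2 + triangle (Suc i)) - 1"
    unfolding e3[symmetric] using assms by simp
  have flip: "tap_fps (pentagonal_taps_from d n (Suc i + 1) Plus Minus) = - ?S"
    using tap_fps_flip[of d n "Suc (Suc i)"] by simp
  have alg: "a * (x * (- 1 + b * (x * (- 1 + c * - s)))) = - (a * x) - (a * x) * (x * b) - (a * x) * (x * b) * (c * s)"
    for a x b c s :: "real fps" by (simp add: algebra_simps)
  have "fps_X ^ (?e - 1) * tap_fps (pentagonal_taps_from d (Suc n) (Suc i) Minus Plus) =
     - (fps_X ^ (?e - 1) * fps_X) - (fps_X ^ (?e - 1) * fps_X) * (fps_X * fps_X ^ (d * Suc i - 1))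
      - (fps_X ^ (?e - 1) * fps_X) * (fps_X * fps_X ^ (d * Suc i - 1)) * (fps_X ^ (d * (2 * Suc i + 1) - 1) * ?S)"
    unfolding pentagonal_taps_from.simps tap_fps.simps tap_fps_skips flip by (rule alg)
  also have "\<dots> = - (fps_X ^ ?e) - fps_X ^ (?e + d * Suc i) - fps_X ^ (?e + d * Suc i + (d * (2 * Suc i + 1) - 1)) * ?S"
    unfolding p1 p2 power_add by (simp only: mult.assoc)
  also have "\<dots> = - (fps_X ^ ?e) - fps_X ^ (d * ((Suc i)\<^sup>2 + triangle (Suc i))) - (\<Sum>t<n. ?f (Suc i) t)"
    unfolding e3p unfolding e2 Suc.IH[of "Suc i"] ..
  also have "(\<Sum>t<n. ?f (Suc i) t) = - (\<Sum>t<n. ?f i (Suc t))"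
    unfolding sum_negf[symmetric] by (intro sum.cong refl) (simp only: power_Suc add_Suc add_Suc_right mult_minus_left mult_1_left minus_minus)
  also have "- (fps_X ^ ?e) - fps_X ^ (d * ((Suc i)\<^sup>2 + triangle (Suc i))) = ?f i 0"
    unfolding power_mult by (simp only: add_0_right power_Suc power_0 mult_1_right mult_minus1 minus_add_distrib diff_conv_add_uminus)
  finally show ?case unfolding sum.lessThan_Suc_shift by (simp only: diff_minus_eq_add)
qed simp

lemma tap_fps_pentagonal_taps:
  assumes "d > 0"
  shows "1 + tap_fps (pentagonal_taps d Minus Plus) = pentagonal_sum (fps_X ^ d) (pentagonal_length d)"
    and "1 - tap_fps (pentagonal_taps d Plus Minus) = pentagonal_sum (fps_X ^ d) (pentagonal_length d)"
proof -
  have "fps_X ^ (d - 1) * tap_fps (pentagonal_taps_from d n 1 Minus Plus) = pentagonal_sum (fps_X ^ d) n - 1" for n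
    using tap_fps_pentagonal_taps_from[OF assms, of 0 n]
    by (simp add: pentagonal_sum_def del: power_Suc triangle_Suc)
  then show 1: "1 + tap_fps (pentagonal_taps d Minus Plus) = pentagonal_sum (fps_X ^ d) (pentagonal_length d)"
    unfolding pentagonal_taps_def tap_fps_skips by simp
  have "tap_fps (pentagonal_taps d Plus Minus) = - tap_fps (pentagonal_taps d Minus Plus)"
    unfolding pentagonal_taps_def tap_fps_skips tap_fps_flip by simp
  then show "1 - tap_fps (pentagonal_taps d Plus Minus) = pentagonal_sum (fps_X ^ d) (pentagonal_length d)" using 1 by simp
qed

lemma subtract_taps_Nil [simp]: "subtract_taps cs [] s = s"
  by (cases "(cs, [] :: int list, s)" rule: subtract_taps.cases) simp_all

lemma subtract_taps_skip:
  "subtract_taps (Skip # cs) bs s = subtract_taps cs (drop 1 bs) s"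
  "subtract_taps (Skip2 # cs) bs s = subtract_taps cs (drop 2 bs) s"
  "subtract_taps (Skip4 # cs) bs s = subtract_taps cs (drop 4 bs) s"
  "subtract_taps (Skip8 # cs) bs s = subtract_taps cs (drop 8 bs) s"
proof -
  show "subtract_taps (Skip # cs) bs s = subtract_taps cs (drop 1 bs) s"
    by (cases "(Skip # cs, bs, s)" rule: subtract_taps.cases) simp_all
  show "subtract_taps (Skip2 # cs) bs s = subtract_taps cs (drop 2 bs) s"
    by (cases "(Skip2 # cs, bs, s)" rule: subtract_taps.cases) simp_all
  show "subtract_taps (Skip4 # cs) bs s = subtract_taps cs (drop 4 bs) s"
    by (cases "(Skip4 # cs, bs, s)" rule: subtract_taps.cases) simp_all
  show "subtract_taps (Skip8 # cs) bs s = subtract_taps cs (drop 8 bs) s"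
    by (cases "(Skip8 # cs, bs, s)" rule: subtract_taps.cases) simp_all
qed

text \<open>The head of \<open>acc\<close> has degree n - 1, which matches taps that begin at degree
  1. A skip of width w > n exhausts the list just as the factor \<open>fps_X ^ w\<close> kills the
  coefficient of degree n.\<close>

lemma tap_fps_mult_nth:
  assumes "map real_of_int acc = map (fps_nth B) (rev [0..<n])"
  shows "real_of_int (subtract_taps cs acc s) = real_of_int s - fps_nth (tap_fps cs * B) n"
  using assms
proof (induction cs arbitrary: acc n s)
  case (Cons c cs)
  have len: "length acc = n" using Cons.prems by (metis length_map length_rev length_upt diff_zero)
  have skip: ?case if "subtract_taps (c # cs) acc s = subtract_taps cs (drop w acc) s"
    "tap_fps (c # cs) = fps_X ^ w * tap_fps cs" for w
  proof -
    have "drop w (rev [0..<n]) = rev [0..<n - w]"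
      by (cases "w \<le> n") (simp_all add: drop_rev take_upt)
    then have "map real_of_int (drop w acc) = map (fps_nth B) (rev [0..<n - w])" using Cons.prems by (metis drop_map)
    from Cons.IH[OF this, of s]
    have IH: "real_of_int (subtract_taps cs (drop w acc) s) = real_of_int s - fps_nth (tap_fps cs * B) (n - w)" .
    have "fps_nth (tap_fps (c # cs) * B) n = (if n < w then 0 else fps_nth (tap_fps cs * B) (n - w))"
      unfolding that(2) mult.assoc by (rule fps_X_power_mult_nth)
    moreover have "drop w acc = []" if "n < w" using len that by simp
    ultimately show ?thesis using IH that(1) by (cases "n < w") simp_all
  qed
  show ?case
  proof (cases n)
    case 0
    then have "acc = []" using Cons.prems by simp
    with 0 show ?thesis by (cases c) (simp_all add: mult.assoc)
  next
    case (Suc n')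
    with Cons.prems obtain b bs where acc: "acc = b # bs" "real_of_int b = fps_nth B n'"
      "map real_of_int bs = map (fps_nth B) (rev [0..<n'])"
      by (cases acc) auto
    show ?thesis
    proof (cases c)
      case Skip
      show ?thesis unfolding Skip by (rule skip[of 1, unfolded Skip]) (simp_all add: subtract_taps_skip)
    next
      case Skip2
      show ?thesis unfolding Skip2 by (rule skip[of 2, unfolded Skip2]) (simp_all add: subtract_taps_skip)
    next
      case Skip4
      show ?thesis unfolding Skip4 by (rule skip[of 4, unfolded Skip4]) (simp_all add: subtract_taps_skip)
    next
      case Skip8
      show ?thesis unfolding Skip8 by (rule skip[of 8, unfolded Skip8]) (simp_all add: subtract_taps_skip)
    qed (use Cons.IH[OF acc(3)] acc(2) Suc in \<open>simp_all add: acc(1) mult.assoc distrib_right left_diff_distrib\<close>)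
  qed
qed simp

definition fps_prefix :: "int list \<Rightarrow> real fps \<Rightarrow> bool" where
  "fps_prefix fs F \<longleftrightarrow> map real_of_int fs = map (fps_nth F) [0..<length fs]"

lemma deconvolve_correct:
  assumes "map real_of_int acc = map (fps_nth B) (rev [0..<n])"
    and "map real_of_int fs = map (fps_nth ((1 + tap_fps cs) * B)) [n..<n + length fs]"
  shows "map real_of_int (deconvolve cs fs acc) = map (fps_nth B) [0..<n + length fs]"
  using assms
proof (induction fs arbitrary: acc n)
  case Nil
  then show ?case by (simp add: rev_map[symmetric])
next
  case (Cons f fs)
  have l: "[n..<n + length (f # fs)] = n # [Suc n..<Suc n + length fs]" by (simp add: upt_conv_Cons del: upt_Suc)
  have f: "real_of_int f = fps_nth ((1 + tap_fps cs) * B) n"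
    and fs: "map real_of_int fs = map (fps_nth ((1 + tap_fps cs) * B)) [Suc n..<Suc n + length fs]"
    using Cons.prems(2) unfolding l by simp_all
  have "real_of_int (subtract_taps cs acc f) = fps_nth B n"
    unfolding tap_fps_mult_nth[OF Cons.prems(1)] f by (simp add: distrib_right)
  then have "map real_of_int (subtract_taps cs acc f # acc) = map (fps_nth B) (rev [0..<Suc n])"
    using Cons.prems(1) by simp
  from Cons.IH[OF this fs] show ?case by simp
qed

lemma convolve_correct:
  assumes "map real_of_int acc = map (fps_nth F) (rev [0..<n])"
    and "map real_of_int fs = map (fps_nth F) [n..<n + length fs]"
  shows "map real_of_int (convolve cs fs acc) = map (fps_nth ((1 - tap_fps cs) * F)) [n..<n + length fs]"
  using assms
proof (induction fs arbitrary: acc n)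
  case (Cons f fs)
  have l: "[n..<n + length (f # fs)] = n # [Suc n..<Suc n + length fs]" by (simp add: upt_conv_Cons del: upt_Suc)
  have f: "real_of_int f = fps_nth F n" and fs: "map real_of_int fs = map (fps_nth F) [Suc n..<Suc n + length fs]"
    using Cons.prems(2) unfolding l by simp_all
  have "real_of_int (subtract_taps cs acc f) = fps_nth ((1 - tap_fps cs) * F) n"
    unfolding tap_fps_mult_nth[OF Cons.prems(1)] f by (simp add: left_diff_distrib)
  moreover have "map real_of_int (f # acc) = map (fps_nth F) (rev [0..<Suc n])"
    using Cons.prems(1) f by simp
  ultimately show ?case using Cons.IH[OF _ fs, of "f # acc"] unfolding l by simp
qed simp

lemma deconvolve_prefix:
  assumes "fps_prefix fs ((1 + tap_fps cs) * B)"
  shows "fps_prefix (deconvolve cs fs []) B" "length (deconvolve cs fs []) = length fs"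
proof -
  have m: "map real_of_int (deconvolve cs fs []) = map (fps_nth B) [0..<length fs]"
    using deconvolve_correct[of "[]" B 0 fs cs] assms by (simp add: fps_prefix_def)
  then show l: "length (deconvolve cs fs []) = length fs" by (metis length_map length_upt diff_zero)
  show "fps_prefix (deconvolve cs fs []) B" unfolding fps_prefix_def l by (rule m)
qed

lemma convolve_prefix:
  assumes "fps_prefix fs F"
  shows "fps_prefix (convolve cs fs []) ((1 - tap_fps cs) * F)" "length (convolve cs fs []) = length fs"
proof -
  have m: "map real_of_int (convolve cs fs []) = map (fps_nth ((1 - tap_fps cs) * F)) [0..<length fs]"
    using convolve_correct[of "[]" F 0 fs cs] assms by (simp add: fps_prefix_def)
  then show l: "length (convolve cs fs []) = length fs" by (metis length_map length_upt diff_zero)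
  show "fps_prefix (convolve cs fs []) ((1 - tap_fps cs) * F)" unfolding fps_prefix_def l by (rule m)
qed

lemma fps_prefix_cong:
  assumes "fps_prefix fs F" "\<And>n. n < length fs \<Longrightarrow> fps_nth F n = fps_nth G n"
  shows "fps_prefix fs G"
  using assms unfolding fps_prefix_def by simp

lemma pentagonal_sum_nth:
  assumes "d > 0" "n < d * (Suc T)\<^sup>2"
  shows "fps_nth (pentagonal_sum (fps_X ^ d :: 'a::comm_ring_1 fps) T) n = fps_nth (pentagonal_fps d) n"
proof -
  have "fps_nth (pentagonal_sum (fps_X ^ d :: 'a fps) (T + t)) n = fps_nth (pentagonal_sum (fps_X ^ d) T) n" for t
  proof (induction t)
    case (Suc t)
    have small: "fps_nth (fps_X ^ (d * ((Suc (T + t))\<^sup>2 + s)) :: 'a fps) n = 0" for s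
    proof -
      have "(Suc T)\<^sup>2 \<le> (Suc (T + t))\<^sup>2" by (intro power_mono) auto
      then have "d * (Suc T)\<^sup>2 \<le> d * ((Suc (T + t))\<^sup>2 + s)" by (intro mult_left_mono trans_le_add1) simp_all
      then have "n < d * ((Suc (T + t))\<^sup>2 + s)" using assms(2) by linarith
      then show ?thesis by (metis fps_X_power_nth nat_neq_iff)
    qed
    have sgn: "fps_nth ((-1) ^ k * h) n = (-1) ^ k * fps_nth h n" for h :: "'a fps" and k
      by (cases "even k") auto
    have "fps_nth (pentagonal_sum (fps_X ^ d :: 'a fps) (T + Suc t)) n = fps_nth (pentagonal_sum (fps_X ^ d) (T + t)) n"
      unfolding pentagonal_sum_def add_Suc_right
      by (simp only: sum.lessThan_Suc fps_add_nth power_mult[symmetric] sgn small) simp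
    with Suc.IH show ?case by simp
  qed simp
  from this[of n] pentagonal_sum_nth_stable[OF assms(1), of n "T + n", where 'a='a] show ?thesis by simp
qed

lemma pentagonal_length_nth:
  assumes "d \<in> {1, 2, 3, 5, 6, 10}" "n < 722"
  shows "fps_nth (pentagonal_sum (fps_X ^ d :: 'a::comm_ring_1 fps) (pentagonal_length d)) n = fps_nth (pentagonal_fps d) n"
proof (rule pentagonal_sum_nth)
  have "722 \<le> d * (Suc (pentagonal_length d))\<^sup>2" using assms(1) by (auto simp: pentagonal_length_def)
  then show "n < d * (Suc (pentagonal_length d))\<^sup>2" using assms(2) by linarith
qed (use assms in auto)

lemma fps_mult_nth_cong:
  assumes "\<And>i. i \<le> n \<Longrightarrow> fps_nth F i = fps_nth G i"
  shows "fps_nth (F * H) n = fps_nth (G * H) n"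
  using assms by (simp add: fps_mult_nth)

lemma diamond_list_prefix:
  assumes "N < 722" "m = 2 * k + 1" "m \<in> {3, 5}"
  shows "fps_prefix (diamond_list m N) (broken_diamond_gf k)" "length (diamond_list m N) = Suc N"
proof -
  let ?ds = "{1, 2, 3, 5, 6, 10} :: nat set"
  have P: "fps_nth (pentagonal_sum (fps_X ^ d) (pentagonal_length d) * F) n = fps_nth (pentagonal_fps d * F) n"
    if "n < Suc N" "d \<in> ?ds" for n d and F :: "real fps"
    using that assms(1) by (intro fps_mult_nth_cong pentagonal_length_nth) auto
  have conv: "fps_prefix (convolve (pentagonal_taps d Plus Minus) fs []) (pentagonal_fps d * F) \<and> length (convolve (pentagonal_taps d Plus Minus) fs []) = Suc N"
    if "fps_prefix fs F" "length fs = Suc N" "d \<in> ?ds" for fs d F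
  proof -
    have d: "d > 0" using that(3) by auto
    note c = convolve_prefix[OF that(1), of "pentagonal_taps d Plus Minus", unfolded tap_fps_pentagonal_taps[OF d] that(2)]
    show ?thesis using fps_prefix_cong[OF c(1)] c(2) P[OF _ that(3)] by simp
  qed
  have dec: "fps_prefix (deconvolve (pentagonal_taps d Minus Plus) fs []) F \<and> length (deconvolve (pentagonal_taps d Minus Plus) fs []) = Suc N"
    if "fps_prefix fs (pentagonal_fps d * F)" "length fs = Suc N" "d \<in> ?ds" for fs d F
  proof -
    have d: "d > 0" using that(3) by auto
    have "fps_prefix fs ((1 + tap_fps (pentagonal_taps d Minus Plus)) * F)"
      unfolding tap_fps_pentagonal_taps[OF d] using fps_prefix_cong[OF that(1)] that(2) P[OF _ that(3)] by simp
    from deconvolve_prefix[OF this] that(2) show ?thesis by simp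
  qed
  let ?P = "pentagonal_fps :: nat \<Rightarrow> real fps"
  have 0: "fps_prefix (1 # replicate N 0) 1"
    unfolding fps_prefix_def
  proof (rule nth_equalityI)
    fix i assume "i < length (map real_of_int (1 # replicate N 0))"
    then show "map real_of_int (1 # replicate N 0) ! i = map (fps_nth 1) [0..<length (1 # replicate N (0::int))] ! i"
      by (cases i) (simp_all del: upt_Suc)
  qed simp
  have len0: "length (1 # replicate N 0 :: int list) = Suc N" by simp
  have m: "m \<in> ?ds" "2 * m \<in> ?ds" "(1::nat) \<in> ?ds" "(2::nat) \<in> ?ds" using assms(3) by auto
  note 1 = conv[OF 0 len0 m(4)]
  note 2 = conv[OF conjunct1[OF 1] conjunct2[OF 1] m(1)]
  have e: "?P m * (?P 2 * 1) = ?P (2 * m) * (?P 1 * (?P 1 * (?P 1 * broken_diamond_gf k)))"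
  proof -
    have "2 * m = 4 * k + 2" using assms(2) by simp
    then show ?thesis using broken_diamond_gf_identity[of k] assms(2) by (simp add: power3_eq_cube mult_ac)
  qed
  note 3 = dec[OF conjunct1[OF 2, unfolded e] conjunct2[OF 2] m(2)]
  note 4 = dec[OF conjunct1[OF 3] conjunct2[OF 3] m(3)]
  note 5 = dec[OF conjunct1[OF 4] conjunct2[OF 4] m(3)]
  note 6 = dec[OF conjunct1[OF 5] conjunct2[OF 5] m(3)]
  show "fps_prefix (diamond_list m N) (broken_diamond_gf k)" "length (diamond_list m N) = Suc N"
    unfolding diamond_list_def using 6 by simp_all
qed

section \<open>The test on truncated binary quotients\<close>

lemma quotient_bits_eq:
  assumes "0 \<le> r" "r < b"
  shows "quotient_bits k r b q * b \<le> 2 ^ k * (q * b + r) \<and> 2 ^ k * (q * b + r) < (quotient_bits k r b q + 1) * b"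
  using assms
proof (induction k arbitrary: r q)
  case (Suc k)
  \<comment> \<open>The invariant of long division: doubling moves a factor 2 from the power into q
    b + r, and a subtraction of b from the remainder moves a unit into q.\<close>
  have e: "2 ^ Suc k * (q * b + r) = 2 ^ k * ((q + q) * b + (r + r))"
    and e': "(q + q) * b + (r + r) = (q + q + 1) * b + (r + r - b)" by (simp_all add: algebra_simps)
  show ?case
  proof (cases "r + r - b < 0")
    case True
    then have q: "quotient_bits (Suc k) r b q = quotient_bits k (r + r) b (q + q)"
      by (simp only: quotient_bits.simps quotient_bits_step.simps if_True)
    show ?thesis unfolding q e using Suc.IH[of "r + r" "q + q"] True Suc.prems by linarith
  next
    case False
    then have q: "quotient_bits (Suc k) r b q = quotient_bits k (r + r - b) b (q + q + 1)"
      by (simp only: quotient_bits.simps quotient_bits_step.simps if_False)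
    show ?thesis unfolding q e e' using Suc.IH[of "r + r - b" "q + q + 1"] False Suc.prems by linarith
  qed
qed (simp add: distrib_right)

lemma ratio_list_nth:
  assumes "slow_growth xs" "i + 1 < length xs"
  shows "0 < xs ! i" "xs ! i \<le> xs ! (i + 1)" "i < length (ratio_list xs)"
    "ratio_list xs ! i * xs ! i \<le> 2 ^ 36 * (xs ! (i + 1) - xs ! i)"
    "2 ^ 36 * (xs ! (i + 1) - xs ! i) < (ratio_list xs ! i + 1) * xs ! i"
proof -
  have "0 < xs ! i \<and> xs ! i \<le> xs ! (i + 1) \<and> i < length (ratio_list xs) \<and>
    ratio_list xs ! i * xs ! i \<le> 2 ^ 36 * (xs ! (i + 1) - xs ! i) \<and>
    2 ^ 36 * (xs ! (i + 1) - xs ! i) < (ratio_list xs ! i + 1) * xs ! i"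
    using assms
  proof (induction i arbitrary: xs)
    case 0
    then obtain a b ys where xs: "xs = a # b # ys" by (cases xs; cases "tl xs") auto
    have "0 \<le> b - a" "b - a < a" using 0 unfolding xs by auto
    from this quotient_bits_eq[OF this, of 36 0] show ?case
      unfolding xs ratio_list.simps nth_Cons_0 by (simp del: quotient_bits.simps)
  next
    case (Suc i)
    then obtain a b ys where xs: "xs = a # b # ys" by (cases xs; cases "tl xs") auto
    have "slow_growth (b # ys)" "i + 1 < length (b # ys)" using Suc.prems unfolding xs by auto
    from Suc.IH[OF this] show ?case unfolding xs by simp
  qed
  then show "0 < xs ! i" "xs ! i \<le> xs ! (i + 1)" "i < length (ratio_list xs)"
    "ratio_list xs ! i * xs ! i \<le> 2 ^ 36 * (xs ! (i + 1) - xs ! i)"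
    "2 ^ 36 * (xs ! (i + 1) - xs ! i) < (ratio_list xs ! i + 1) * xs ! i" by auto
qed

lemma turan_check_nth:
  assumes "turan_check xs" "i + 2 < length xs"
  shows "turan_test (xs ! i) (xs ! (i + 1)) (xs ! i - xs ! (i + 1) - 1) (xs ! (i + 1) - xs ! (i + 2) - 1)"
  using assms
proof (induction i arbitrary: xs)
  case 0
  then obtain x y z ys where "xs = x # y # z # ys" by (cases xs; cases "tl xs"; cases "tl (tl xs)") auto
  with 0 show ?case by simp
next
  case (Suc i)
  then obtain x y z ys where xs: "xs = x # y # z # ys" by (cases xs; cases "tl xs"; cases "tl (tl xs)") auto
  have "turan_check (y # z # ys)" "i + 2 < length (y # z # ys)" using Suc.prems unfolding xs by auto
  from Suc.IH[OF this] show ?case unfolding xs by simp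
qed

text \<open>For consecutive quotients x, y, z of the sequence, y / x and z / y are consecutive
  values of \<Theta>; multiplication by x^2 y turns the hypothesis into the claim.\<close>

lemma turan_of_ratios:
  fixes x y z :: real
  assumes "x > 0" "y > 0" "y * (x - z)\<^sup>2 < 4 * x * (x - y) * (y - z)"
  shows "4 * (1 - y / x) * (1 - z / y) - (1 - y / x * (z / y))\<^sup>2 > 0"
proof -
  have "4 * (1 - y / x) * (1 - z / y) - (1 - y / x * (z / y))\<^sup>2 = (4 * x * (x - y) * (y - z) - y * (x - z)\<^sup>2) / (x\<^sup>2 * y)"
    using assms(1,2) by (simp add: divide_simps) (simp add: power2_eq_square algebra_simps)
  also have "\<dots> > 0" using assms by (intro divide_pos_pos) auto
  finally show ?thesis .
qed

text \<open>Truncation changes a difference of two scaled quotients by less than 1: x - y > X - Y -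
  1 and y - z > Y - Z - 1, while x - z < X - Z + 1, which is p + r + 3.\<close>

lemma turan_of_ratio_bounds:
  fixes x y z :: real and X Y Z :: int
  assumes t: "turan_test X Y (X - Y - 1) (Y - Z - 1)"
    and x: "2 ^ 36 + X \<le> x" "x < 2 ^ 36 + X + 1" and y: "2 ^ 36 + Y \<le> y" "y < 2 ^ 36 + Y + 1"
    and z: "2 ^ 36 + Z \<le> z" "z < 2 ^ 36 + Z + 1" and pos: "0 \<le> X" "0 < y"
  shows "y * (x - z)\<^sup>2 < 4 * x * (x - y) * (y - z)"
proof -
  define p r where "p = real_of_int (X - Y - 1)" and "r = real_of_int (Y - Z - 1)"
  have t': "0 \<le> X - Y - 1" "0 \<le> Y - Z - 1"
    "(2 ^ 36 + Y + 1) * (((X - Y - 1) + (Y - Z - 1) + 3) * ((X - Y - 1) + (Y - Z - 1) + 3)) \<le> 4 * ((2 ^ 36 + X) * ((X - Y - 1) * (Y - Z - 1)))"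
    using t unfolding turan_test_def by auto
  have pr: "0 \<le> p" "0 \<le> r" using t'(1,2) unfolding p_def r_def by linarith+
  have "real_of_int ((2 ^ 36 + Y + 1) * (((X - Y - 1) + (Y - Z - 1) + 3) * ((X - Y - 1) + (Y - Z - 1) + 3)))
     \<le> real_of_int (4 * ((2 ^ 36 + X) * ((X - Y - 1) * (Y - Z - 1))))"
    using t'(3) by (simp only: of_int_le_iff)
  then have test: "(2 ^ 36 + real_of_int Y + 1) * (p + r + 3)\<^sup>2 \<le> 4 * (2 ^ 36 + real_of_int X) * (p * r)"
    unfolding p_def r_def power2_eq_square of_int_mult of_int_add of_int_power of_int_numeral of_int_1 by (simp only: mult.assoc)
  have d: "p \<le> x - y" "r \<le> y - z" "0 \<le> x - z" "x - z \<le> p + r + 3"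
    using x y z pr unfolding p_def r_def by auto
  have "y * (x - z)\<^sup>2 \<le> y * (p + r + 3)\<^sup>2" using d pos by (intro mult_left_mono power_mono) auto
  also have "\<dots> < (2 ^ 36 + real_of_int Y + 1) * (p + r + 3)\<^sup>2" using y pr by (intro mult_strict_right_mono) auto
  also note test
  also have "4 * (2 ^ 36 + real_of_int X) * (p * r) \<le> 4 * x * ((x - y) * (y - z))"
    using x d pr pos by (intro mult_mono) auto
  finally show ?thesis by (simp only: mult.assoc)
qed

text \<open>The shortened list starts at degree 5, the smallest index in \<Theta> k 6, and ends at
  degree 701, the largest one in \<Theta> k 700; its entry i is the coefficient of degree i +
  5.\<close>

lemma broken_diamond_turan_small:
  assumes "diamond_check (drop 5 (diamond_list m 701))" "m = 2 * k + 1" "m \<in> {3, 5}" and n: "6 \<le> n" "n < 700"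
  shows "4 * (1 - \<Theta> k n) * (1 - \<Theta> k (n + 1)) - (1 - \<Theta> k n * \<Theta> k (n + 1))\<^sup>2 > 0"
proof -
  let ?D = "diamond_list m 701"
  let ?xs = "drop 5 ?D"
  have pre: "fps_prefix ?D (broken_diamond_gf k)" "length ?D = 702"
    using diamond_list_prefix[of 701 m k] assms(2,3) by auto
  have "map real_of_int ?D = map (\<Delta> k) [0..<702]"
    using pre unfolding fps_prefix_def by (simp add: broken_diamond_def[abs_def])
  then have "map real_of_int ?D ! j = map (\<Delta> k) [0..<702] ! j" for j by simp
  then have D: "real_of_int (?D ! j) = \<Delta> k j" if "j < 702" for j
    using that pre(2) by (metis add_0 diff_zero length_upt nth_map nth_upt)
  have len: "length ?xs = 697" using pre(2) by simp
  have xs: "real_of_int (?xs ! i) = \<Delta> k (i + 5)" if "i < 697" for i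
    using that D[of "i + 5"] pre(2) by (simp add: add.commute)
  have sg: "slow_growth ?xs" "turan_check (ratio_list ?xs)" using assms(1) unfolding diamond_check_def by auto
  define \<rho> where "\<rho> j = \<Delta> k (j + 1) / \<Delta> k j" for j
  define R where "R i = ratio_list ?xs ! i" for i
  have pos: "0 < \<Delta> k (i + 5)" and low: "2 ^ 36 + R i \<le> 2 ^ 36 * \<rho> (i + 5)" and up: "2 ^ 36 * \<rho> (i + 5) < 2 ^ 36 + R i + 1"
    and R0: "\<Delta> k (i + 5) \<le> \<Delta> k (i + 6)" and li: "i < length (ratio_list ?xs)" if "i < 696" for i
  proof -
    have i: "i + 1 < length ?xs" using that len by simp
    note r = ratio_list_nth[OF sg(1) i, folded R_def]
    have a: "real_of_int (?xs ! i) = \<Delta> k (i + 5)" "real_of_int (?xs ! (i + 1)) = \<Delta> k (i + 6)"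
      using xs[of i] xs[of "i + 1"] that by (auto simp: add.commute)
    show p: "0 < \<Delta> k (i + 5)" using r(1) unfolding a(1)[symmetric] by simp
    show "\<Delta> k (i + 5) \<le> \<Delta> k (i + 6)" using r(2) unfolding a[symmetric] by simp
    show "i < length (ratio_list ?xs)" by (rule r(3))
    have "real_of_int (R i * ?xs ! i) \<le> real_of_int (2 ^ 36 * (?xs ! (i + 1) - ?xs ! i))"
      "real_of_int (2 ^ 36 * (?xs ! (i + 1) - ?xs ! i)) < real_of_int ((R i + 1) * ?xs ! i)"
      using r(4,5) by (simp_all only: of_int_le_iff of_int_less_iff)
    then have b: "R i * \<Delta> k (i + 5) \<le> 2 ^ 36 * (\<Delta> k (i + 6) - \<Delta> k (i + 5))"
      "2 ^ 36 * (\<Delta> k (i + 6) - \<Delta> k (i + 5)) < (R i + 1) * \<Delta> k (i + 5)"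
      using a by simp_all
    have e: "\<rho> (i + 5) = \<Delta> k (i + 6) / \<Delta> k (i + 5)" by (simp add: \<rho>_def eval_nat_numeral)
    show "2 ^ 36 + R i \<le> 2 ^ 36 * \<rho> (i + 5)" "2 ^ 36 * \<rho> (i + 5) < 2 ^ 36 + R i + 1"
      unfolding e using b p by (simp_all add: pos_le_divide_eq pos_divide_less_eq algebra_simps)
  qed
  define i where "i = n - 6"
  have i: "n - 1 = i + 5" "n = i + 1 + 5" "n + 1 = i + 2 + 5" "i < 694" using n by (auto simp: i_def)
  have il: "i + 2 < length (ratio_list ?xs)" using li[of "i + 2"] i(4) by simp
  note test = turan_check_nth[OF sg(2) il, folded R_def]
  \<comment> \<open>Negative digits would force a quotient below 1, against the monotonicity checked
    by \<open>slow_growth\<close>.\<close>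
  have "0 \<le> R i"
  proof (rule ccontr)
    assume "\<not> 0 \<le> R i"
    then have "R i + 1 \<le> 0" by simp
    then have "real_of_int (R i) + 1 \<le> 0" by linarith
    moreover have "1 \<le> \<rho> (i + 5)" unfolding \<rho>_def using R0[of i] pos[of i] i(4) by (simp add: eval_nat_numeral)
    ultimately show False using up[of i] i(4) by simp
  qed
  have p: "0 < \<Delta> k (n - 1)" "0 < \<Delta> k n" "0 < \<Delta> k (n + 1)"
    using pos[of i] pos[of "i + 1"] pos[of "i + 2"] i(4) unfolding i by (auto simp: add_ac)
  \<comment> \<open>The digits describe the quotients scaled by 2^36; the scaling disappears again
    in \<Theta>, which is a quotient of quotients.\<close>
  define s :: real where "s = 2 ^ 36"
  have s: "s > 0" by (simp add: s_def)
  have rp: "0 < \<rho> (n - 1)" "0 < \<rho> n" unfolding \<rho>_def using p n by simp_all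
  have "(s * \<rho> n) * (s * \<rho> (n - 1) - s * \<rho> (n + 1))\<^sup>2 < 4 * (s * \<rho> (n - 1)) * (s * \<rho> (n - 1) - s * \<rho> n) * (s * \<rho> n - s * \<rho> (n + 1))"
  proof (rule turan_of_ratio_bounds[OF test])
    show "0 < s * \<rho> n" using s rp by simp
  qed (use low[of i, folded i(1)] up[of i, folded i(1)] low[of "i + 1", folded i(2)] up[of "i + 1", folded i(2)]
      low[of "i + 2", folded i(3)] up[of "i + 2", folded i(3)] i(4) \<open>0 \<le> R i\<close> in \<open>simp_all add: s_def\<close>)
  from turan_of_ratios[OF _ _ this]
  have "4 * (1 - (s * \<rho> n) / (s * \<rho> (n - 1))) * (1 - (s * \<rho> (n + 1)) / (s * \<rho> n)) -
     (1 - (s * \<rho> n) / (s * \<rho> (n - 1)) * ((s * \<rho> (n + 1)) / (s * \<rho> n)))\<^sup>2 > 0"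
    using s rp by simp
  moreover have "(s * \<rho> n) / (s * \<rho> (n - 1)) = \<Theta> k n" "(s * \<rho> (n + 1)) / (s * \<rho> n) = \<Theta> k (n + 1)"
    unfolding \<rho>_def broken_diamond_ratio_def using s p n by (simp_all add: field_simps power2_eq_square)
  ultimately show ?thesis by simp
qed

lemma diamond_check_3: "diamond_check (drop 5 (diamond_list 3 701))"
  by code_simp

lemma diamond_check_5: "diamond_check (drop 5 (diamond_list 5 701))"
  by code_simp

theorem theorem1p10:
  fixes k n :: nat
  assumes "k \<in> {1, 2}" and "n \<ge> 6"
  shows "4 * (1 - \<Theta> k n) * (1 - \<Theta> k (n + 1)) - (1 - \<Theta> k n * \<Theta> k (n + 1))\<^sup>2 > 0"
proof -
  define m where "m = 2 * k + 1"
  have m: "m \<in> {3, 5}" using assms(1) by (auto simp: m_def)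
  show ?thesis
  proof (cases "n < 700")
    case True
    have "diamond_check (drop 5 (diamond_list m 701))" using m diamond_check_3 diamond_check_5 by blast
    then show ?thesis using m_def m assms(2) True by (rule broken_diamond_turan_small)
  next
    case False
    then show ?thesis by (intro broken_diamond_turan_large[OF m_def m]) simp
  qed
qed

end
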